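(* There exist universal constants $\delta_0\in(0,1)$, $C_1>0$ and $\gamma>0$ such that the following holds. Let $R\le K\le N$ and $M, L$ be positive integers, and let $\Psi\in\mathbb{R}^{M\times N}$ satisfy the restricted isometry property $$(1-\delta_K)\|z_1-z_2\|_2^2\le\|\Psi(z_1-z_2)\|_2^2\le(1+\delta_K)\|z_1-z_2\|_2^2\quad\text{for all } K\text{-sparse } z_1,z_2\in\mathbb{R}^N,$$ with a constant $0<\delta_K\le\delta_0$. Let $w_1,\dots,w_L$ be independent $\mathrm{Normal}(0,I_M)$ random vectors. Suppose that $$L\ \ge\ C_1\cdot R\cdot M .$$ Then there are constants $c_1,c_2>0$ depending only on $\delta_K$, and a constant $C_2>0$ depending only on $c_1,c_2$ and $\delta_K$, such that with probability exceeding $1-e^{-\gamma M}$ over the draw of $w_1,\dots,w_L$ the following holds simultaneously for every symmetric positive semidefinite rank-$R$ matrix $\Sigma^\star\in\mathbb{R}^{N\times N}$ having at most $K$ nonzero rows, every $\varepsilon\ge 0$ and every noise vector $z\in\mathbb{R}^L$ with $\|z\|_2\le\varepsilon$: if $y=\mathcal{W}(\Psi\Sigma^\star\Psi^{\mathsf T})+z$, then any output $\widehat\Sigma=\widehat Q_2\widehat V^{\mathsf T}$ of the two-stage estimation procedure (described in the context) run on $y$ with parameters $\varepsilon,c_1,c_2$ satisfies $$\big\|\widehat\Sigma-\Sigma^\star\big\|_F\le\frac{C_2\,\varepsilon}{\sqrt L}.$$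
   Context: A vector is $K$-sparse if it has at most $K$ nonzero entries. $\|\cdot\|_F$ is the Frobenius norm. For a matrix $Z$ with $N$ rows, $\|Z\|_{1,2}=\sum_{n=1}^N\|Z_{n,:}\|_2$, where $Z_{n,:}$ is the $n$th row of $Z$. The linear operator $\mathcal{W}$ maps an $M\times M$ matrix $B$ to the vector $\mathcal{W}(B)=\big[w_\ell^{\mathsf T}Bw_\ell\big]_{\ell=1}^L\in\mathbb{R}^L$. The two-stage estimation procedure. Input: $y\in\mathbb{R}^L$, $\Psi\in\mathbb{R}^{M\times N}$, $w_1,\dots,w_L\in\mathbb{R}^M$, the rank $R$, the noise bound $\varepsilon$, and constants $c_1,c_2$. Stage 1 (low-rank estimation): let $\widehat B$ be any minimizer of $\operatorname{trace}(B)$ over symmetric positive semidefinite $B\in\mathbb{R}^{M\times M}$ subject to $\|\mathcal{W}(B)-y\|_2\le\varepsilon$. Stage 2a (sparse estimation): let $\widehat U\in\mathbb{R}^{M\times R}$ be a matrix whose columns are orthonormal eigenvectors of $\widehat B$ for its $R$ largest eigenvalues, and let $\widehat Q_1\in\mathbb{R}^{N\times R}$ be any minimizer of $\|Q\|_{1,2}$ over $Q\in\mathbb{R}^{N\times R}$ subject to $\|\Psi Q-\widehat B\widehat U\|_F\le c_1\varepsilon/\sqrt L$. Stage 2b (sparse estimation): let $\widehat V\in\mathbb{R}^{N\times R}$ be a matrix whose columns are orthonormal (top $R$) left singular vectors of $\widehat Q_1$, and let $\widehat Q_2\in\mathbb{R}^{N\times R}$ be any minimizer of $\|Q\|_{1,2}$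 over $Q\in\mathbb{R}^{N\times R}$ subject to $\|\Psi Q-\widehat U\widehat Q_1^{\mathsf T}\widehat V\|_F\le c_2\varepsilon/\sqrt L$. Output: $\widehat\Sigma=\widehat Q_2\widehat V^{\mathsf T}$. *)

theory Defs
  imports
    "HOL-Probability.Distributions"
    "Jordan_Normal_Form.Char_Poly"
    "Jordan_Normal_Form.DL_Rank"
begin

definition l2_norm :: "real Matrix.vec \<Rightarrow> real" where
  "l2_norm v = sqrt (scalar_prod v v)"

definition frobenius_norm :: "real Matrix.mat \<Rightarrow> real" where
  "frobenius_norm A = sqrt (\<Sum>i<dim_row A. \<Sum>j<dim_col A. (A $$ (i, j))\<^sup>2)"

definition norm_1_2 :: "real Matrix.mat \<Rightarrow> real" where
  "norm_1_2 Z = (\<Sum>n<dim_row Z. l2_norm (Matrix.row Z n))"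

definition trace_mat :: "real Matrix.mat \<Rightarrow> real" where
  "trace_mat A = (\<Sum>i<dim_row A. A $$ (i, i))"

definition sparse_vec :: "nat \<Rightarrow> real Matrix.vec \<Rightarrow> bool" where
  "sparse_vec K v \<longleftrightarrow> card {i. i < dim_vec v \<and> vec_index v i \<noteq> 0} \<le> K"

definition row_sparse :: "nat \<Rightarrow> real Matrix.mat \<Rightarrow> bool" where
  "row_sparse K A \<longleftrightarrow> card {i. i < dim_row A \<and> Matrix.row A i \<noteq> 0\<^sub>v (dim_col A)} \<le> K"

definition sym_psd :: "nat \<Rightarrow> real Matrix.mat \<Rightarrow> bool" where
  "sym_psd n A \<longleftrightarrow>
     A \<in> carrier_mat n n \<and> transpose_mat A = A \<and>
     (\<forall>x \<in> carrier_vec n. 0 \<le> scalar_prod x (A *\<^sub>v x))"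

definition rip :: "nat \<Rightarrow> nat \<Rightarrow> real Matrix.mat \<Rightarrow> real \<Rightarrow> bool" where
  "rip K N \<Psi> \<delta> \<longleftrightarrow>
     (\<forall>z\<^sub>1 \<in> carrier_vec N. \<forall>z\<^sub>2 \<in> carrier_vec N. sparse_vec K z\<^sub>1 \<longrightarrow> sparse_vec K z\<^sub>2 \<longrightarrow>
        (1 - \<delta>) * (l2_norm (z\<^sub>1 - z\<^sub>2))\<^sup>2 \<le> (l2_norm (\<Psi> *\<^sub>v (z\<^sub>1 - z\<^sub>2)))\<^sup>2 \<and>
        (l2_norm (\<Psi> *\<^sub>v (z\<^sub>1 - z\<^sub>2)))\<^sup>2 \<le> (1 + \<delta>) * (l2_norm (z\<^sub>1 - z\<^sub>2))\<^sup>2)"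

definition quad_meas :: "nat \<Rightarrow> (nat \<Rightarrow> real Matrix.vec) \<Rightarrow> real Matrix.mat \<Rightarrow> real Matrix.vec" where
  "quad_meas L w B = Matrix.vec L (\<lambda>l. scalar_prod (w l) (B *\<^sub>v w l))"

definition orthogonal_matrix_n :: "nat \<Rightarrow> real Matrix.mat \<Rightarrow> bool" where
  "orthogonal_matrix_n n P \<longleftrightarrow> P \<in> carrier_mat n n \<and> transpose_mat P * P = 1\<^sub>m n"

definition first_cols :: "nat \<Rightarrow> real Matrix.mat \<Rightarrow> real Matrix.mat" where
  "first_cols r P = Matrix.mat (dim_row P) r (\<lambda>(i, j). P $$ (i, j))"

text \<open>The columns of \<open>U\<close> are the first \<open>r\<close> members of an orthonormal eigenbasis. The eigenbasis
  counts eigenvalues with multiplicity, ties at the \<open>r\<close>-th eigenvalue may be broken arbitrarily,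
  and the order of the \<open>r\<close> selected columns is left free.\<close>

definition top_eigenvectors :: "nat \<Rightarrow> nat \<Rightarrow> real Matrix.mat \<Rightarrow> real Matrix.mat \<Rightarrow> bool" where
  "top_eigenvectors n r B U \<longleftrightarrow> r \<le> n \<and>
     (\<exists>P ev. orthogonal_matrix_n n P \<and>
        (\<forall>j<n. eigenvector B (Matrix.col P j) (ev j)) \<and>
        (\<forall>i j. i < r \<longrightarrow> r \<le> j \<longrightarrow> j < n \<longrightarrow> ev j \<le> ev i) \<and>
        U = first_cols r P)"

text \<open>The columns of \<open>V\<close> are the left singular vectors of the \<open>m \<times> n\<close> matrix \<open>A\<close> for its \<open>r\<close>
  largest singular values in some full singular value decomposition. As above, ties are broken
  arbitrarily; singular values may be zero.\<close>

definition top_left_singular_vectors ::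
  "nat \<Rightarrow> nat \<Rightarrow> nat \<Rightarrow> real Matrix.mat \<Rightarrow> real Matrix.mat \<Rightarrow> bool" where
  "top_left_singular_vectors m n r A V \<longleftrightarrow> r \<le> min m n \<and>
     (\<exists>P W sv. orthogonal_matrix_n m P \<and> orthogonal_matrix_n n W \<and>
        (\<forall>i < min m n. 0 \<le> sv i) \<and>
        A = P * Matrix.mat m n (\<lambda>(i, j). if i = j then sv i else 0) * transpose_mat W \<and>
        (\<forall>i j. i < r \<longrightarrow> r \<le> j \<longrightarrow> j < min m n \<longrightarrow> sv j \<le> sv i) \<and>
        V = first_cols r P)"

definition stage_1 ::
  "nat \<Rightarrow> nat \<Rightarrow> (nat \<Rightarrow> real Matrix.vec) \<Rightarrow> real Matrix.vec \<Rightarrow> real \<Rightarrow> real Matrix.mat \<Rightarrow> bool" where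
  "stage_1 M L w y \<epsilon> B \<longleftrightarrow>
     is_arg_min trace_mat (\<lambda>B. sym_psd M B \<and> l2_norm (quad_meas L w B - y) \<le> \<epsilon>) B"

definition sparse_program ::
  "nat \<Rightarrow> nat \<Rightarrow> real Matrix.mat \<Rightarrow> real Matrix.mat \<Rightarrow> real \<Rightarrow> real Matrix.mat \<Rightarrow> bool" where
  "sparse_program N R \<Psi> A \<tau> Q \<longleftrightarrow>
     is_arg_min norm_1_2 (\<lambda>Q. Q \<in> carrier_mat N R \<and> frobenius_norm (\<Psi> * Q - A) \<le> \<tau>) Q"

text \<open>\<open>S\<close> is a possible output of the two-stage procedure. It is a relation because the minimizers,
  eigenvectors and singular vectors need not be unique.\<close>

definition two_stage_output ::
  "nat \<Rightarrow> nat \<Rightarrow> nat \<Rightarrow> nat \<Rightarrow> real Matrix.mat \<Rightarrow> (nat \<Rightarrow> real Matrix.vec) \<Rightarrow> real Matrix.vec \<Rightarrow>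
   real \<Rightarrow> real \<Rightarrow> real \<Rightarrow> real Matrix.mat \<Rightarrow> bool" where
  "two_stage_output M N L R \<Psi> w y \<epsilon> c\<^sub>1 c\<^sub>2 S \<longleftrightarrow>
     (\<exists>B U Q\<^sub>1 V Q\<^sub>2.
        stage_1 M L w y \<epsilon> B \<and>
        top_eigenvectors M R B U \<and>
        sparse_program N R \<Psi> (B * U) (c\<^sub>1 * \<epsilon> / sqrt (real L)) Q\<^sub>1 \<and>
        top_left_singular_vectors N R R Q\<^sub>1 V \<and>
        sparse_program N R \<Psi> (U * transpose_mat Q\<^sub>1 * V) (c\<^sub>2 * \<epsilon> / sqrt (real L)) Q\<^sub>2 \<and>
        S = Q\<^sub>2 * transpose_mat V)"

text \<open>The joint law of \<open>L\<close> independent standard Gaussian vectors of length \<open>M\<close>: the inner product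
  measure is \<open>Normal(0, I)\<close> on vectors of length \<open>M\<close>, the outer one expresses independence.\<close>

definition gaussian_vectors :: "nat \<Rightarrow> nat \<Rightarrow> (nat \<Rightarrow> nat \<Rightarrow> real) measure" where
  "gaussian_vectors L M =
     PiM {..<L} (\<lambda>_. PiM {..<M} (\<lambda>_. density lborel (\<lambda>x. ennreal (std_normal_density x))))"

end

theory Submission
  imports Defs "Jordan_Normal_Form.Spectral_Radius"
begin

text \<open>Let \<open>B\<^sup>\<star> = \<Psi> \<Sigma>\<^sup>\<star> \<Psi>\<^sup>T\<close>, which has rank at most \<open>R\<close>. Differences of consecutive measurements
  satisfy \<open>a\<^sup>T X a - b\<^sup>T X b = (a + b)\<^sup>T X (a - b)\<close>, and \<open>a + b\<close>, \<open>a - b\<close> are independent Gaussian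
  vectors; so the normalised \<open>\<ell>\<^sub>1\<close>-norm of these differences is comparable to the Frobenius norm, first for
  a fixed \<open>X\<close> by Chernoff bounds, then for all matrices of rank \<open>O(R)\<close> by a net of cardinality \<open>exp (O (R M))\<close>.
  A trace minimiser differs from \<open>B\<^sup>\<star>\<close> by a matrix of rank \<open>O(R)\<close> plus a tail of eigenvectors with small trace,
  and cutting the tail into blocks of decreasing size bounds the error of stage 1. In stage 2 the matrices
  \<open>\<Sigma>\<^sup>\<star> \<Psi>\<^sup>T U\<close> and \<open>\<Sigma>\<^sup>\<star> V\<close> are row-sparse and feasible, because \<open>U\<close> nearly captures the range of \<open>B\<^sup>\<star>\<close>
  (Eckart-Young) and the restricted isometry property transfers this to \<open>\<Sigma>\<^sup>\<star>\<close>; the group-sparse version of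
  Candes' recovery argument then bounds the errors of both sparse programs.\<close>

section \<open>Orthonormal families and the spectral theorem\<close>

text \<open>The absolute values of the measurement differences are summed, not their squares: a
  Gaussian quadratic form has only exponential tails, so its square has no exponential moment and
  the upper Chernoff bound would be lost. The price is an isometry whose two constants, 8 and 1/24,
  are far apart; therefore the blocks of eigenvalues in the first stage are a large constant
  multiple of R long. All randomness sits in one event about matrices of rank O (R); on it
  everything is deterministic, hence uniform in \<Sigma>, \<epsilon> and z. In the second stage
  sparsity level K suffices, because the isometry is stated for differences of two K-sparse vectors
  and so controls vectors with 2 K nonzero entries. All estimates are made for \<delta> up to 1/10,
  so that \<open>c\<^sub>1\<close>, \<open>c\<^sub>2\<close>, \<open>C\<^sub>2\<close> become the
  absolute numbers 300, 2700, 19200. Vectors and matrices are functions on the naturals, of which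
  only arguments below the dimension count; zero padding and changes of dimension then need no
  conversions.\<close>

definition ip :: "nat \<Rightarrow> (nat \<Rightarrow> real) \<Rightarrow> (nat \<Rightarrow> real) \<Rightarrow> real" where
  "ip M x y = (\<Sum>a<M. x a * y a)"

definition frob2 :: "nat \<Rightarrow> (nat \<Rightarrow> nat \<Rightarrow> real) \<Rightarrow> real" where
  "frob2 M X = (\<Sum>a<M. \<Sum>b<M. (X a b)\<^sup>2)"

text \<open>Zero vectors are allowed as padding, so that the length of the family is only an upper
  bound for the dimension of its span.\<close>

definition orthfam :: "nat \<Rightarrow> nat \<Rightarrow> (nat \<Rightarrow> nat \<Rightarrow> real) \<Rightarrow> bool" where
  "orthfam M r q \<longleftrightarrow> (\<forall>i<r. \<forall>j<r. i \<noteq> j \<longrightarrow> ip M (q i) (q j) = 0) \<and>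
     (\<forall>i<r. ip M (q i) (q i) = 1 \<or> ip M (q i) (q i) = 0)"

text \<open>Symmetric matrices of rank at most \<open>r\<close> are kept in spectral form: the list
  of eigenpairs can be cut in two, and the bound \<open>c\<close> on the Euclidean norm of the
  coefficients passes to both pieces.\<close>

definition low_rank :: "nat \<Rightarrow> nat \<Rightarrow> real \<Rightarrow> (nat \<Rightarrow> nat \<Rightarrow> real) \<Rightarrow> bool" where
  "low_rank M r c X \<longleftrightarrow> (\<exists>\<mu> q. orthfam M r q \<and> (\<Sum>i<r. (\<mu> i)\<^sup>2) \<le> c\<^sup>2 \<and>
     (\<forall>a<M. \<forall>b<M. X a b = (\<Sum>i<r. \<mu> i * q i a * q i b)))"

section \<open>Bessel-type inequalities and Frobenius norms of outer products\<close>

lemma ip_commute: "ip M x y = ip M y x"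
  by (simp add: ip_def mult.commute)

lemma ip_self_nonneg [simp]: "0 \<le> ip M x x"
  by (auto simp: ip_def intro: sum_nonneg)

lemma ip_self: "ip M x x = (\<Sum>a<M. (x a)\<^sup>2)"
  by (simp add: ip_def power2_eq_square)

lemma ip_sum_right: "ip M x (\<lambda>a. \<Sum>i\<in>I. c i * f i a) = (\<Sum>i\<in>I. c i * ip M x (f i))"
  unfolding ip_def sum_distrib_left by (subst sum.swap) (simp add: algebra_simps)

lemma ip_sum_left: "ip M (\<lambda>a. \<Sum>i\<in>I. c i * f i a) x = (\<Sum>i\<in>I. c i * ip M (f i) x)"
  using ip_sum_right by (simp add: ip_commute)

lemma ip_Cauchy_Schwarz: "(ip M x y)\<^sup>2 \<le> ip M x x * ip M y y"
  unfolding ip_self unfolding ip_def by (rule Cauchy_Schwarz_ineq_sum)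

lemma frob2_nonneg [simp]: "0 \<le> frob2 M X"
  by (auto simp: frob2_def intro!: sum_nonneg)

lemma orthfam_bound:
  assumes "orthfam M r q" "i < r"
  shows "ip M (q i) (q i) \<le> 1"
  using assms by (auto simp: orthfam_def)

lemma orthfam_ip_basis:
  assumes "orthfam M r q" "i < r"
  shows "ip M (\<lambda>a. \<Sum>i<r. c i * q i a) (q i) = c i * ip M (q i) (q i)"
proof -
  have "ip M (q i) (\<lambda>a. \<Sum>i<r. c i * q i a) = (\<Sum>j<r. c j * ip M (q i) (q j))"
    by (rule ip_sum_right)
  also have "\<dots> = (\<Sum>j\<in>{i}. c j * ip M (q i) (q j))"
    by (rule sum.mono_neutral_right) (use assms in \<open>auto simp: orthfam_def\<close>)
  finally show ?thesis by (simp add: ip_commute)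
qed

lemma orthfam_ip_combination:
  assumes "orthfam M r q"
  shows "ip M (\<lambda>a. \<Sum>i<r. c i * q i a) (\<lambda>a. \<Sum>i<r. c i * q i a) = (\<Sum>i<r. (c i)\<^sup>2 * ip M (q i) (q i))"
proof -
  have "ip M (\<lambda>a. \<Sum>i<r. c i * q i a) (\<lambda>a. \<Sum>i<r. c i * q i a) =
      (\<Sum>i<r. c i * ip M (\<lambda>a. \<Sum>i<r. c i * q i a) (q i))"
    by (rule ip_sum_right)
  also have "\<dots> = (\<Sum>i<r. c i * (c i * ip M (q i) (q i)))"
    by (rule sum.cong) (use orthfam_ip_basis[OF assms] in auto)
  finally show ?thesis by (simp add: power2_eq_square mult.assoc)
qed

lemma orthfam_combination_le:
  assumes "orthfam M r q"
  shows "ip M (\<lambda>a. \<Sum>i<r. c i * q i a) (\<lambda>a. \<Sum>i<r. c i * q i a) \<le> (\<Sum>i<r. (c i)\<^sup>2)"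
  unfolding orthfam_ip_combination[OF assms]
  by (intro sum_mono) (use orthfam_bound[OF assms] in \<open>auto intro: mult_left_le\<close>)

lemma ip_diff: "ip M (\<lambda>a. x a - y a) (\<lambda>a. x a - y a) = ip M x x - 2 * ip M x y + ip M y y"
  by (simp add: ip_def algebra_simps sum.distrib sum_subtractf sum_distrib_left)

text \<open>The squared norm of \<open>q i\<close> is 1 or 0, and a padding vector has inner product
  0 with everything by Cauchy-Schwarz. This makes the formulas for orthonormal vectors hold in the
  presence of padding.\<close>

lemma orthfam_ip_projection:
  assumes "orthfam M r q" "i < r"
  shows "ip M x (q i) * ip M (q i) (q i) = ip M x (q i)"
proof -
  have "ip M x (q i) = 0" if "ip M (q i) (q i) = 0"
    using ip_Cauchy_Schwarz[of M x "q i"] that by simp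
  then show ?thesis using assms by (auto simp: orthfam_def)
qed

text \<open>Completing the square in each coefficient separately: the inner product with
  \<open>q i\<close> is the optimal choice. Arbitrary \<open>c\<close> is what the Eckart-Young
  bound needs, where the approximating matrix is not a projection of \<open>x\<close>.\<close>

lemma orthfam_ip_residual:
  assumes "orthfam M r q"
  shows "ip M (\<lambda>a. x a - (\<Sum>i<r. c i * q i a)) (\<lambda>a. x a - (\<Sum>i<r. c i * q i a)) \<ge>
    ip M x x - (\<Sum>i<r. (ip M x (q i))\<^sup>2)"
proof -
  have "ip M (\<lambda>a. x a - (\<Sum>i<r. c i * q i a)) (\<lambda>a. x a - (\<Sum>i<r. c i * q i a)) =
    ip M x x - 2 * (\<Sum>i<r. c i * ip M x (q i)) + (\<Sum>i<r. (c i)\<^sup>2 * ip M (q i) (q i))"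
    unfolding ip_diff orthfam_ip_combination[OF assms] unfolding ip_sum_right ..
  also have "\<dots> = ip M x x + (\<Sum>i<r. (c i)\<^sup>2 * ip M (q i) (q i) - 2 * (c i * ip M x (q i)))"
    by (simp add: sum_subtractf sum_distrib_left)
  also have "\<dots> \<ge> ip M x x + (\<Sum>i<r. - (ip M x (q i))\<^sup>2)"
  proof (intro add_left_mono sum_mono)
    fix i assume i: "i \<in> {..<r}"
    have p: "ip M x (q i) * ip M (q i) (q i) = ip M x (q i)"
      using orthfam_ip_projection[OF assms] i by auto
    consider "ip M (q i) (q i) = 1" | "ip M (q i) (q i) = 0"
      using assms i by (auto simp: orthfam_def)
    then show "- (ip M x (q i))\<^sup>2 \<le> (c i)\<^sup>2 * ip M (q i) (q i) - 2 * (c i * ip M x (q i))"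
    proof cases
      case 1
      have "0 \<le> (c i - ip M x (q i))\<^sup>2" by simp
      then show ?thesis by (simp add: 1 power2_diff algebra_simps)
    next
      case 2
      then show ?thesis using p by simp
    qed
  qed
  finally show ?thesis by (simp add: sum_negf)
qed

lemma orthfam_ip_residual_eq:
  assumes "orthfam M r q"
  shows "ip M (\<lambda>a. x a - (\<Sum>i<r. ip M x (q i) * q i a)) (\<lambda>a. x a - (\<Sum>i<r. ip M x (q i) * q i a)) =
    ip M x x - (\<Sum>i<r. (ip M x (q i))\<^sup>2)"
proof -
  have "ip M (\<lambda>a. x a - (\<Sum>i<r. ip M x (q i) * q i a)) (\<lambda>a. x a - (\<Sum>i<r. ip M x (q i) * q i a))
      = ip M x x - 2 * (\<Sum>i<r. ip M x (q i) * ip M x (q i)) + (\<Sum>i<r. (ip M x (q i))\<^sup>2 * ip M (q i) (q i))"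
    unfolding ip_diff orthfam_ip_combination[OF assms] unfolding ip_sum_right ..
  also have "(\<Sum>i<r. (ip M x (q i))\<^sup>2 * ip M (q i) (q i)) = (\<Sum>i<r. (ip M x (q i))\<^sup>2)"
    by (rule sum.cong) (use orthfam_ip_projection[OF assms] in \<open>auto simp: power2_eq_square mult.assoc\<close>)
  finally show ?thesis by (simp add: power2_eq_square)
qed

lemma Bessel:
  assumes "orthfam M r q"
  shows "(\<Sum>i<r. (ip M x (q i))\<^sup>2) \<le> ip M x x"
  using orthfam_ip_residual_eq[OF assms, of x]
    ip_self_nonneg[of M "\<lambda>a. x a - (\<Sum>i<r. ip M x (q i) * q i a)"] by linarith

text \<open>Each row of the matrix is a combination of the \<open>q i\<close>, so it is no longer
  than its vector of coefficients; the \<open>A i\<close> may be arbitrary.\<close>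

lemma frob2_outer_le:
  assumes "orthfam M r q"
  shows "frob2 M (\<lambda>a b. \<Sum>i<r. A i a * q i b) \<le> (\<Sum>i<r. ip M (A i) (A i))"
proof -
  have "frob2 M (\<lambda>a b. \<Sum>i<r. A i a * q i b) \<le> (\<Sum>a<M. \<Sum>i<r. (A i a)\<^sup>2)"
    unfolding frob2_def
    by (intro sum_mono) (use orthfam_combination_le[OF assms] in \<open>auto simp: ip_self\<close>)
  also have "\<dots> = (\<Sum>i<r. ip M (A i) (A i))"
    unfolding ip_self by (rule sum.swap)
  finally show ?thesis .
qed

lemma frob2_transpose: "frob2 M (\<lambda>a b. X b a) = frob2 M X"
  unfolding frob2_def by (rule sum.swap)

lemma frob2_L2_set: "sqrt (frob2 M X) = L2_set (\<lambda>(a, b). X a b) ({..<M} \<times> {..<M})"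
  by (simp add: frob2_def L2_set_def sum.cartesian_product split_def)

lemma frob_triangle:
  "sqrt (frob2 M (\<lambda>a b. X a b + Y a b)) \<le> sqrt (frob2 M X) + sqrt (frob2 M Y)"
  unfolding frob2_L2_set
  using L2_set_triangle_ineq[of "\<lambda>(a, b). X a b" "\<lambda>(a, b). Y a b" "{..<M} \<times> {..<M}"]
  by (simp add: split_def)

lemma frob2_cong: "(\<And>a b. a < M \<Longrightarrow> b < M \<Longrightarrow> X a b = Y a b) \<Longrightarrow> frob2 M X = frob2 M Y"
  by (simp add: frob2_def)

lemma frob2_scale: "frob2 M (\<lambda>a b. c * X a b) = c\<^sup>2 * frob2 M X"
  by (simp add: frob2_def power_mult_distrib sum_distrib_left)

lemma low_rank_frob:
  assumes "low_rank M r c X" "0 \<le> c"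
  shows "sqrt (frob2 M X) \<le> c"
proof -
  obtain \<mu> q where q: "orthfam M r q" and m: "(\<Sum>i<r. (\<mu> i)\<^sup>2) \<le> c\<^sup>2"
    and X: "\<And>a b. a < M \<Longrightarrow> b < M \<Longrightarrow> X a b = (\<Sum>i<r. \<mu> i * q i a * q i b)"
    using assms(1) unfolding low_rank_def by blast
  have "frob2 M X = frob2 M (\<lambda>a b. \<Sum>i<r. (\<mu> i * q i a) * q i b)"
    by (rule frob2_cong) (simp add: X)
  also have "\<dots> \<le> (\<Sum>i<r. ip M (\<lambda>a. \<mu> i * q i a) (\<lambda>a. \<mu> i * q i a))"
    by (rule frob2_outer_le[OF q])
  also have "\<dots> = (\<Sum>i<r. (\<mu> i)\<^sup>2 * ip M (q i) (q i))"
    by (simp add: ip_def power2_eq_square sum_distrib_left algebra_simps)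
  also have "\<dots> \<le> (\<Sum>i<r. (\<mu> i)\<^sup>2)"
    by (intro sum_mono) (use orthfam_bound[OF q] in \<open>auto intro: mult_left_le\<close>)
  finally show ?thesis using m assms(2) by (intro real_le_lsqrt) auto
qed

lemma low_rank_symmetric:
  assumes "low_rank M r c X" "a < M" "b < M"
  shows "X a b = X b a"
proof -
  obtain \<mu> q where X: "\<forall>a<M. \<forall>b<M. X a b = (\<Sum>i<r. \<mu> i * q i a * q i b)"
    using assms unfolding low_rank_def by blast
  have "X a b = (\<Sum>i<r. \<mu> i * q i a * q i b)" "X b a = (\<Sum>i<r. \<mu> i * q i b * q i a)"
    using X assms by auto
  then show ?thesis by (simp add: mult.commute mult.left_commute)
qed

text \<open>The difference of two matrices of rank \<open>r\<close> has rank up to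
  \<open>2 * r\<close>; cutting its list of eigenpairs in two leads back to the class over which the
  supremum is taken in the net argument.\<close>

lemma low_rank_split:
  assumes "low_rank M (r + s) c X"
  obtains Y Z where "low_rank M r c Y" "low_rank M s c Z"
    "\<And>a b. a < M \<Longrightarrow> b < M \<Longrightarrow> X a b = Y a b + Z a b"
proof -
  obtain \<mu> q where q: "orthfam M (r + s) q" and m: "(\<Sum>i<r + s. (\<mu> i)\<^sup>2) \<le> c\<^sup>2"
    and X: "\<And>a b. a < M \<Longrightarrow> b < M \<Longrightarrow> X a b = (\<Sum>i<r + s. \<mu> i * q i a * q i b)"
    using assms(1) unfolding low_rank_def by blast
  have split: "sum f {..<r + s} = sum f {..<r} + (\<Sum>i<s. f (r + i))" for f :: "nat \<Rightarrow> real"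
    by (induction s) auto
  have "0 \<le> (\<Sum>i<r. (\<mu> i)\<^sup>2)" "0 \<le> (\<Sum>i<s. (\<mu> (r + i))\<^sup>2)" by (auto intro: sum_nonneg)
  then have m': "(\<Sum>i<r. (\<mu> i)\<^sup>2) \<le> c\<^sup>2" "(\<Sum>i<s. (\<mu> (r + i))\<^sup>2) \<le> c\<^sup>2"
    using m by (auto simp: split)
  show ?thesis
  proof
    show "low_rank M r c (\<lambda>a b. \<Sum>i<r. \<mu> i * q i a * q i b)"
      unfolding low_rank_def by (rule exI[of _ \<mu>], rule exI[of _ q]) (use q m' in \<open>auto simp: orthfam_def\<close>)
    show "low_rank M s c (\<lambda>a b. \<Sum>i<s. \<mu> (r + i) * q (r + i) a * q (r + i) b)"
      unfolding low_rank_def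
      by (rule exI[of _ "\<lambda>i. \<mu> (r + i)"], rule exI[of _ "\<lambda>i. q (r + i)"])
        (use q m' in \<open>auto simp: orthfam_def\<close>)
  qed (simp add: X split)
qed

section \<open>Spectral theorem for real symmetric matrices\<close>

lemma symmetric_real_eigenvalue:
  fixes A :: "real mat"
  assumes A: "A \<in> carrier_mat n n" and sym: "transpose_mat A = A" and "n > 0"
  shows "\<exists>e. eigenvalue A e"
proof -
  \<comment> \<open>Over the complex numbers an eigenvalue exists, and symmetry makes it equal to
    its conjugate. Being a real root of the characteristic polynomial, it is an eigenvalue of
    \<open>A\<close> itself, without splitting the complex eigenvector.\<close>
  let ?A = "map_mat complex_of_real A"
  have CA: "?A \<in> carrier_mat n n" using A by simp
  obtain a where a: "eigenvalue ?A a"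
    using spectrum_non_empty[OF CA] \<open>n > 0\<close> by (auto simp: spectrum_def)
  then obtain v where v: "v \<in> carrier_vec n" "v \<noteq> 0\<^sub>v n" "?A *\<^sub>v v = a \<cdot>\<^sub>v v"
    using CA A unfolding eigenvalue_def eigenvector_def by auto
  have t: "transpose_mat ?A = ?A" using sym by (metis map_mat_transpose)
  have "(transpose_mat ?A *\<^sub>v conjugate v) \<bullet> v = conjugate v \<bullet> (?A *\<^sub>v v)"
    by (rule transpose_vec_mult_scalar[OF CA v(1)]) (use v in auto)
  moreover have "?A *\<^sub>v conjugate v = conjugate (?A *\<^sub>v v)"
    by (rule eq_vecI) (use A v(1) in \<open>auto simp: scalar_prod_def\<close>)
  ultimately have "conjugate v \<bullet> (a \<cdot>\<^sub>v v) = conjugate (a \<cdot>\<^sub>v v) \<bullet> v"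
    using v(3) t by simp
  then have "a * (conjugate v \<bullet> v) = cnj a * (conjugate v \<bullet> v)"
    using v(1) by (simp add: conjugate_smult_vec)
  moreover have "conjugate v \<bullet> v \<noteq> 0"
    using v conjugate_square_eq_0_vec[of v n]
    by (metis carrier_vec_conjugate conjugate_vec_sprod_comm)
  ultimately have "a = cnj a" by simp
  then have a_real: "a = complex_of_real (Re a)" by (simp add: complex_eq_iff)
  have "complex_of_real (poly (char_poly A) (Re a)) = poly (char_poly ?A) a"
    by (subst (2) a_real) (simp add: of_real_hom.char_poly_hom[OF A])
  also have "\<dots> = 0" using a eigenvalue_root_char_poly[OF CA] by simp
  finally show ?thesis using eigenvalue_root_char_poly[OF A] by auto
qed

lemma symmetric_unit_eigenvector:
  fixes A :: "nat \<Rightarrow> nat \<Rightarrow> real"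
  assumes sym: "\<And>a b. a < n \<Longrightarrow> b < n \<Longrightarrow> A a b = A b a" and "n > 0"
  obtains v e where "ip n v v = 1" "\<And>a. a < n \<Longrightarrow> ip n (A a) v = e * v a"
proof -
  define B where "B = Matrix.mat n n (\<lambda>(a, b). A a b)"
  have B: "B \<in> carrier_mat n n" "transpose_mat B = B"
    by (auto simp: B_def sym)
  obtain e where "eigenvalue B e" using symmetric_real_eigenvalue[OF B \<open>n > 0\<close>] by blast
  then obtain v where v: "v \<in> carrier_vec n" "v \<noteq> 0\<^sub>v n" "B *\<^sub>v v = e \<cdot>\<^sub>v v"
    using B unfolding eigenvalue_def eigenvector_def by auto
  define u where "u = vec_index v"
  define c where "c = sqrt (ip n u u)"
  have "\<exists>a<n. u a \<noteq> 0" using v(1,2) by (auto simp: u_def)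
  then have "ip n u u > 0" unfolding ip_self by (auto intro: sum_pos2)
  then have c: "c > 0" "c\<^sup>2 = ip n u u" by (auto simp: c_def)
  have eig: "ip n (A a) u = e * u a" if "a < n" for a
  proof -
    have "ip n (A a) u = (B *\<^sub>v v) $ a"
      using that v(1) by (simp add: B_def ip_def u_def scalar_prod_def atLeast0LessThan)
    then show ?thesis using that v by (simp add: u_def)
  qed
  show ?thesis
  proof
    show "ip n (\<lambda>a. u a / c) (\<lambda>a. u a / c) = 1"
      using c by (auto simp: ip_self power_divide simp flip: sum_divide_distrib)
    show "ip n (A a) (\<lambda>b. u b / c) = e * (u a / c)" if "a < n" for a
      using eig[OF that] by (simp add: ip_def flip: sum_divide_distrib)
  qed
qed

text \<open>The Householder reflection that exchanges the last unit vector with the unit vector \<open>v\<close>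
  (the identity if they are equal, since then the division by zero yields zero). It reduces the spectral
  theorem to a matrix of smaller size.\<close>

definition householder :: "nat \<Rightarrow> (nat \<Rightarrow> real) \<Rightarrow> (nat \<Rightarrow> real) \<Rightarrow> nat \<Rightarrow> real" where
  "householder n v x = (let u = (\<lambda>a. v a - (if a = n then 1 else 0)) in
     (\<lambda>a. x a - 2 * ip (Suc n) u x / ip (Suc n) u u * u a))"

lemma ip_lin:
  "ip M (\<lambda>a. x a - c * u a) y = ip M x y - c * ip M u y"
  "ip M y (\<lambda>a. x a - c * u a) = ip M y x - c * ip M y u"
  by (simp_all add: ip_def algebra_simps sum_subtractf sum_distrib_left)

lemma householder_ip:
  "ip (Suc n) (householder n v x) (householder n v y) = ip (Suc n) x y"
proof -
  define u where "u = (\<lambda>a. v a - (if a = n then 1 else 0::real))"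
  define t where "t = ip (Suc n) u u"
  have c: "ip (Suc n) x u = ip (Suc n) u x" for x by (rule ip_commute)
  show ?thesis
    unfolding householder_def Let_def u_def[symmetric] ip_lin c[of x] c[of y] t_def[symmetric]
    by (cases "t = 0") (simp_all add: field_simps)
qed

lemma householder_ip_commute:
  "ip (Suc n) (householder n v x) y = ip (Suc n) x (householder n v y)"
proof -
  define u where "u = (\<lambda>a. v a - (if a = n then 1 else 0::real))"
  have c: "ip (Suc n) x u = ip (Suc n) u x" by (rule ip_commute)
  show ?thesis
    unfolding householder_def Let_def u_def[symmetric] ip_lin c by simp
qed

lemma ip_unit: "b < M \<Longrightarrow> ip M (\<lambda>a. if a = b then 1 else 0) x = x b"
  by (simp add: ip_def if_distrib[of "\<lambda>t. t * _"] cong: if_cong)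

lemma householder_last:
  assumes "ip (Suc n) v v = 1" "a \<le> n"
  shows "householder n v (\<lambda>a. if a = n then 1 else 0) a = v a"
proof -
  define u where "u = (\<lambda>a. v a - (if a = n then 1 else 0::real))"
  have uu: "ip (Suc n) u u = 2 - 2 * v n"
  proof -
    have "ip (Suc n) u u = ip (Suc n) v v - 2 * ip (Suc n) (\<lambda>a. if a = n then 1 else 0) v
        + ip (Suc n) (\<lambda>a. if a = n then 1 else 0) (\<lambda>a. if a = n then 1 else 0)"
      unfolding u_def ip_diff by (simp add: ip_commute)
    then show ?thesis using assms by (simp only: ip_unit) (simp add: ip_unit)
  qed
  have ue: "ip (Suc n) u (\<lambda>a. if a = n then 1 else 0) = v n - 1"
    by (subst ip_commute) (simp add: ip_unit u_def)
  show ?thesis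
  proof (cases "ip (Suc n) u u = 0")
    case True
    then have "u a = 0" using assms(2)
      unfolding ip_self by (subst (asm) sum_nonneg_eq_0_iff) auto
    then show ?thesis
      by (simp only: householder_def Let_def u_def[symmetric] True) (simp add: u_def split: if_splits)
  next
    case False
    then have "2 * (v n - 1) / ip (Suc n) u u = -1" using uu by (simp add: field_simps)
    moreover have "householder n v (\<lambda>a. if a = n then 1 else 0) a =
        (if a = n then 1 else 0) - 2 * (v n - 1) / ip (Suc n) u u * u a"
      by (simp only: householder_def Let_def u_def[symmetric] ue)
    ultimately have "householder n v (\<lambda>a. if a = n then 1 else 0) a = (if a = n then 1 else 0) + u a"
      by simp
    then show ?thesis by (simp add: u_def)
  qed
qed

lemma bilinear_form_eq_ip:
  fixes A :: "nat \<Rightarrow> nat \<Rightarrow> real"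
  shows "(\<Sum>a<n. \<Sum>b<n. x a * A a b * y b) = ip n x (\<lambda>a. ip n (A a) y)"
  by (simp add: ip_def sum_distrib_left mult.assoc)

text \<open>In the orthonormal basis \<open>h (\<delta> a)\<close> the last basis vector is the
  eigenvector \<open>v\<close>, so the last row and column of the form \<open>F\<close> are
  \<open>e\<close> times a unit vector. The induction hypothesis diagonalises the leading block; its
  eigenvectors are padded by 0 and reflected back.\<close>

lemma spectral_theorem:
  fixes A :: "nat \<Rightarrow> nat \<Rightarrow> real"
  assumes "\<And>a b. a < n \<Longrightarrow> b < n \<Longrightarrow> A a b = A b a"
  shows "\<exists>p \<nu>. (\<forall>i<n. \<forall>j<n. ip n (p i) (p j) = (if i = j then 1 else 0)) \<and>
    (\<forall>a<n. \<forall>b<n. A a b = (\<Sum>i<n. \<nu> i * p i a * p i b))"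
  using assms
proof (induction n arbitrary: A)
  case 0
  then show ?case by simp
next
  case (Suc n)
  obtain v e where v: "ip (Suc n) v v = 1" and eig: "\<And>a. a < Suc n \<Longrightarrow> ip (Suc n) (A a) v = e * v a"
    using symmetric_unit_eigenvector[of "Suc n" A] Suc.prems by blast
  let ?N = "Suc n"
  define h where "h = householder n v"
  define \<delta> :: "nat \<Rightarrow> nat \<Rightarrow> real" where "\<delta> = (\<lambda>b a. if a = b then 1 else 0)"
  define F where "F x y = ip ?N x (\<lambda>a. ip ?N (A a) y)" for x y
  have hh: "ip ?N (h x) (h y) = ip ?N x y" for x y by (simp add: h_def householder_ip)
  have hc: "ip ?N (h x) y = ip ?N x (h y)" for x y by (simp add: h_def householder_ip_commute)
  have hn: "a \<le> n \<Longrightarrow> h (\<delta> n) a = v a" for a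
    using householder_last[OF v] by (simp add: h_def \<delta>_def)
  have ip_cong: "ip ?N x y = ip ?N x' y'" if "\<And>a. a \<le> n \<Longrightarrow> x a = x' a" "\<And>a. a \<le> n \<Longrightarrow> y a = y' a"
    for x y x' y' using that by (auto simp: ip_def)
  have ip_d: "ip ?N (\<delta> b) x = x b" if "b \<le> n" for b x using that by (simp add: \<delta>_def ip_unit)
  have Fsym: "F x y = F y x" for x y
    unfolding F_def bilinear_form_eq_ip[symmetric]
    by (subst sum.swap) (intro sum.cong refl, simp add: Suc.prems mult.commute mult.left_commute)
  have Fv: "F x (h (\<delta> n)) = e * ip ?N x (h (\<delta> n))" for x
  proof -
    have "ip ?N (A a) (h (\<delta> n)) = e * v a" if "a \<le> n" for a
      using eig[of a] that ip_cong[of "A a" "A a" "h (\<delta> n)" v] hn by simp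
    then have "F x (h (\<delta> n)) = ip ?N x (\<lambda>a. e * v a)"
      unfolding F_def by (intro ip_cong refl) auto
    also have "\<dots> = e * ip ?N x v" by (simp add: ip_def sum_distrib_left mult.left_commute distrib_left)
    also have "ip ?N x v = ip ?N x (h (\<delta> n))" using hn by (intro ip_cong) auto
    finally show ?thesis .
  qed
  define B where "B a b = F (h (\<delta> a)) (h (\<delta> b))" for a b
  obtain p \<nu> where p: "\<And>i j. i < n \<Longrightarrow> j < n \<Longrightarrow> ip n (p i) (p j) = (if i = j then 1 else 0)"
    and B: "\<And>a b. a < n \<Longrightarrow> b < n \<Longrightarrow> B a b = (\<Sum>i<n. \<nu> i * p i a * p i b)"
    using Suc.IH[of B] Fsym unfolding B_def by blast
  have Bn: "B a n = (if a = n then e else 0)" "B n a = (if a = n then e else 0)" if "a \<le> n" for a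
  proof -
    show "B a n = (if a = n then e else 0)"
      using that ip_d[of a "\<delta> n"] by (simp add: B_def Fv hh) (simp add: \<delta>_def)
    then show "B n a = (if a = n then e else 0)" using Fsym by (simp add: B_def)
  qed
  have hh_id: "h (h x) a = x a" if "a \<le> n" for x a
  proof -
    have "ip ?N (\<delta> a) (h (h x)) = ip ?N (h (\<delta> a)) (h x)" by (rule hc[symmetric])
    also have "\<dots> = ip ?N (\<delta> a) x" by (rule hh)
    finally have "ip ?N (\<delta> a) (h (h x)) = ip ?N (\<delta> a) x" .
    then show ?thesis using that by (simp add: ip_d)
  qed
  \<comment> \<open>Linearity of the reflection in coordinates; it turns
    \<open>F (h x) (h y)\<close> into a double sum over the entries of \<open>B\<close>.\<close>
  have h_expand: "h x a = (\<Sum>b<?N. x b * h (\<delta> b) a)" if "a \<le> n" for x a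
  proof -
    define u where "u = (\<lambda>a. v a - (if a = n then 1 else 0::real))"
    have ud: "ip ?N u (\<delta> b) = u b" if "b < ?N" for b
      using that ip_d[of b u] by (simp add: ip_commute)
    have "(\<Sum>b<?N. x b * h (\<delta> b) a) = (\<Sum>b<?N. x b * \<delta> b a - 2 / ip ?N u u * u a * (u b * x b))"
      by (intro sum.cong refl)
        (simp add: h_def householder_def Let_def u_def[symmetric] ud algebra_simps)
    also have "\<dots> = (\<Sum>b<?N. x b * \<delta> b a) - 2 / ip ?N u u * u a * ip ?N u x"
      unfolding sum_subtractf ip_def sum_distrib_left ..
    also have "(\<Sum>b<?N. x b * \<delta> b a) = x a"
      using that by (simp add: \<delta>_def if_distrib[of "\<lambda>t. _ * t"] cong: if_cong)
    finally show ?thesis by (simp add: h_def householder_def Let_def u_def[symmetric] algebra_simps)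
  qed
  have F_cong: "F x y = F x' y'" if "\<And>a. a \<le> n \<Longrightarrow> x a = x' a" "\<And>a. a \<le> n \<Longrightarrow> y a = y' a"
    for x y x' y' unfolding F_def using that by (intro ip_cong refl) auto
  have F_left: "F (\<lambda>a. \<Sum>b<?N. x b * f b a) y = (\<Sum>b<?N. x b * F (f b) y)" for x f y
    by (simp only: F_def ip_sum_left)
  have Fh: "F (h x) (h y) = (\<Sum>a<?N. x a * (\<Sum>b<?N. y b * B a b))" for x y
  proof -
    have left: "F (h x) w = (\<Sum>a<?N. x a * F (h (\<delta> a)) w)" for x w
    proof -
      have "F (h x) w = F (\<lambda>c. \<Sum>b<?N. x b * h (\<delta> b) c) w"
        by (intro F_cong h_expand refl)
      also have "\<dots> = (\<Sum>a<?N. x a * F (h (\<delta> a)) w)" by (rule F_left)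
      finally show ?thesis .
    qed
    have "F (h (\<delta> a)) (h y) = (\<Sum>b<?N. y b * B a b)" for a
      using left[of y "h (\<delta> a)"] by (simp add: B_def Fsym)
    then have "F (h x) (h y) = (\<Sum>a<?N. x a * (\<Sum>b<?N. y b * B a b))"
      using left[of x "h y"] by simp
    then show ?thesis .
  qed
  define z where "z i = (\<lambda>a. if a < n then p i a else 0)" for i
  define p' where "p' i = (if i = n then h (\<delta> n) else h (z i))" for i
  define \<nu>' where "\<nu>' i = (if i = n then e else \<nu> i)" for i
  have z_ip: "ip ?N (z i) x = ip n (p i) x" for i x by (simp add: ip_def z_def)
  have zz: "ip n (p i) (z j) = ip n (p i) (p j)" for i j by (simp add: ip_def z_def)
  have orth: "ip ?N (p' i) (p' j) = (if i = j then 1 else 0)" if ij: "i < ?N" "j < ?N" for i j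
  proof -
    consider "i < n" "j < n" | "i < n" "j = n" | "i = n" "j < n" | "i = n" "j = n"
      using ij unfolding less_Suc_eq by blast
    then show ?thesis
    proof cases
      case 1
      then show ?thesis by (simp add: p'_def hh z_ip zz p)
    next
      case 2
      then show ?thesis using ip_d[of n "z i"] by (simp add: p'_def hh ip_commute) (simp add: z_def)
    next
      case 3
      then show ?thesis using ip_d[of n "z j"] by (simp add: p'_def hh) (simp add: z_def)
    next
      case 4
      then show ?thesis using ip_d[of n "\<delta> n"] by (simp add: p'_def hh) (simp add: \<delta>_def)
    qed
  qed
  have expand: "A a b = (\<Sum>i<?N. \<nu>' i * p' i a * p' i b)" if ab: "a < ?N" "b < ?N" for a b
  proof -
    have p'_eq: "p' i c = (if i = n then h (\<delta> c) n else ip n (p i) (h (\<delta> c)))" if "c < ?N" for i c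
    proof -
      have "p' i c = ip ?N (p' i) (\<delta> c)" using that ip_d[of c "p' i"] by (simp add: ip_commute)
      then show ?thesis using ip_d[of n "h (\<delta> c)"] by (simp add: p'_def hc z_ip)
    qed
    let ?x = "h (\<delta> a)" and ?y = "h (\<delta> b)"
    have "A a b = F (\<delta> a) (\<delta> b)"
    proof -
      have "ip ?N (A c) (\<delta> b) = A c b" for c
        using ab ip_d[of b "A c"] by (metis ip_commute less_Suc_eq_le)
      then show ?thesis using ab by (simp add: F_def ip_d)
    qed
    also have "\<dots> = F (h ?x) (h ?y)" using hh_id by (intro F_cong) auto
    also have "\<dots> = (\<Sum>c<?N. ?x c * (\<Sum>d<?N. ?y d * B c d))" by (rule Fh)
    also have "\<dots> = (\<Sum>c<n. ?x c * (\<Sum>d<n. ?y d * B c d)) + e * ?x n * ?y n"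
      by (simp add: Bn)
    also have "(\<Sum>c<n. ?x c * (\<Sum>d<n. ?y d * B c d)) =
        (\<Sum>c<n. \<Sum>d<n. \<Sum>i<n. \<nu> i * (p i c * ?x c) * (p i d * ?y d))"
      by (simp add: B sum_distrib_left mult.assoc mult.commute mult.left_commute)
    also have "\<dots> = (\<Sum>c<n. \<Sum>i<n. \<Sum>d<n. \<nu> i * (p i c * ?x c) * (p i d * ?y d))"
      by (intro sum.cong refl sum.swap)
    also have "\<dots> = (\<Sum>i<n. \<Sum>c<n. \<Sum>d<n. \<nu> i * (p i c * ?x c) * (p i d * ?y d))"
      by (rule sum.swap)
    also have "\<dots> = (\<Sum>i<n. \<nu> i * ip n (p i) ?x * ip n (p i) ?y)"
      by (simp only: ip_def mult.assoc sum_product) (simp only: sum_distrib_left)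
    also have "\<dots> + e * ?x n * ?y n = (\<Sum>i<?N. \<nu>' i * p' i a * p' i b)"
      using ab by (simp add: p'_eq \<nu>'_def)
    finally show ?thesis .
  qed
  show ?case using orth expand by blast
qed


text \<open>On \<open>s\<close> orthonormal eigenvectors with nonzero eigenvalues, applying
  \<open>X\<close> and dividing by the eigenvalue is the identity, but it factors through dimension
  \<open>r\<close>. If \<open>r < s\<close>, both factors are padded by zeros to size
  \<open>s\<close>, and the determinant of their product would be 0 instead of 1.\<close>

lemma card_eigenvectors_le:
  fixes F G :: "nat \<Rightarrow> nat \<Rightarrow> real"
  assumes X: "\<And>a b. a < M \<Longrightarrow> b < M \<Longrightarrow> X a b = (\<Sum>k<r. F a k * G k b)"
    and p: "\<And>i j. i < s \<Longrightarrow> j < s \<Longrightarrow> ip M (p i) (p j) = (if i = j then 1 else 0)"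
    and eig: "\<And>i a. i < s \<Longrightarrow> a < M \<Longrightarrow> ip M (X a) (p i) = \<nu> i * p i a"
    and nz: "\<And>i. i < s \<Longrightarrow> \<nu> i \<noteq> 0"
  shows "s \<le> r"
proof (rule ccontr)
  assume "\<not> s \<le> r"
  then have rs: "r < s" by simp
  define C where "C = Matrix.mat s s (\<lambda>(i, k). if k < r then ip M (p i) (\<lambda>a. F a k) else 0)"
  define D where "D = Matrix.mat s s (\<lambda>(k, j). if k < r then ip M (G k) (p j) / \<nu> j else 0)"
  have C: "C \<in> carrier_mat s s" and D: "D \<in> carrier_mat s s" by (auto simp: C_def D_def)
  have "(C * D) $$ (i, j) = (if i = j then 1 else 0)" if i: "i < s" and j: "j < s" for i j
  proof -
    have "(C * D) $$ (i, j) = (\<Sum>k<s. C $$ (i, k) * D $$ (k, j))"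
      using C D i j by (simp add: scalar_prod_def atLeast0LessThan)
    also have "\<dots> = (\<Sum>k<r. ip M (p i) (\<lambda>a. F a k) * (ip M (G k) (p j) / \<nu> j))"
      using rs i j by (intro sum.mono_neutral_cong_right) (auto simp: C_def D_def)
    also have "\<dots> = ip M (p i) (\<lambda>a. \<Sum>k<r. (ip M (G k) (p j) / \<nu> j) * F a k)"
      unfolding ip_sum_right by (simp add: mult.commute)
    also have "\<dots> = ip M (p i) (\<lambda>a. ip M (X a) (p j) / \<nu> j)"
    proof -
      have "(\<Sum>k<r. (ip M (G k) (p j) / \<nu> j) * F a k) = ip M (X a) (p j) / \<nu> j" if "a < M" for a
      proof -
        have "ip M (X a) (p j) = ip M (\<lambda>b. \<Sum>k<r. F a k * G k b) (p j)"
          using X that by (simp add: ip_def)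
        then show ?thesis unfolding ip_sum_left by (simp add: sum_divide_distrib mult.commute)
      qed
      then show ?thesis by (simp add: ip_def)
    qed
    also have "\<dots> = ip M (p i) (p j)"
      using eig[OF j] nz[OF j] by (simp add: ip_def)
    finally show ?thesis using p i j by simp
  qed
  then have "C * D = 1\<^sub>m s" using C D by (intro eq_matI) auto
  then have "det C * det D = 1" using det_mult[OF C D] by simp
  moreover have "det D = 0"
  proof -
    \<comment> \<open>Row \<open>r\<close> of \<open>D\<close> is padding, hence zero; scaling it by
      0 changes nothing and forces the determinant to vanish.\<close>
    have "multrow r 0 D = D" by (rule eq_matI) (auto simp: D_def)
    then show ?thesis using det_multrow[OF rs D, of 0] by simp
  qed
  ultimately show False by simp
qed

text \<open>The general entry to \<open>low_rank\<close>: any factorisation through dimension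
  \<open>r\<close>, however unsymmetric, leaves at most \<open>r\<close> nonzero eigenvalues, so the
  symmetric matrix has a spectral form of that length.\<close>

lemma low_rank_factorization:
  fixes F G :: "nat \<Rightarrow> nat \<Rightarrow> real"
  assumes sym: "\<And>a b. a < M \<Longrightarrow> b < M \<Longrightarrow> X a b = X b a"
    and X: "\<And>a b. a < M \<Longrightarrow> b < M \<Longrightarrow> X a b = (\<Sum>k<r. F a k * G k b)"
  shows "low_rank M r (sqrt (frob2 M X)) X"
proof -
  obtain p \<nu> where p: "\<And>i j. i < M \<Longrightarrow> j < M \<Longrightarrow> ip M (p i) (p j) = (if i = j then 1 else 0)"
    and Xp: "\<And>a b. a < M \<Longrightarrow> b < M \<Longrightarrow> X a b = (\<Sum>i<M. \<nu> i * p i a * p i b)"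
    using spectral_theorem[of M X, OF sym] by blast
  have orth: "orthfam M M p" using p by (auto simp: orthfam_def)
  have eig: "ip M (X a) (p i) = \<nu> i * p i a" if "a < M" "i < M" for a i
  proof -
    have "ip M (X a) (p i) = ip M (\<lambda>b. \<Sum>i<M. (\<nu> i * p i a) * p i b) (p i)"
      using Xp that by (simp add: ip_def)
    then show ?thesis using orthfam_ip_basis[OF orth that(2)] p that by simp
  qed
  have frob: "frob2 M X = (\<Sum>i<M. (\<nu> i)\<^sup>2)"
  proof -
    have "frob2 M X = (\<Sum>a<M. ip M (\<lambda>b. \<Sum>i<M. (\<nu> i * p i a) * p i b) (\<lambda>b. \<Sum>i<M. (\<nu> i * p i a) * p i b))"
      by (simp add: frob2_def ip_self Xp)
    also have "\<dots> = (\<Sum>a<M. \<Sum>i<M. (\<nu> i * p i a)\<^sup>2)"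
      unfolding orthfam_ip_combination[OF orth] by (simp add: p)
    also have "\<dots> = (\<Sum>i<M. (\<nu> i)\<^sup>2 * ip M (p i) (p i))"
      by (subst sum.swap) (simp add: power_mult_distrib ip_self sum_distrib_left)
    finally show ?thesis by (simp add: p)
  qed
  define S where "S = {i. i < M \<and> \<nu> i \<noteq> 0}"
  define s where "s = card S"
  have "finite S" by (simp add: S_def)
  then obtain h where h: "bij_betw h {..<s} S"
    using ex_bij_betw_nat_finite[of S] by (auto simp: s_def atLeast0LessThan)
  have hS: "h i < M" "\<nu> (h i) \<noteq> 0" if "i < s" for i
    using bij_betwE[OF h] that by (auto simp: S_def)
  have hinj: "h i = h j \<longleftrightarrow> i = j" if "i < s" "j < s" for i j
    using h that by (auto simp: bij_betw_def inj_on_def)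
  have sr: "s \<le> r"
  proof (rule card_eigenvectors_le[where M = M and X = X and F = F and G = G
        and p = "\<lambda>i. p (h i)" and \<nu> = "\<lambda>i. \<nu> (h i)"])
    show "ip M (p (h i)) (p (h j)) = (if i = j then 1 else 0)" if "i < s" "j < s" for i j
      using p[of "h i" "h j"] hS hinj that by simp
  qed (use X hS eig in auto)
  have sumS: "(\<Sum>i<r. if i < s then f (h i) else 0) = (\<Sum>i<M. f i)"
    if f: "\<And>i. i < M \<Longrightarrow> \<nu> i = 0 \<Longrightarrow> f i = 0" for f :: "nat \<Rightarrow> real"
  proof -
    have "(\<Sum>i<r. if i < s then f (h i) else 0) = (\<Sum>i<s. f (h i))"
      by (rule sum.mono_neutral_cong_right) (use sr in auto)
    also have "\<dots> = sum f S" by (rule sum.reindex_bij_betw[OF h])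
    also have "\<dots> = sum f {..<M}"
      by (rule sum.mono_neutral_left) (use f in \<open>auto simp: S_def\<close>)
    finally show ?thesis .
  qed
  \<comment> \<open>Eigenpairs with nonzero eigenvalue come first; the other \<open>r - s\<close>
    places are filled with zero vectors.\<close>
  define q where "q i = (if i < s then p (h i) else (\<lambda>_. 0))" for i
  define \<mu> where "\<mu> i = (if i < s then \<nu> (h i) else 0)" for i
  have "orthfam M r q"
    using p hS hinj by (auto simp: orthfam_def q_def ip_def[of _ "\<lambda>_. 0"] ip_def[of _ _ "\<lambda>_. 0"])
  moreover have "(\<Sum>i<r. (\<mu> i)\<^sup>2) = frob2 M X"
    unfolding frob sumS[of "\<lambda>i. (\<nu> i)\<^sup>2", simplified, symmetric]
    by (rule sum.cong) (auto simp: \<mu>_def)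
  moreover have "X a b = (\<Sum>i<r. \<mu> i * q i a * q i b)" if "a < M" "b < M" for a b
    unfolding Xp[OF that] sumS[of "\<lambda>i. \<nu> i * p i a * p i b", simplified, symmetric]
    by (rule sum.cong) (auto simp: \<mu>_def q_def)
  ultimately show ?thesis
    unfolding low_rank_def by (intro exI[of _ \<mu>] exI[of _ q]) auto
qed

section \<open>Nets of low-rank matrices\<close>

lemma sum_half_powers_le: "(\<Sum>t\<in>{- int S..int S}. (1/2::real) ^ nat \<bar>t\<bar>) \<le> 3"
proof -
  have "(\<Sum>t\<in>{- int S..int S}. (1/2::real) ^ nat \<bar>t\<bar>) = 3 - 2 * (1/2) ^ S"
  proof (induction S)
    case (Suc S)
    have "{- int (Suc S)..int (Suc S)} = insert (- int (Suc S)) (insert (int (Suc S)) {- int S..int S})"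
      by auto
    then show ?case using Suc by (simp add: nat_add_distrib)
  qed simp
  then show ?thesis by simp
qed

text \<open>Weighted counting: if each coordinate contributes the factor
  \<open>(1/2) ^ nat \<bar>k i\<bar>\<close>, every point of \<open>A\<close> weighs at least
  \<open>(1/2) ^ S\<close>, whereas all points together weigh at most 3 per coordinate. The exponent
  is linear in \<open>card I\<close> and \<open>S\<close>, without a logarithm.\<close>

lemma card_integer_points_le:
  fixes I :: "'i set" and S :: nat
  assumes I: "finite I"
  defines "A \<equiv> {k \<in> I \<rightarrow>\<^sub>E (UNIV :: int set). (\<Sum>i\<in>I. \<bar>k i\<bar>) \<le> int S}"
  shows "finite A" "real (card A) \<le> 3 ^ card I * 2 ^ S"
proof -
  let ?B = "I \<rightarrow>\<^sub>E {- int S..int S}"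
  have sub: "A \<subseteq> ?B"
  proof
    fix k assume k: "k \<in> A"
    have "k i \<in> {- int S..int S}" if "i \<in> I" for i
    proof -
      have "\<bar>k i\<bar> \<le> (\<Sum>i\<in>I. \<bar>k i\<bar>)" using that I by (intro member_le_sum) auto
      moreover have "(\<Sum>i\<in>I. \<bar>k i\<bar>) \<le> int S" using k by (simp add: A_def)
      ultimately show ?thesis by auto
    qed
    moreover have "k \<in> extensional I" using k by (simp add: A_def PiE_iff)
    ultimately show "k \<in> ?B" by (simp only: PiE_iff) blast
  qed
  have B: "finite ?B" using I by (intro finite_PiE) auto
  then show "finite A" using sub finite_subset by blast
  have "real (card A) * (1/2) ^ S = (\<Sum>k\<in>A. (1/2) ^ S)" by simp
  also have "\<dots> \<le> (\<Sum>k\<in>A. \<Prod>i\<in>I. (1/2) ^ nat \<bar>k i\<bar>)"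
  proof (rule sum_mono)
    fix k assume k: "k \<in> A"
    have "(\<Sum>i\<in>I. nat \<bar>k i\<bar>) \<le> S"
    proof -
      have "int (\<Sum>i\<in>I. nat \<bar>k i\<bar>) = (\<Sum>i\<in>I. \<bar>k i\<bar>)" by simp
      also have "\<dots> \<le> int S" using k by (simp add: A_def)
      finally show ?thesis by (simp only: of_nat_le_iff)
    qed
    then have "(1/2) ^ S \<le> (1/2::real) ^ (\<Sum>i\<in>I. nat \<bar>k i\<bar>)" by (intro power_decreasing) auto
    then show "(1/2) ^ S \<le> (\<Prod>i\<in>I. (1/2::real) ^ nat \<bar>k i\<bar>)" by (simp add: power_sum)
  qed
  also have "\<dots> \<le> (\<Sum>k\<in>?B. \<Prod>i\<in>I. (1/2) ^ nat \<bar>k i\<bar>)"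
    using B sub by (intro sum_mono2) (auto intro: prod_nonneg)
  also have "\<dots> = (\<Prod>i\<in>I. \<Sum>t\<in>{- int S..int S}. (1/2) ^ nat \<bar>t\<bar>)"
    using I by (subst prod_sum_PiE) auto
  also have "\<dots> \<le> (\<Prod>i\<in>I. 3)"
    by (intro prod_mono conjI sum_nonneg sum_half_powers_le) auto
  finally show "real (card A) \<le> 3 ^ card I * 2 ^ S"
    by (simp add: power_divide divide_simps)
qed

text \<open>The left vector, the coefficient and the right vector are replaced in turn; each
  replacement costs at most \<eta>, because one of the two vector factors is an untouched orthogonal
  family.\<close>

lemma frob2_combination_diff:
  assumes q: "orthfam M r q" and q': "orthfam M r q'" and "0 \<le> \<eta>"
    and \<mu>: "(\<Sum>i<r. (\<mu> i)\<^sup>2) \<le> 1" and \<mu>': "(\<Sum>i<r. (\<mu>' i)\<^sup>2) \<le> 1"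
    and d\<mu>: "(\<Sum>i<r. (\<mu> i - \<mu>' i)\<^sup>2) \<le> \<eta>\<^sup>2"
    and dq: "\<And>i. i < r \<Longrightarrow> ip M (\<lambda>a. q i a - q' i a) (\<lambda>a. q i a - q' i a) \<le> \<eta>\<^sup>2"
  shows "sqrt (frob2 M (\<lambda>a b. (\<Sum>i<r. \<mu> i * q i a * q i b) - (\<Sum>i<r. \<mu>' i * q' i a * q' i b))) \<le> 3 * \<eta>"
proof -
  have sc: "ip M (\<lambda>a. c * x a) (\<lambda>a. c * x a) = c\<^sup>2 * ip M x x" for c x
    by (simp add: ip_self power_mult_distrib sum_distrib_left)
  have weighted: "(\<Sum>i<r. (c i)\<^sup>2 * ip M (\<lambda>a. q i a - q' i a) (\<lambda>a. q i a - q' i a)) \<le> \<eta>\<^sup>2"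
    if "(\<Sum>i<r. (c i)\<^sup>2) \<le> 1" for c
  proof -
    have "(\<Sum>i<r. (c i)\<^sup>2 * ip M (\<lambda>a. q i a - q' i a) (\<lambda>a. q i a - q' i a)) \<le> (\<Sum>i<r. (c i)\<^sup>2 * \<eta>\<^sup>2)"
      by (intro sum_mono mult_left_mono dq) auto
    also have "\<dots> \<le> 1 * \<eta>\<^sup>2"
      unfolding sum_distrib_right[symmetric] by (intro mult_right_mono that) auto
    finally show ?thesis by simp
  qed
  let ?A = "\<lambda>a b. \<Sum>i<r. (\<mu> i * (q i a - q' i a)) * q i b"
  let ?B = "\<lambda>a b. \<Sum>i<r. ((\<mu> i - \<mu>' i) * q' i a) * q i b"
  let ?C = "\<lambda>b a. \<Sum>i<r. (\<mu>' i * (q i b - q' i b)) * q' i a"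
  have A: "frob2 M ?A \<le> \<eta>\<^sup>2"
    by (rule order_trans[OF frob2_outer_le[OF q]]) (use weighted[OF \<mu>] in \<open>simp only: sc\<close>)
  have C: "frob2 M (\<lambda>a b. ?C b a) \<le> \<eta>\<^sup>2"
    unfolding frob2_transpose[of M ?C]
    by (rule order_trans[OF frob2_outer_le[OF q']]) (use weighted[OF \<mu>'] in \<open>simp only: sc\<close>)
  have "frob2 M ?B \<le> (\<Sum>i<r. (\<mu> i - \<mu>' i)\<^sup>2 * ip M (q' i) (q' i))"
    using frob2_outer_le[OF q, of "\<lambda>i a. (\<mu> i - \<mu>' i) * q' i a"] by (simp add: sc)
  also have "\<dots> \<le> (\<Sum>i<r. (\<mu> i - \<mu>' i)\<^sup>2)"
    by (intro sum_mono) (use orthfam_bound[OF q'] in \<open>auto intro: mult_left_le\<close>)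
  finally have B: "frob2 M ?B \<le> \<eta>\<^sup>2" using d\<mu> by simp
  have root: "sqrt x \<le> \<eta>" if "x \<le> \<eta>\<^sup>2" for x using that \<open>0 \<le> \<eta>\<close> by (simp add: real_le_lsqrt)
  have "(\<lambda>a b. (\<Sum>i<r. \<mu> i * q i a * q i b) - (\<Sum>i<r. \<mu>' i * q' i a * q' i b)) =
      (\<lambda>a b. (?A a b + ?B a b) + ?C b a)"
    by (intro ext) (simp add: algebra_simps flip: sum.distrib sum_subtractf)
  then show ?thesis
    using frob_triangle[of M "\<lambda>a b. ?A a b + ?B a b" "\<lambda>a b. ?C b a"] frob_triangle[of M ?A ?B]
      root[OF A] root[OF B] root[OF C] by simp
qed

lemma low_rank_mono: "low_rank M r c X \<Longrightarrow> 0 \<le> c \<Longrightarrow> c \<le> d \<Longrightarrow> low_rank M r d X"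
  unfolding low_rank_def by (meson order_trans power_mono)

text \<open>Eigenpairs are rounded to a grid of step \<open>\<eta> / sqrt r\<close> for the
  eigenvalues and \<open>\<eta> / sqrt M\<close> for the entries of the vectors. The sum of squares
  of the scaled parameters is O (r M), which puts the integer parts into a ball of that radius for
  the sum of absolute values; a box would cost a factor log M in the exponent. One matrix of the
  class is kept per occupied cell, so the net points are themselves normalised and of rank
  \<open>r\<close>.\<close>

lemma low_rank_net:
  assumes "0 < \<rho>"
  shows "\<exists>C::real. 1 \<le> C \<and> (\<forall>M r. 1 \<le> M \<longrightarrow> 1 \<le> r \<longrightarrow>
    (\<exists>\<N>. finite \<N> \<and> real (card \<N>) \<le> C ^ (M * r) \<and>
      (\<forall>X\<in>\<N>. low_rank M r 1 X \<and> frob2 M X = 1) \<and>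
      (\<forall>X. low_rank M r 1 X \<and> frob2 M X = 1 \<longrightarrow>
        (\<exists>Y\<in>\<N>. low_rank M (r + r) \<rho> (\<lambda>a b. X a b - Y a b)))))"
proof -
  define \<eta> where "\<eta> = \<rho> / 3"
  have \<eta>: "\<eta> > 0" using assms by (simp add: \<eta>_def)
  define T where "T = nat \<lceil>2 / \<eta>\<^sup>2 + 2\<rceil>"
  have T: "2 / \<eta>\<^sup>2 + 2 \<le> real T" by (simp add: T_def) linarith
  define D where "D = (3 * 2 ^ T :: real)"
  have D: "1 \<le> D" unfolding D_def using one_le_power[of "2::real" T] by linarith
  show ?thesis
  proof (intro exI[of _ "D\<^sup>2"] conjI allI impI)
    show "1 \<le> D\<^sup>2" using D by (rule one_le_power)
    fix M r :: nat assume M: "1 \<le> M" and r: "1 \<le> r"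
    \<comment> \<open>Coordinate \<open>(i, j)\<close> with \<open>j < M\<close> carries entry
      \<open>j\<close> of the \<open>i\<close>-th vector; the extra index \<open>M\<close> carries
      the \<open>i\<close>-th coefficient.\<close>
    define I where "I = {..<r} \<times> {..M}"
    define mk where "mk p = (\<lambda>a b. \<Sum>i<r. fst p i * snd p i a * snd p i b)"
      for p :: "(nat \<Rightarrow> real) \<times> (nat \<Rightarrow> nat \<Rightarrow> real)"
    define sc where "sc p = (\<lambda>(i, j). if j = M then fst p i * sqrt r / \<eta> else snd p i j * sqrt M / \<eta>)"
      for p :: "(nat \<Rightarrow> real) \<times> (nat \<Rightarrow> nat \<Rightarrow> real)"
    define key where "key p = restrict (\<lambda>x. \<lfloor>sc p x\<rfloor>) I" for p
    define Par where "Par = {p. orthfam M r (snd p) \<and> (\<Sum>i<r. (fst p i)\<^sup>2) \<le> 1 \<and> frob2 M (mk p) = 1}"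
    have sum_I: "(\<Sum>x\<in>I. f x) = (\<Sum>i<r. f (i, M) + (\<Sum>j<M. f (i, j)))" for f :: "nat \<times> nat \<Rightarrow> real"
    proof -
      have "(\<Sum>x\<in>I. f x) = (\<Sum>i<r. \<Sum>j\<le>M. f (i, j))"
        by (simp add: I_def sum.cartesian_product)
      then show ?thesis by (simp add: lessThan_Suc_atMost[symmetric] add.commute)
    qed
    define S where "S = T * (r * (M + 1))"
    define A where "A = {k \<in> I \<rightarrow>\<^sub>E (UNIV :: int set). (\<Sum>i\<in>I. \<bar>k i\<bar>) \<le> int S}"
    have "finite I" by (simp add: I_def)
    note cnt = card_integer_points_le[OF this, of S, folded A_def]
    have keyA: "key p \<in> A" if p: "p \<in> Par" for p
    proof -
      have "(\<Sum>x\<in>I. (sc p x)\<^sup>2) = (\<Sum>i<r. (fst p i)\<^sup>2 * r / \<eta>\<^sup>2 + ip M (snd p i) (snd p i) * M / \<eta>\<^sup>2)"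
        unfolding sum_I by (simp add: sc_def power_divide power_mult_distrib ip_self sum_distrib_right sum_divide_distrib)
      also have "\<dots> = (\<Sum>i<r. (fst p i)\<^sup>2) * r / \<eta>\<^sup>2 + (\<Sum>i<r. ip M (snd p i) (snd p i)) * M / \<eta>\<^sup>2"
        by (simp add: sum.distrib sum_distrib_right sum_divide_distrib)
      also have "\<dots> \<le> 1 * real r / \<eta>\<^sup>2 + real r * real M / \<eta>\<^sup>2"
      proof -
        have "(\<Sum>i<r. (fst p i)\<^sup>2) \<le> 1" using p by (simp add: Par_def)
        moreover have "(\<Sum>i<r. ip M (snd p i) (snd p i)) \<le> (\<Sum>i<r. 1)"
          using orthfam_bound[of M r "snd p"] p by (intro sum_mono) (simp add: Par_def)
        ultimately show ?thesis by (intro add_mono divide_right_mono mult_right_mono) auto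
      qed
      finally have bound: "(\<Sum>x\<in>I. (sc p x)\<^sup>2) \<le> real r / \<eta>\<^sup>2 + real r * real M / \<eta>\<^sup>2"
        by simp
      have "real_of_int (\<Sum>x\<in>I. \<bar>key p x\<bar>) = (\<Sum>x\<in>I. \<bar>real_of_int \<lfloor>sc p x\<rfloor>\<bar>)"
        by (simp add: key_def)
      \<comment> \<open>The absolute value of an integer is at most its square, so the bound on
        squares controls a sum of absolute values.\<close>
      also have "\<dots> \<le> (\<Sum>x\<in>I. 2 * (sc p x)\<^sup>2 + 2)"
      proof (rule sum_mono)
        fix x
        let ?k = "\<lfloor>sc p x\<rfloor>"
        have "\<bar>?k\<bar> \<le> ?k\<^sup>2"
        proof (cases "?k = 0")
          case False
          then have "\<bar>?k\<bar> * 1 \<le> \<bar>?k\<bar> * \<bar>?k\<bar>" by (intro mult_left_mono) auto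
          then show ?thesis by (simp add: power2_eq_square)
        qed simp
        then have "\<bar>real_of_int ?k\<bar> \<le> (real_of_int ?k)\<^sup>2"
          by (metis of_int_abs of_int_le_iff of_int_power)
        also have "(real_of_int ?k)\<^sup>2 \<le> (\<bar>sc p x\<bar> + 1)\<^sup>2"
          by (rule power2_le_iff_abs_le[THEN iffD2]) linarith+
        also have "\<dots> \<le> 2 * (sc p x)\<^sup>2 + 2"
          using zero_le_power2[of "\<bar>sc p x\<bar> - 1"] by (simp add: power2_eq_square algebra_simps)
        finally show "\<bar>real_of_int ?k\<bar> \<le> 2 * (sc p x)\<^sup>2 + 2" .
      qed
      also have "\<dots> = 2 * (\<Sum>x\<in>I. (sc p x)\<^sup>2) + 2 * real (r * (M + 1))"
        by (simp add: sum.distrib sum_distrib_left I_def)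
      also have "\<dots> \<le> 2 * (real r / \<eta>\<^sup>2 + real r * real M / \<eta>\<^sup>2) + 2 * real (r * (M + 1))"
        using bound by simp
      also have "\<dots> = (2 / \<eta>\<^sup>2 + 2) * real (r * (M + 1))"
        by (simp add: algebra_simps add_divide_distrib)
      also have "\<dots> \<le> real T * real (r * (M + 1))" by (intro mult_right_mono T) auto
      finally have "(\<Sum>x\<in>I. \<bar>key p x\<bar>) \<le> int S" unfolding S_def by (metis of_int_le_iff of_int_of_nat_eq of_nat_mult)
      then show ?thesis by (simp add: A_def key_def)
    qed
    define \<N> where "\<N> = (\<lambda>k. mk (inv_into Par key k)) ` (key ` Par)"
    have inv: "inv_into Par key k \<in> Par" "key (inv_into Par key k) = k" if "k \<in> key ` Par" for k
      using that by (simp_all add: inv_into_into f_inv_into_f)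
    have fin: "finite (key ` Par)" using cnt(1) keyA by (meson finite_subset image_subsetI)
    have "real (card \<N>) \<le> real (card (key ` Par))"
      unfolding \<N>_def by (intro of_nat_mono card_image_le fin)
    also have "\<dots> \<le> real (card A)" using cnt(1) keyA by (intro of_nat_mono card_mono) auto
    also have "\<dots> \<le> 3 ^ card I * 2 ^ S" by (rule cnt)
    also have "\<dots> = D ^ (r * (M + 1))"
      by (simp add: I_def S_def D_def power_mult power_mult_distrib)
    \<comment> \<open>\<open>M + 1 \<le> 2 * M\<close>, hence the square of \<open>D\<close> as the
      base.\<close>
    also have "\<dots> \<le> D ^ (2 * (M * r))" using M r by (intro power_increasing D) (simp add: algebra_simps)
    finally have card: "real (card \<N>) \<le> (D\<^sup>2) ^ (M * r)" by (simp only: power_mult)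
    have mk_low: "low_rank M r 1 (mk p)" if "p \<in> Par" for p
      using that unfolding low_rank_def Par_def mk_def by (intro exI[of _ "fst p"] exI[of _ "snd p"]) auto
    have close: "low_rank M (r + r) \<rho> (\<lambda>a b. mk p a b - mk p' a b)"
      if p: "p \<in> Par" and p': "p' \<in> Par" and k: "key p = key p'" for p p'
    proof -
      have sc: "\<bar>sc p x - sc p' x\<bar> \<le> 1" if "x \<in> I" for x
      proof -
        have "\<lfloor>sc p x\<rfloor> = \<lfloor>sc p' x\<rfloor>" using fun_cong[OF k, of x] that by (simp add: key_def)
        then show ?thesis by linarith
      qed
      have "(fst p i - fst p' i)\<^sup>2 \<le> \<eta>\<^sup>2 / r" if "i < r" for i
      proof -
        have "\<bar>(fst p i - fst p' i) * (sqrt r / \<eta>)\<bar> \<le> 1"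
          using sc[of "(i, M)"] that by (simp add: sc_def I_def algebra_simps)
        then have "((fst p i - fst p' i) * (sqrt r / \<eta>))\<^sup>2 \<le> 1" by (simp only: abs_square_le_1)
        then show ?thesis using r \<eta> by (simp add: power_mult_distrib power_divide divide_simps)
      qed
      then have "(\<Sum>i<r. (fst p i - fst p' i)\<^sup>2) \<le> (\<Sum>i<r. \<eta>\<^sup>2 / r)" by (intro sum_mono) auto
      then have d\<mu>: "(\<Sum>i<r. (fst p i - fst p' i)\<^sup>2) \<le> \<eta>\<^sup>2" using r by simp
      have dq: "ip M (\<lambda>a. snd p i a - snd p' i a) (\<lambda>a. snd p i a - snd p' i a) \<le> \<eta>\<^sup>2" if "i < r" for i
      proof -
        have "(snd p i j - snd p' i j)\<^sup>2 \<le> \<eta>\<^sup>2 / M" if "j < M" for j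
        proof -
          have "\<bar>(snd p i j - snd p' i j) * (sqrt M / \<eta>)\<bar> \<le> 1"
            using sc[of "(i, j)"] \<open>i < r\<close> that by (simp add: sc_def I_def algebra_simps)
          then have "((snd p i j - snd p' i j) * (sqrt M / \<eta>))\<^sup>2 \<le> 1" by (simp only: abs_square_le_1)
          then show ?thesis using M \<eta> by (simp add: power_mult_distrib power_divide divide_simps)
        qed
        then have "(\<Sum>j<M. (snd p i j - snd p' i j)\<^sup>2) \<le> (\<Sum>j<M. \<eta>\<^sup>2 / M)" by (intro sum_mono) auto
        then show ?thesis using M by (simp add: ip_self)
      qed
      have "sqrt (frob2 M (\<lambda>a b. mk p a b - mk p' a b)) \<le> 3 * \<eta>"
        unfolding mk_def
        by (rule frob2_combination_diff) (use p p' d\<mu> dq \<eta> in \<open>auto simp: Par_def\<close>)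
      moreover have "low_rank M (r + r) (sqrt (frob2 M (\<lambda>a b. mk p a b - mk p' a b))) (\<lambda>a b. mk p a b - mk p' a b)"
      proof (rule low_rank_factorization)
        show "mk p a b - mk p' a b = mk p b a - mk p' b a" for a b
          by (simp add: mk_def mult.commute mult.left_commute)
        have split: "sum f {..<r + s} = sum f {..<r} + (\<Sum>i<s. f (r + i))" for f :: "nat \<Rightarrow> real" and s
          by (induction s) auto
        show "mk p a b - mk p' a b = (\<Sum>k<r + r.
            (if k < r then fst p k * snd p k a else - fst p' (k - r) * snd p' (k - r) a) *
            (if k < r then snd p k b else snd p' (k - r) b))" for a b
          unfolding split by (simp add: mk_def sum_negf)
      qed
      ultimately show ?thesis using low_rank_mono by (simp add: \<eta>_def)
    qed
    show "\<exists>\<N>. finite \<N> \<and> real (card \<N>) \<le> (D\<^sup>2) ^ (M * r) \<and>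
      (\<forall>X\<in>\<N>. low_rank M r 1 X \<and> frob2 M X = 1) \<and>
      (\<forall>X. low_rank M r 1 X \<and> frob2 M X = 1 \<longrightarrow>
        (\<exists>Y\<in>\<N>. low_rank M (r + r) \<rho> (\<lambda>a b. X a b - Y a b)))"
    proof (intro exI[of _ \<N>] conjI card ballI allI impI)
      show "finite \<N>" using fin by (simp add: \<N>_def)
    next
      fix X assume "X \<in> \<N>"
      then obtain k where "k \<in> key ` Par" "X = mk (inv_into Par key k)" unfolding \<N>_def by blast
      then obtain p where p: "p \<in> Par" "X = mk p" using inv(1) by blast
      show "low_rank M r 1 X" using p mk_low by simp
      show "frob2 M X = 1" using p by (simp add: Par_def)
    next
      fix X assume X: "low_rank M r 1 X \<and> frob2 M X = 1"
      then obtain \<mu> q where q: "orthfam M r q" and m: "(\<Sum>i<r. (\<mu> i)\<^sup>2) \<le> 1"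
        and Xe: "\<And>a b. a < M \<Longrightarrow> b < M \<Longrightarrow> X a b = mk (\<mu>, q) a b"
        unfolding low_rank_def mk_def by auto
      have p: "(\<mu>, q) \<in> Par" using q m X frob2_cong[of M X "mk (\<mu>, q)"] Xe by (simp add: Par_def)
      define p' where "p' = inv_into Par key (key (\<mu>, q))"
      have "p' \<in> Par" "key p' = key (\<mu>, q)" using inv p by (auto simp: p'_def)
      then have "low_rank M (r + r) \<rho> (\<lambda>a b. mk (\<mu>, q) a b - mk p' a b)" using close p by auto
      then have "low_rank M (r + r) \<rho> (\<lambda>a b. X a b - mk p' a b)"
        unfolding low_rank_def using Xe by simp
      then show "\<exists>Y\<in>\<N>. low_rank M (r + r) \<rho> (\<lambda>a b. X a b - Y a b)"
        using p by (auto simp: \<N>_def p'_def)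
    qed
  qed
qed

section \<open>Gaussian quadratic forms\<close>

abbreviation std_normal :: "real measure" where
  "std_normal \<equiv> density lborel (\<lambda>x. ennreal (std_normal_density x))"

lemma prob_space_std_normal: "prob_space std_normal"
  by (rule prob_space_normal_density) simp

interpretation std_normal: prob_space std_normal
  by (rule prob_space_std_normal)

interpretation std_normal_product: product_prob_space "\<lambda>_::'i. std_normal" UNIV
  by standard

abbreviation std_normal_vec :: "nat \<Rightarrow> (nat \<Rightarrow> real) measure" where
  "std_normal_vec M \<equiv> PiM {..<M} (\<lambda>_. std_normal)"

lemma prob_space_std_normal_vec: "prob_space (PiM I (\<lambda>_. std_normal))"
  by (rule prob_space_PiM) (rule prob_space_std_normal)

section \<open>Rotation invariance of Gaussian product measures\<close>

lemma nn_integral_std_normal: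
  "f \<in> borel_measurable borel \<Longrightarrow>
    (\<integral>\<^sup>+x. f x \<partial>std_normal) = (\<integral>\<^sup>+x. ennreal (std_normal_density x) * f x \<partial>lborel)"
  by (rule nn_integral_density) auto

lemma std_normal_density_rotate:
  fixes c k :: real
  assumes "c\<^sup>2 + k\<^sup>2 = 1"
  shows "std_normal_density (c * s + k * t) * std_normal_density (c * t - k * s) =
    std_normal_density s * std_normal_density t"
proof -
  have "(c * s + k * t)\<^sup>2 + (c * t - k * s)\<^sup>2 = (c\<^sup>2 + k\<^sup>2) * (s\<^sup>2 + t\<^sup>2)"
    by (simp add: power2_eq_square algebra_simps)
  also have "\<dots> = s\<^sup>2 + t\<^sup>2" using assms by simp
  finally have e: "(c * s + k * t)\<^sup>2 + (c * t - k * s)\<^sup>2 = s\<^sup>2 + t\<^sup>2" .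
  have "std_normal_density x * std_normal_density y = (1 / sqrt (2 * pi))\<^sup>2 * exp (- (x\<^sup>2 + y\<^sup>2) / 2)" for x y
    by (simp add: std_normal_density_def power2_eq_square exp_add[symmetric] diff_divide_distrib add_divide_distrib)
  then show ?thesis by (simp only: e)
qed

text \<open>For fixed \<open>t\<close> the variable \<open>s\<close> is replaced by
  \<open>p = c * s + k * t\<close>, then for fixed \<open>p\<close> the variable \<open>t\<close> is
  replaced: two one-dimensional affine substitutions, whose factors 1 / |c| and |c| cancel. The
  division by \<open>c\<close> excludes the rotation by a right angle.\<close>

lemma nn_integral_lborel_rotate:
  fixes f :: "real \<Rightarrow> real \<Rightarrow> ennreal"
  assumes [measurable]: "case_prod f \<in> borel_measurable (borel \<Otimes>\<^sub>M borel)" and ck: "c\<^sup>2 + k\<^sup>2 = 1" and "c \<noteq> 0"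
  shows "(\<integral>\<^sup>+s. \<integral>\<^sup>+t. f (c * s + k * t) (c * t - k * s) \<partial>lborel \<partial>lborel) = (\<integral>\<^sup>+s. \<integral>\<^sup>+t. f s t \<partial>lborel \<partial>lborel)"
proof -
  have m1: "f s \<in> borel_measurable borel" for s by measurable
  have "(\<integral>\<^sup>+s. \<integral>\<^sup>+t. f (c * s + k * t) (c * t - k * s) \<partial>lborel \<partial>lborel) =
      (\<integral>\<^sup>+t. \<integral>\<^sup>+s. f (c * s + k * t) (c * t - k * s) \<partial>lborel \<partial>lborel)"
    by (rule lborel_pair.Fubini'[symmetric]) measurable
  also have "\<dots> = (\<integral>\<^sup>+t. ennreal \<bar>1 / c\<bar> * (\<integral>\<^sup>+p. f p (t / c - k / c * p) \<partial>lborel) \<partial>lborel)"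
  proof (intro nn_integral_cong)
    fix t :: real
    have e: "c * t - k * (- k * t / c + 1 / c * p) = t / c - k / c * p" for p
    proof -
      have "c * t + k * k * t / c = (c\<^sup>2 + k\<^sup>2) * t / c"
        using \<open>c \<noteq> 0\<close> by (simp add: power2_eq_square field_simps)
      then show ?thesis using ck by (simp add: algebra_simps)
    qed
    have "(\<integral>\<^sup>+s. f (c * s + k * t) (c * t - k * s) \<partial>lborel) =
      ennreal \<bar>1 / c\<bar> * (\<integral>\<^sup>+p. f (c * (- k * t / c + 1 / c * p) + k * t) (c * t - k * (- k * t / c + 1 / c * p)) \<partial>lborel)"
      using \<open>c \<noteq> 0\<close> by (intro nn_integral_real_affine) auto
    then show "(\<integral>\<^sup>+s. f (c * s + k * t) (c * t - k * s) \<partial>lborel) = ennreal \<bar>1 / c\<bar> * (\<integral>\<^sup>+p. f p (t / c - k / c * p) \<partial>lborel)"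
      unfolding e using \<open>c \<noteq> 0\<close> by (simp add: algebra_simps)
  qed
  also have "\<dots> = ennreal \<bar>1 / c\<bar> * (\<integral>\<^sup>+t. \<integral>\<^sup>+p. f p (t / c - k / c * p) \<partial>lborel \<partial>lborel)"
    by (rule nn_integral_cmult) measurable
  also have "(\<integral>\<^sup>+t. \<integral>\<^sup>+p. f p (t / c - k / c * p) \<partial>lborel \<partial>lborel) = (\<integral>\<^sup>+p. \<integral>\<^sup>+t. f p (t / c - k / c * p) \<partial>lborel \<partial>lborel)"
    by (rule lborel_pair.Fubini'[symmetric]) measurable
  also have "\<dots> = (\<integral>\<^sup>+p. ennreal \<bar>c\<bar> * (\<integral>\<^sup>+t. f p t \<partial>lborel) \<partial>lborel)"
  proof (intro nn_integral_cong)
    fix p :: real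
    have "(\<integral>\<^sup>+t. f p (t / c - k / c * p) \<partial>lborel) = ennreal \<bar>c\<bar> * (\<integral>\<^sup>+t. f p ((k * p + c * t) / c - k / c * p) \<partial>lborel)"
      using \<open>c \<noteq> 0\<close> by (intro nn_integral_real_affine) auto
    then show "(\<integral>\<^sup>+t. f p (t / c - k / c * p) \<partial>lborel) = ennreal \<bar>c\<bar> * (\<integral>\<^sup>+t. f p t \<partial>lborel)"
      using \<open>c \<noteq> 0\<close> by (simp add: add_divide_distrib)
  qed
  also have "\<dots> = ennreal \<bar>c\<bar> * (\<integral>\<^sup>+p. \<integral>\<^sup>+t. f p t \<partial>lborel \<partial>lborel)"
    by (rule nn_integral_cmult) measurable
  also have "ennreal \<bar>1 / c\<bar> * \<dots> = (\<integral>\<^sup>+p. \<integral>\<^sup>+t. f p t \<partial>lborel \<partial>lborel)"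
    using \<open>c \<noteq> 0\<close> by (simp add: mult.assoc[symmetric] ennreal_mult[symmetric] abs_mult[symmetric])
  finally show ?thesis .
qed

lemma nn_integral_std_normal_rotate:
  fixes F :: "real \<Rightarrow> real \<Rightarrow> ennreal"
  assumes [measurable]: "case_prod F \<in> borel_measurable (borel \<Otimes>\<^sub>M borel)" and ck: "c\<^sup>2 + k\<^sup>2 = 1" and "c \<noteq> 0"
  shows "(\<integral>\<^sup>+s. \<integral>\<^sup>+t. F (c * s + k * t) (c * t - k * s) \<partial>std_normal \<partial>std_normal) =
    (\<integral>\<^sup>+s. \<integral>\<^sup>+t. F s t \<partial>std_normal \<partial>std_normal)"
proof -
  define f where "f s t = ennreal (std_normal_density s * std_normal_density t) * F s t" for s t
  have dens: "(\<integral>\<^sup>+s. \<integral>\<^sup>+t. G s t \<partial>std_normal \<partial>std_normal) =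
      (\<integral>\<^sup>+s. \<integral>\<^sup>+t. ennreal (std_normal_density s * std_normal_density t) * G s t \<partial>lborel \<partial>lborel)"
    if [measurable]: "case_prod G \<in> borel_measurable (borel \<Otimes>\<^sub>M borel)" for G :: "real \<Rightarrow> real \<Rightarrow> ennreal"
  proof -
    have [measurable]: "G s \<in> borel_measurable borel" for s by measurable
    have "(\<integral>\<^sup>+s. \<integral>\<^sup>+t. G s t \<partial>std_normal \<partial>std_normal) =
        (\<integral>\<^sup>+s. \<integral>\<^sup>+t. ennreal (std_normal_density t) * G s t \<partial>lborel \<partial>std_normal)"
      by (simp add: nn_integral_std_normal)
    also have "\<dots> = (\<integral>\<^sup>+s. ennreal (std_normal_density s) * (\<integral>\<^sup>+t. ennreal (std_normal_density t) * G s t \<partial>lborel) \<partial>lborel)"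
      by (rule nn_integral_std_normal) measurable
    also have "\<dots> = (\<integral>\<^sup>+s. \<integral>\<^sup>+t. ennreal (std_normal_density s) * (ennreal (std_normal_density t) * G s t) \<partial>lborel \<partial>lborel)"
      by (intro nn_integral_cong nn_integral_cmult[symmetric]) measurable
    finally show ?thesis by (simp add: ennreal_mult mult.assoc)
  qed
  have "(\<integral>\<^sup>+s. \<integral>\<^sup>+t. F (c * s + k * t) (c * t - k * s) \<partial>std_normal \<partial>std_normal) =
      (\<integral>\<^sup>+s. \<integral>\<^sup>+t. f (c * s + k * t) (c * t - k * s) \<partial>lborel \<partial>lborel)"
    unfolding f_def std_normal_density_rotate[OF ck] by (rule dens) measurable
  also have "\<dots> = (\<integral>\<^sup>+s. \<integral>\<^sup>+t. f s t \<partial>lborel \<partial>lborel)"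
    by (rule nn_integral_lborel_rotate[OF _ ck \<open>c \<noteq> 0\<close>]) (unfold f_def, measurable)
  also have "\<dots> = (\<integral>\<^sup>+s. \<integral>\<^sup>+t. F s t \<partial>std_normal \<partial>std_normal)"
    unfolding f_def by (rule dens[symmetric]) measurable
  finally show ?thesis .
qed

text \<open>Symmetry of the normal density, read off from the half turn with \<open>c = -1\<close>
  and \<open>k = 0\<close>.\<close>

lemma nn_integral_std_normal_reflect:
  fixes h :: "real \<Rightarrow> ennreal"
  assumes [measurable]: "h \<in> borel_measurable borel"
  shows "(\<integral>\<^sup>+s. h (\<bar>z\<bar> * s) \<partial>std_normal) = (\<integral>\<^sup>+s. h (z * s) \<partial>std_normal)"
proof -
  have "(\<integral>\<^sup>+s. \<integral>\<^sup>+t. h (z * (-1 * s + 0 * t)) \<partial>std_normal \<partial>std_normal) =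
      (\<integral>\<^sup>+s. \<integral>\<^sup>+t. h (z * s) \<partial>std_normal \<partial>std_normal)"
    by (rule nn_integral_std_normal_rotate[of "\<lambda>s t. h (z * s)"]) auto
  then show ?thesis using std_normal.emeasure_space_1 by (cases "z \<ge> 0") simp_all
qed

text \<open>By induction the partial sum is distributed as \<open>\<sigma> * t\<close> with
  \<open>t\<close> standard normal, and the rotation with cosine \<open>\<sigma> / \<sigma>'\<close>
  merges it with the new term. Since \<open>h\<close> is arbitrary, moments and exponential moments
  are covered alike.\<close>

lemma nn_integral_linear_form:
  fixes h :: "real \<Rightarrow> ennreal"
  assumes "finite I" and [measurable]: "h \<in> borel_measurable borel"
  shows "(\<integral>\<^sup>+u. h (\<Sum>i\<in>I. z i * u i) \<partial>PiM I (\<lambda>_. std_normal)) =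
    (\<integral>\<^sup>+s. h (sqrt (\<Sum>i\<in>I. (z i)\<^sup>2) * s) \<partial>std_normal)"
  using assms
proof (induction I arbitrary: h)
  case empty
  have "(\<integral>\<^sup>+s. h 0 \<partial>std_normal) = h 0" using std_normal.emeasure_space_1 by simp
  then show ?case by (simp add: PiM_empty nn_integral_count_space_finite)
next
  case (insert i I)
  note [measurable] = insert.prems
  define \<sigma> where "\<sigma> = sqrt (\<Sum>i\<in>I. (z i)\<^sup>2)"
  define \<sigma>' where "\<sigma>' = sqrt (\<Sum>i\<in>insert i I. (z i)\<^sup>2)"
  have \<sigma>: "\<sigma> \<ge> 0" "\<sigma>' \<ge> 0" "\<sigma>'\<^sup>2 = \<sigma>\<^sup>2 + (z i)\<^sup>2"
    using insert(1,2) by (auto simp: \<sigma>_def \<sigma>'_def sum_nonneg add_nonneg_nonneg)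
  have "(\<integral>\<^sup>+u. h (\<Sum>i\<in>insert i I. z i * u i) \<partial>PiM (insert i I) (\<lambda>_. std_normal)) =
     (\<integral>\<^sup>+u. \<integral>\<^sup>+s. h (\<Sum>j\<in>insert i I. z j * (u(i := s)) j) \<partial>std_normal \<partial>PiM I (\<lambda>_. std_normal))"
    by (rule std_normal_product.product_nn_integral_insert) (use insert(1,2) in measurable)
  also have "\<dots> = (\<integral>\<^sup>+u. \<integral>\<^sup>+s. h (z i * s + (\<Sum>j\<in>I. z j * u j)) \<partial>std_normal \<partial>PiM I (\<lambda>_. std_normal))"
    using insert(1,2) by (auto intro!: nn_integral_cong arg_cong[where f=h] sum.cong)
  also have "\<dots> = (\<integral>\<^sup>+t. \<integral>\<^sup>+s. h (z i * s + \<sigma> * t) \<partial>std_normal \<partial>std_normal)"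
    unfolding \<sigma>_def by (rule insert.IH[of "\<lambda>x. \<integral>\<^sup>+s. h (z i * s + x) \<partial>std_normal"]) measurable
  also have "\<dots> = (\<integral>\<^sup>+s. h (\<sigma>' * s) \<partial>std_normal)"
  proof (cases "\<sigma> = 0")
    \<comment> \<open>The cosine would be 0 here; the new term stands alone, and its sign is removed
      by reflection.\<close>
    case True
    then have "\<sigma>' = \<bar>z i\<bar>" using \<sigma> by (simp add: power2_eq_iff_nonneg flip: real_sqrt_abs real_sqrt_unique)
    then show ?thesis
      using True std_normal.emeasure_space_1 by (simp add: nn_integral_std_normal_reflect)
  next
    case False
    then have \<sigma>'0: "\<sigma>' > 0" using \<sigma> by (metis add_pos_nonneg less_eq_real_def power2_less_0 zero_le_power2 zero_less_power2)
    have ck: "(\<sigma> / \<sigma>')\<^sup>2 + (z i / \<sigma>')\<^sup>2 = 1"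
      using \<sigma>'0 by (simp add: power_divide \<sigma>(3)[symmetric] flip: add_divide_distrib)
    have "(\<integral>\<^sup>+t. \<integral>\<^sup>+s. h (z i * s + \<sigma> * t) \<partial>std_normal \<partial>std_normal) =
       (\<integral>\<^sup>+t. \<integral>\<^sup>+s. h (\<sigma>' * (\<sigma> / \<sigma>' * t + z i / \<sigma>' * s)) \<partial>std_normal \<partial>std_normal)"
      using \<sigma>'0 by (simp add: algebra_simps)
    also have "\<dots> = (\<integral>\<^sup>+t. \<integral>\<^sup>+s. h (\<sigma>' * t) \<partial>std_normal \<partial>std_normal)"
      using nn_integral_std_normal_rotate[of "\<lambda>p q. h (\<sigma>' * p)", OF _ ck] False \<sigma>'0 by simp
    finally show ?thesis using std_normal.emeasure_space_1 by simp
  qed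
  finally show ?case by (simp add: \<sigma>'_def)
qed


text \<open>Moves coordinate \<open>i\<close> of both vectors into the two innermost integrals,
  where a rotation of the plane applies.\<close>

lemma nn_integral_pair_insert:
  fixes G :: "('i \<Rightarrow> real) \<Rightarrow> ('i \<Rightarrow> real) \<Rightarrow> ennreal"
  assumes I: "finite I" "i \<notin> I"
    and [measurable]: "case_prod G \<in> borel_measurable (PiM (insert i I) (\<lambda>_. std_normal) \<Otimes>\<^sub>M PiM (insert i I) (\<lambda>_. std_normal))"
  shows "(\<integral>\<^sup>+x. \<integral>\<^sup>+y. G x y \<partial>PiM (insert i I) (\<lambda>_. std_normal) \<partial>PiM (insert i I) (\<lambda>_. std_normal)) =
    (\<integral>\<^sup>+x. \<integral>\<^sup>+y. \<integral>\<^sup>+s. \<integral>\<^sup>+t. G (x(i := s)) (y(i := t)) \<partial>std_normal \<partial>std_normal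
      \<partial>PiM I (\<lambda>_. std_normal) \<partial>PiM I (\<lambda>_. std_normal))"
proof -
  let ?P = "PiM I (\<lambda>_. std_normal)" and ?P' = "PiM (insert i I) (\<lambda>_. std_normal)"
  interpret P: prob_space ?P by (rule prob_space_std_normal_vec)
  interpret P': prob_space ?P' by (rule prob_space_std_normal_vec)
  interpret Q: pair_sigma_finite std_normal ?P ..
  have upd [measurable]: "(\<lambda>(x, s). x(i := s)) \<in> measurable (?P \<Otimes>\<^sub>M std_normal) ?P'"
    by (rule measurable_add_dim)
  have upd1: "(\<lambda>s. x(i := s)) \<in> measurable std_normal ?P'" if "x \<in> space ?P" for x
    using measurable_compose[OF measurable_Pair1'[OF that, of std_normal] upd] by simp
  have "(\<integral>\<^sup>+x. \<integral>\<^sup>+y. G x y \<partial>?P' \<partial>?P') = (\<integral>\<^sup>+x. \<integral>\<^sup>+s. \<integral>\<^sup>+y. G (x(i := s)) y \<partial>?P' \<partial>std_normal \<partial>?P)"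
    by (rule std_normal_product.product_nn_integral_insert[OF I]) measurable
  also have "\<dots> = (\<integral>\<^sup>+x. \<integral>\<^sup>+s. \<integral>\<^sup>+y. \<integral>\<^sup>+t. G (x(i := s)) (y(i := t)) \<partial>std_normal \<partial>?P \<partial>std_normal \<partial>?P)"
  proof (intro nn_integral_cong std_normal_product.product_nn_integral_insert[OF I])
    fix x s assume x: "x \<in> space ?P" and "s \<in> space std_normal"
    then have "x(i := s) \<in> space ?P'" using measurable_space[OF upd1] by blast
    then show "G (x(i := s)) \<in> borel_measurable ?P'" by measurable
  qed
  also have "\<dots> = (\<integral>\<^sup>+x. \<integral>\<^sup>+y. \<integral>\<^sup>+s. \<integral>\<^sup>+t. G (x(i := s)) (y(i := t)) \<partial>std_normal \<partial>std_normal \<partial>?P \<partial>?P)"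
  proof (intro nn_integral_cong Q.Fubini'[symmetric])
    fix x assume x: "x \<in> space ?P"
    have [measurable]: "(\<lambda>s. x(i := s)) \<in> measurable std_normal ?P'" by (rule upd1[OF x])
    show "(\<lambda>(s, y). \<integral>\<^sup>+t. G (x(i := s)) (y(i := t)) \<partial>std_normal) \<in> borel_measurable (std_normal \<Otimes>\<^sub>M ?P)"
      by measurable
  qed
  finally show ?thesis .
qed

text \<open>The rotation acts on each pair \<open>(x i, y i)\<close> separately, so one plane is
  rotated at a time.\<close>

lemma nn_integral_std_normal_vec_rotate:
  fixes F :: "('i \<Rightarrow> real) \<Rightarrow> ('i \<Rightarrow> real) \<Rightarrow> ennreal"
  assumes I: "finite I"
    and F: "case_prod F \<in> borel_measurable (PiM I (\<lambda>_. std_normal) \<Otimes>\<^sub>M PiM I (\<lambda>_. std_normal))"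
    and ck: "c\<^sup>2 + k\<^sup>2 = 1" "c \<noteq> 0"
  shows "(\<integral>\<^sup>+x. \<integral>\<^sup>+y. F (\<lambda>i\<in>I. c * x i + k * y i) (\<lambda>i\<in>I. c * y i - k * x i)
      \<partial>PiM I (\<lambda>_. std_normal) \<partial>PiM I (\<lambda>_. std_normal)) =
    (\<integral>\<^sup>+x. \<integral>\<^sup>+y. F x y \<partial>PiM I (\<lambda>_. std_normal) \<partial>PiM I (\<lambda>_. std_normal))"
  using I F
proof (induction I arbitrary: F)
  case empty
  show ?case by (simp add: PiM_empty nn_integral_count_space_finite)
next
  case (insert i I)
  note [measurable] = insert.prems
  let ?P = "PiM I (\<lambda>_. std_normal)" and ?P' = "PiM (insert i I) (\<lambda>_. std_normal)"
  interpret P: prob_space ?P by (rule prob_space_std_normal_vec)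
  interpret P': prob_space ?P' by (rule prob_space_std_normal_vec)
  have upd [measurable]: "(\<lambda>(x, s). x(i := s)) \<in> measurable (?P \<Otimes>\<^sub>M std_normal) ?P'"
    by (rule measurable_add_dim)
  have upd1: "(\<lambda>s. x(i := s)) \<in> measurable std_normal ?P'" if "x \<in> space ?P" for x
    using measurable_compose[OF measurable_Pair1'[OF that, of std_normal] upd] by simp
  define G where "G x y = F (\<lambda>j\<in>insert i I. c * x j + k * y j) (\<lambda>j\<in>insert i I. c * y j - k * x j)" for x y
  have [measurable]: "case_prod G \<in> borel_measurable (?P' \<Otimes>\<^sub>M ?P')"
    unfolding G_def by measurable
  define u where "u x y = (\<lambda>j\<in>I. c * x j + k * y j)" for x y :: "'i \<Rightarrow> real"
  define v where "v x y = (\<lambda>j\<in>I. c * y j - k * x j)" for x y :: "'i \<Rightarrow> real"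
  have uv: "u x y \<in> space ?P" "v x y \<in> space ?P" for x y
    by (auto simp: u_def v_def space_PiM)
  have G: "G (x(i := s)) (y(i := t)) = F ((u x y)(i := c * s + k * t)) ((v x y)(i := c * t - k * s))" for x y s t
    unfolding G_def u_def v_def using insert(2)
    by (intro arg_cong2[where f = F]) (auto simp: fun_eq_iff restrict_def)
  have "(\<integral>\<^sup>+x. \<integral>\<^sup>+y. G x y \<partial>?P' \<partial>?P') =
      (\<integral>\<^sup>+x. \<integral>\<^sup>+y. \<integral>\<^sup>+s. \<integral>\<^sup>+t. G (x(i := s)) (y(i := t)) \<partial>std_normal \<partial>std_normal \<partial>?P \<partial>?P)"
    by (rule nn_integral_pair_insert) (use insert in measurable)
  also have "\<dots> = (\<integral>\<^sup>+x. \<integral>\<^sup>+y. \<integral>\<^sup>+s. \<integral>\<^sup>+t. F ((u x y)(i := s)) ((v x y)(i := t)) \<partial>std_normal \<partial>std_normal \<partial>?P \<partial>?P)"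
  proof -
    have "(\<integral>\<^sup>+s. \<integral>\<^sup>+t. F ((u x y)(i := c * s + k * t)) ((v x y)(i := c * t - k * s)) \<partial>std_normal \<partial>std_normal) =
        (\<integral>\<^sup>+s. \<integral>\<^sup>+t. F ((u x y)(i := s)) ((v x y)(i := t)) \<partial>std_normal \<partial>std_normal)" for x y
    proof (rule nn_integral_std_normal_rotate[of "\<lambda>s t. F ((u x y)(i := s)) ((v x y)(i := t))", OF _ ck])
      have [measurable]: "(\<lambda>s. (u x y)(i := s)) \<in> measurable std_normal ?P'" "(\<lambda>s. (v x y)(i := s)) \<in> measurable std_normal ?P'"
        by (intro upd1 uv)+
      have "(\<lambda>(s, t). F ((u x y)(i := s)) ((v x y)(i := t))) \<in> borel_measurable (std_normal \<Otimes>\<^sub>M std_normal)"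
        by measurable
      then show "(\<lambda>(s, t). F ((u x y)(i := s)) ((v x y)(i := t))) \<in> borel_measurable (borel \<Otimes>\<^sub>M borel)"
        by (simp cong: measurable_cong_sets sets_pair_measure_cong)
    qed
    then show ?thesis by (simp only: G)
  qed
  also have "\<dots> = (\<integral>\<^sup>+x. \<integral>\<^sup>+y. \<integral>\<^sup>+s. \<integral>\<^sup>+t. F (x(i := s)) (y(i := t)) \<partial>std_normal \<partial>std_normal \<partial>?P \<partial>?P)"
    unfolding u_def v_def
    by (rule insert.IH[of "\<lambda>x y. \<integral>\<^sup>+s. \<integral>\<^sup>+t. F (x(i := s)) (y(i := t)) \<partial>std_normal \<partial>std_normal"]) measurable
  also have "\<dots> = (\<integral>\<^sup>+x. \<integral>\<^sup>+y. F x y \<partial>?P' \<partial>?P')"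
    by (rule nn_integral_pair_insert[symmetric]) (use insert in measurable)
  finally show ?case unfolding G_def .
qed

section \<open>Quadratic forms of independent Gaussian vectors\<close>

definition bform :: "nat \<Rightarrow> (nat \<Rightarrow> nat \<Rightarrow> real) \<Rightarrow> (nat \<Rightarrow> real) \<Rightarrow> (nat \<Rightarrow> real) \<Rightarrow> real" where
  "bform M X x y = ip M x (\<lambda>a. ip M (X a) y)"

lemma bform_symmetric:
  assumes "\<And>a b. a < M \<Longrightarrow> b < M \<Longrightarrow> X a b = X b a"
  shows "bform M X x y = bform M X y x"
proof -
  have "bform M X x y = (\<Sum>a<M. \<Sum>b<M. X a b * x a * y b)"
    by (simp add: bform_def ip_def sum_distrib_left algebra_simps)
  also have "\<dots> = (\<Sum>b<M. \<Sum>a<M. X a b * x a * y b)" by (rule sum.swap)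
  also have "\<dots> = (\<Sum>b<M. \<Sum>a<M. X b a * y b * x a)" using assms by (intro sum.cong refl) (simp add: algebra_simps)
  also have "\<dots> = bform M X y x"
    by (simp add: bform_def ip_def sum_distrib_left algebra_simps)
  finally show ?thesis .
qed

lemma ip_measurable [measurable]:
  assumes [measurable]: "\<And>a. a < M \<Longrightarrow> (\<lambda>w. f w a) \<in> borel_measurable N" "\<And>a. a < M \<Longrightarrow> (\<lambda>w. g w a) \<in> borel_measurable N"
  shows "(\<lambda>w. ip M (f w) (g w)) \<in> borel_measurable N"
  unfolding ip_def by (intro borel_measurable_sum borel_measurable_times) (use assms in auto)

lemma bform_measurable [measurable]:
  assumes [measurable]: "\<And>a. a < M \<Longrightarrow> (\<lambda>w. f w a) \<in> borel_measurable N" "\<And>a. a < M \<Longrightarrow> (\<lambda>w. g w a) \<in> borel_measurable N"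
  shows "(\<lambda>w. bform M X (f w) (g w)) \<in> borel_measurable N"
  unfolding bform_def by (intro ip_measurable assms borel_measurable_const)

lemma component_measurable_borel:
  "a \<in> I \<Longrightarrow> (\<lambda>w. w a) \<in> borel_measurable (PiM I (\<lambda>_. std_normal))"
  by measurable

lemma nn_integral_ip:
  assumes [measurable]: "h \<in> borel_measurable borel"
  shows "(\<integral>\<^sup>+u. h (ip M z u) \<partial>std_normal_vec M) = (\<integral>\<^sup>+s. h (sqrt (ip M z z) * s) \<partial>std_normal)"
  using nn_integral_linear_form[of "{..<M}" h z] by (simp add: ip_def power2_eq_square)

text \<open>Polarisation: half the difference of the quadratic forms is the bilinear form at (x + y)
  / sqrt 2 and (y - x) / sqrt 2, which are again independent standard vectors. Given one of them,
  the form is linear in the other, hence normal, with the length of X x as standard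
  deviation.\<close>

lemma nn_integral_bform:
  assumes [measurable]: "h \<in> borel_measurable borel"
    and sym: "\<And>a b. a < M \<Longrightarrow> b < M \<Longrightarrow> X a b = X b a"
  shows "(\<integral>\<^sup>+x. \<integral>\<^sup>+y. h ((bform M X y y - bform M X x x) / 2) \<partial>std_normal_vec M \<partial>std_normal_vec M) =
    (\<integral>\<^sup>+x. \<integral>\<^sup>+s. h (sqrt (\<Sum>b<M. (ip M (X b) x)\<^sup>2) * s) \<partial>std_normal \<partial>std_normal_vec M)"
proof -
  let ?c = "1 / sqrt 2 :: real"
  have [measurable]: "(\<lambda>(x, y). h (bform M X x y)) \<in> borel_measurable (std_normal_vec M \<Otimes>\<^sub>M std_normal_vec M)"
    by measurable
  have rot: "bform M X (\<lambda>i\<in>{..<M}. ?c * x i + ?c * y i) (\<lambda>i\<in>{..<M}. ?c * y i - ?c * x i) =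
      (bform M X y y - bform M X x x) / 2" for x y
  proof -
    have "bform M X (\<lambda>i\<in>{..<M}. ?c * x i + ?c * y i) (\<lambda>i\<in>{..<M}. ?c * y i - ?c * x i) =
        ?c * ?c * (bform M X y y - bform M X x x + (bform M X x y - bform M X y x))"
      by (simp add: bform_def ip_def sum_distrib_left sum.distrib sum_subtractf algebra_simps)
    then show ?thesis by (simp add: bform_symmetric[of M X x y, OF sym])
  qed
  have "(\<integral>\<^sup>+x. \<integral>\<^sup>+y. h ((bform M X y y - bform M X x x) / 2) \<partial>std_normal_vec M \<partial>std_normal_vec M) =
     (\<integral>\<^sup>+x. \<integral>\<^sup>+y. h (bform M X x y) \<partial>std_normal_vec M \<partial>std_normal_vec M)"
    unfolding rot[symmetric]
    by (rule nn_integral_std_normal_vec_rotate[of _ "\<lambda>x y. h (bform M X x y)"]) (auto simp: power_divide)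
  also have "\<dots> = (\<integral>\<^sup>+x. \<integral>\<^sup>+y. h (ip M (\<lambda>a. ip M (X a) x) y) \<partial>std_normal_vec M \<partial>std_normal_vec M)"
    by (intro nn_integral_cong arg_cong[of _ _ h], subst bform_symmetric[OF sym])
      (simp_all add: bform_def ip_commute)
  also have "\<dots> = (\<integral>\<^sup>+x. \<integral>\<^sup>+s. h (sqrt (\<Sum>b<M. (ip M (X b) x)\<^sup>2) * s) \<partial>std_normal \<partial>std_normal_vec M)"
    by (simp add: nn_integral_ip ip_self)
  finally show ?thesis .
qed

section \<open>Moments of a single measurement difference\<close>

lemma nn_integral_std_normal_even_moment:
  "(\<integral>\<^sup>+s. ennreal (s ^ (2 * k)) \<partial>std_normal) = ennreal (fact (2 * k) / (2 ^ k * fact k))"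
proof -
  have "(\<integral>\<^sup>+s. ennreal (s ^ (2 * k)) \<partial>std_normal) = (\<integral>\<^sup>+s. ennreal (std_normal_density s * s ^ (2 * k)) \<partial>lborel)"
    by (subst nn_integral_std_normal) (auto simp: ennreal_mult)
  also have "\<dots> = ennreal (fact (2 * k) / (2 ^ k * fact k))"
    using std_normal_moment_even[of k] by (intro nn_integral_eq_integral[THEN trans])
      (auto simp: has_bochner_integral_iff)
  finally show ?thesis .
qed

lemma nn_integral_std_normal_exp:
  "(\<integral>\<^sup>+s. ennreal (exp (w * s)) \<partial>std_normal) = ennreal (exp (w\<^sup>2 / 2))"
proof -
  have "std_normal_density s * exp (w * s) = exp (w\<^sup>2 / 2) * normal_density w 1 s" for s
    by (simp add: normal_density_def mult_exp_exp power2_eq_square field_simps)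
  then have "(\<integral>\<^sup>+s. ennreal (exp (w * s)) \<partial>std_normal) = (\<integral>\<^sup>+s. ennreal (exp (w\<^sup>2 / 2)) * ennreal (normal_density w 1 s) \<partial>lborel)"
    by (subst nn_integral_std_normal) (auto simp flip: ennreal_mult)
  also have "\<dots> = ennreal (exp (w\<^sup>2 / 2)) * (\<integral>\<^sup>+s. ennreal (normal_density w 1 s) \<partial>lborel)"
    by (rule nn_integral_cmult) measurable
  also have "(\<integral>\<^sup>+s. ennreal (normal_density w 1 s) \<partial>lborel) = 1"
    by (subst nn_integral_eq_integral) auto
  finally show ?thesis by simp
qed

text \<open>The exponential factor only changes the variance from 1 to 4/3, since 1/2 - 1/8 = 3/8;
  the normalisation leaves 2 / sqrt 3.\<close>

lemma nn_integral_std_normal_exp_square: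
  "(\<integral>\<^sup>+s. ennreal (exp (s\<^sup>2 / 8)) \<partial>std_normal) = ennreal (2 / sqrt 3)"
proof -
  have "std_normal_density s * exp (s\<^sup>2 / 8) = 2 / sqrt 3 * normal_density 0 (2 / sqrt 3) s" for s
  proof -
    have "sqrt (2 * pi * (2 / sqrt 3)\<^sup>2) = sqrt (2 * pi) * (2 / sqrt 3)"
      by (simp only: real_sqrt_mult real_sqrt_abs) simp
    then show ?thesis
      by (simp add: normal_density_def mult_exp_exp power_divide power_mult_distrib field_simps)
  qed
  then have "(\<integral>\<^sup>+s. ennreal (exp (s\<^sup>2 / 8)) \<partial>std_normal) = (\<integral>\<^sup>+s. ennreal (2 / sqrt 3) * ennreal (normal_density 0 (2 / sqrt 3) s) \<partial>lborel)"
    by (subst nn_integral_std_normal) (auto simp flip: ennreal_mult)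
  also have "\<dots> = ennreal (2 / sqrt 3) * (\<integral>\<^sup>+s. ennreal (normal_density 0 (2 / sqrt 3) s) \<partial>lborel)"
    by (rule nn_integral_cmult) measurable
  also have "(\<integral>\<^sup>+s. ennreal (normal_density 0 (2 / sqrt 3) s) \<partial>lborel) = 1"
    by (subst nn_integral_eq_integral) auto
  finally show ?thesis by simp
qed

text \<open>The rows of \<open>X\<close>, normalised, form a convex combination, so that Jensen's inequality reduces
  the squared norm of \<open>X x\<close> to a single standard normal variable.\<close>

lemma nn_integral_convex_square_norm_le:
  assumes conv: "convex_on UNIV \<phi>" and mono: "\<And>s t. 0 \<le> s \<Longrightarrow> s \<le> t \<Longrightarrow> \<phi> s \<le> \<phi> t"
    and nonneg: "\<And>t. 0 \<le> \<phi> t" and [measurable]: "\<phi> \<in> borel_measurable borel"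
    and X: "frob2 M X = 1"
  shows "(\<integral>\<^sup>+x. ennreal (\<phi> (\<Sum>b<M. (ip M (X b) x)\<^sup>2)) \<partial>std_normal_vec M) \<le> (\<integral>\<^sup>+s. ennreal (\<phi> (s\<^sup>2)) \<partial>std_normal)"
proof -
  define p where "p b = ip M (X b) (X b)" for b
  define r where "r b = (\<lambda>a. X b a / sqrt (p b))" for b
  have p: "0 \<le> p b" for b by (simp add: p_def)
  have sum_p: "(\<Sum>b<M. p b) = 1" using X by (simp add: frob2_def p_def ip_self)
  have r_ip: "ip M (r b) x = ip M (X b) x / sqrt (p b)" for b x
    by (simp add: r_def ip_def sum_divide_distrib)
  have r_norm: "ip M (r b) (r b) \<le> 1" for b
  proof -
    have "ip M (r b) (r b) = p b / (sqrt (p b))\<^sup>2"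
      by (simp add: r_def ip_self p_def power_divide sum_divide_distrib)
    then show ?thesis using p[of b] by simp
  qed
  \<comment> \<open>A zero row has no direction: there \<open>r b\<close> is 0 through division by
    zero, and Cauchy-Schwarz makes the left side vanish as well.\<close>
  have sq: "(ip M (X b) x)\<^sup>2 = p b * (ip M (r b) x)\<^sup>2" for b x
  proof (cases "p b = 0")
    case True
    then have "(ip M (X b) x)\<^sup>2 \<le> 0" using ip_Cauchy_Schwarz[of M "X b" x] by (simp add: p_def)
    then show ?thesis using True by simp
  qed (use p[of b] in \<open>simp add: r_ip power_divide\<close>)
  have [measurable]: "(\<lambda>x. ip M (r b) x) \<in> borel_measurable (std_normal_vec M)" for b
    by measurable
  have "(\<integral>\<^sup>+x. ennreal (\<phi> (\<Sum>b<M. (ip M (X b) x)\<^sup>2)) \<partial>std_normal_vec M) \<le>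
      (\<integral>\<^sup>+x. (\<Sum>b<M. ennreal (p b) * ennreal (\<phi> ((ip M (r b) x)\<^sup>2))) \<partial>std_normal_vec M)"
  proof (rule nn_integral_mono)
    fix x
    have "\<phi> (\<Sum>b<M. (ip M (X b) x)\<^sup>2) \<le> (\<Sum>b<M. p b * \<phi> ((ip M (r b) x)\<^sup>2))"
      unfolding sq using convex_on_sum[OF _ _ conv, of "{..<M}" p "\<lambda>b. (ip M (r b) x)\<^sup>2"] sum_p p
      by (cases "M = 0") auto
    then have "ennreal (\<phi> (\<Sum>b<M. (ip M (X b) x)\<^sup>2)) \<le> ennreal (\<Sum>b<M. p b * \<phi> ((ip M (r b) x)\<^sup>2))"
      by (rule ennreal_leI)
    also have "\<dots> = (\<Sum>b<M. ennreal (p b) * ennreal (\<phi> ((ip M (r b) x)\<^sup>2)))"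
      using p nonneg by (simp add: sum_ennreal[symmetric] ennreal_mult)
    finally show "ennreal (\<phi> (\<Sum>b<M. (ip M (X b) x)\<^sup>2)) \<le> (\<Sum>b<M. ennreal (p b) * ennreal (\<phi> ((ip M (r b) x)\<^sup>2)))" .
  qed
  also have "\<dots> = (\<Sum>b<M. ennreal (p b) * (\<integral>\<^sup>+x. ennreal (\<phi> ((ip M (r b) x)\<^sup>2)) \<partial>std_normal_vec M))"
    by (subst nn_integral_sum) (auto intro!: sum.cong nn_integral_cmult)
  also have "\<dots> \<le> (\<Sum>b<M. ennreal (p b) * (\<integral>\<^sup>+s. ennreal (\<phi> (s\<^sup>2)) \<partial>std_normal))"
  proof (intro sum_mono mult_left_mono)
    fix b
    have "(\<integral>\<^sup>+x. ennreal (\<phi> ((ip M (r b) x)\<^sup>2)) \<partial>std_normal_vec M) =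
        (\<integral>\<^sup>+s. ennreal (\<phi> ((sqrt (ip M (r b) (r b)) * s)\<^sup>2)) \<partial>std_normal)"
      by (rule nn_integral_ip[of "\<lambda>t. ennreal (\<phi> (t\<^sup>2))"]) measurable
    also have "\<dots> \<le> (\<integral>\<^sup>+s. ennreal (\<phi> (s\<^sup>2)) \<partial>std_normal)"
      using r_norm[of b]
      by (intro nn_integral_mono ennreal_leI mono) (auto simp: power_mult_distrib intro: mult_left_le_one_le)
    finally show "(\<integral>\<^sup>+x. ennreal (\<phi> ((ip M (r b) x)\<^sup>2)) \<partial>std_normal_vec M) \<le> (\<integral>\<^sup>+s. ennreal (\<phi> (s\<^sup>2)) \<partial>std_normal)" .
  qed simp
  also have "\<dots> = (\<integral>\<^sup>+s. ennreal (\<phi> (s\<^sup>2)) \<partial>std_normal)"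
    using sum_p p by (simp add: sum_distrib_right[symmetric] sum_ennreal)
  finally show ?thesis .
qed

text \<open>Given \<open>x\<close>, the form is normal, and bounding exp |t| by exp t + exp (- t)
  yields \<open>2 * exp (?N x / 8)\<close>. Jensen's inequality then replaces \<open>?N x\<close> by
  the square of one normal variable. The rate 1/4 leads to the finite constant 4 / sqrt 3, which is
  below exp 1.\<close>

lemma nn_integral_exp_abs_bform_le:
  assumes X: "frob2 M X = 1" and sym: "\<And>a b. a < M \<Longrightarrow> b < M \<Longrightarrow> X a b = X b a"
  shows "(\<integral>\<^sup>+x. \<integral>\<^sup>+y. ennreal (exp (\<bar>bform M X x x - bform M X y y\<bar> / 4)) \<partial>std_normal_vec M \<partial>std_normal_vec M) \<le> ennreal (exp 1)"
proof -
  let ?N = "\<lambda>x. \<Sum>b<M. (ip M (X b) x)\<^sup>2"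
  have N: "0 \<le> ?N x" for x by (intro sum_nonneg) auto
  have "(\<integral>\<^sup>+x. \<integral>\<^sup>+y. ennreal (exp (\<bar>bform M X x x - bform M X y y\<bar> / 4)) \<partial>std_normal_vec M \<partial>std_normal_vec M) =
    (\<integral>\<^sup>+x. \<integral>\<^sup>+s. ennreal (exp (\<bar>sqrt (?N x) * s\<bar> / 2)) \<partial>std_normal \<partial>std_normal_vec M)"
    using nn_integral_bform[of "\<lambda>t. ennreal (exp (\<bar>t\<bar> / 2))", OF _ sym] by (simp add: abs_minus_commute)
  also have "\<dots> \<le> (\<integral>\<^sup>+x. 2 * ennreal (exp (?N x / 8)) \<partial>std_normal_vec M)"
  proof (rule nn_integral_mono)
    fix x
    let ?w = "sqrt (?N x) / 2"
    have "(\<integral>\<^sup>+s. ennreal (exp (\<bar>sqrt (?N x) * s\<bar> / 2)) \<partial>std_normal) \<le>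
        (\<integral>\<^sup>+s. ennreal (exp (?w * s)) + ennreal (exp (- ?w * s)) \<partial>std_normal)"
    proof (rule nn_integral_mono)
      fix s
      have "exp (\<bar>t\<bar>) \<le> exp t + exp (- t)" for t :: real by (cases "t \<ge> 0") auto
      from this[of "sqrt (?N x) * s / 2"]
      show "ennreal (exp (\<bar>sqrt (?N x) * s\<bar> / 2)) \<le> ennreal (exp (?w * s)) + ennreal (exp (- ?w * s))"
        by (simp flip: ennreal_plus)
    qed
    also have "\<dots> = 2 * ennreal (exp (?w\<^sup>2 / 2))"
    proof -
      have "(\<integral>\<^sup>+s. ennreal (exp (- ?w * s)) \<partial>std_normal) = ennreal (exp (?w\<^sup>2 / 2))"
        using nn_integral_std_normal_exp[of "- ?w"] by (simp only: power2_minus)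
      then show ?thesis
        by (subst nn_integral_add) (simp_all only: nn_integral_std_normal_exp[of ?w] mult_2, measurable)
    qed
    finally show "(\<integral>\<^sup>+s. ennreal (exp (\<bar>sqrt (?N x) * s\<bar> / 2)) \<partial>std_normal) \<le> 2 * ennreal (exp (?N x / 8))"
      using N by (simp add: power_divide)
  qed
  also have "\<dots> = 2 * (\<integral>\<^sup>+x. ennreal (exp (?N x / 8)) \<partial>std_normal_vec M)"
    by (rule nn_integral_cmult) measurable
  also have "\<dots> \<le> 2 * (\<integral>\<^sup>+s. ennreal (exp (s\<^sup>2 / 8)) \<partial>std_normal)"
  proof (intro mult_left_mono nn_integral_convex_square_norm_le[of "\<lambda>t. exp (t / 8)"] X)
    show "convex_on UNIV (\<lambda>t::real. exp (t / 8))"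
      by (rule convex_on_realI[where f' = "\<lambda>t. exp (t / 8) / 8"]) (auto intro!: derivative_eq_intros)
  qed auto
  also have "\<dots> = ennreal (4 / sqrt 3)"
    by (simp add: nn_integral_std_normal_exp_square) (simp flip: ennreal_numeral ennreal_mult)
  also have "\<dots> \<le> ennreal (exp 1)"
  proof (rule ennreal_leI)
    have "(4 / sqrt 3)\<^sup>2 \<le> (5/2 :: real)\<^sup>2" by (simp add: power2_eq_square)
    then have "4 / sqrt 3 \<le> (5/2 :: real)" by (rule power2_le_imp_le) simp
    also have "\<dots> \<le> exp 1" using exp_lower_Taylor_quadratic[of "1::real"] by simp
    finally show "4 / sqrt 3 \<le> exp (1::real)" .
  qed
  finally show ?thesis .
qed

text \<open>A polynomial bound that involves only the second and fourth moment: if these are 1 and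
  at most 9, the mean of the exponential is at most 1 - 1/9 + 9/162 = 17/18. The quadratic term is
  on the left to avoid subtraction of extended reals. The proof combines the quadratic bound for exp
  (- y) with (x - 3)^2 (x + 6) x \<ge> 0.\<close>

lemma exp_minus_abs_le: "exp (- \<bar>t\<bar> / 3) + t\<^sup>2 / 9 \<le> 1 + t ^ 4 / 162" for t :: real
proof -
  define x where "x = \<bar>t\<bar>"
  have x: "x \<ge> 0" "t\<^sup>2 = x\<^sup>2" "t ^ 4 = x ^ 4" by (auto simp: x_def power_even_abs)
  have "exp (- x / 3) \<le> 1 - x / 3 + x\<^sup>2 / 18"
  proof -
    let ?y = "x / 3"
    \<comment> \<open>The product equals \<open>1 + ?y ^ 4 / 4\<close>.\<close>
    have "1 \<le> (1 - ?y + ?y\<^sup>2 / 2) * (1 + ?y + ?y\<^sup>2 / 2)"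
      using x by (simp add: power2_eq_square field_simps)
    also have "\<dots> \<le> (1 - ?y + ?y\<^sup>2 / 2) * exp ?y"
    proof (rule mult_left_mono)
      show "1 + ?y + ?y\<^sup>2 / 2 \<le> exp ?y" using exp_lower_Taylor_quadratic[of ?y] x by simp
      show "0 \<le> 1 - ?y + ?y\<^sup>2 / 2" using zero_le_power2[of "?y - 1"] by (simp add: power2_eq_square algebra_simps)
    qed
    finally have "1 / exp ?y \<le> 1 - ?y + ?y\<^sup>2 / 2" by (simp add: pos_divide_le_eq)
    then show ?thesis by (simp add: exp_minus inverse_eq_divide power_divide)
  qed
  moreover have "x\<^sup>2 / 2 - x ^ 4 / 54 \<le> x"
  proof -
    have "0 \<le> (x - 3)\<^sup>2 * (x + 6) * x" using x by simp
    then show ?thesis by (simp add: power2_eq_square power4_eq_xxxx algebra_simps)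
  qed
  ultimately show ?thesis using x by (simp add: x_def[symmetric])
qed

text \<open>The fourth-moment method: the form has second moment \<open>frob2 M X = 1\<close> and
  fourth moment at most 3 * 3 = 9, one factor from the conditional normal variable and one from
  Jensen's inequality for the length of X x. So it cannot concentrate near 0, whatever the rank of
  \<open>X\<close>.\<close>

lemma nn_integral_exp_minus_abs_bform_le:
  assumes X: "frob2 M X = 1" and sym: "\<And>a b. a < M \<Longrightarrow> b < M \<Longrightarrow> X a b = X b a"
  shows "(\<integral>\<^sup>+x. \<integral>\<^sup>+y. ennreal (exp (- \<bar>bform M X x x - bform M X y y\<bar> / 6)) \<partial>std_normal_vec M \<partial>std_normal_vec M)
    \<le> ennreal (exp (- 1 / 18))" (is "?E \<le> _")
proof -
  interpret V: prob_space "std_normal_vec M" by (rule prob_space_std_normal_vec)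
  let ?N = "\<lambda>x. \<Sum>b<M. (ip M (X b) x)\<^sup>2"
  have N: "0 \<le> ?N x" for x by (intro sum_nonneg) auto
  have E: "?E = (\<integral>\<^sup>+x. \<integral>\<^sup>+s. ennreal (exp (- \<bar>sqrt (?N x) * s\<bar> / 3)) \<partial>std_normal \<partial>std_normal_vec M)"
    using nn_integral_bform[of "\<lambda>t. ennreal (exp (- \<bar>t\<bar> / 3))", OF _ sym] by (simp add: abs_minus_commute)
  have m2: "(\<integral>\<^sup>+s. ennreal ((sqrt (?N x) * s)\<^sup>2) \<partial>std_normal) = ennreal (?N x)" for x
  proof -
    have "(\<integral>\<^sup>+s. ennreal ((sqrt (?N x) * s)\<^sup>2) \<partial>std_normal) = (\<integral>\<^sup>+s. ennreal (?N x) * ennreal (s\<^sup>2) \<partial>std_normal)"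
      using N by (simp add: power_mult_distrib ennreal_mult)
    then show ?thesis
      using nn_integral_std_normal_even_moment[of 1] by (simp add: nn_integral_cmult fact_numeral)
  qed
  have m4: "(\<integral>\<^sup>+s. ennreal ((sqrt (?N x) * s) ^ 4) \<partial>std_normal) = 3 * ennreal ((?N x)\<^sup>2)" for x
  proof -
    have "(sqrt (?N x)) ^ 4 = (?N x)\<^sup>2"
      using N[of x] by (metis mult_2 numeral_Bit0 power_even_eq power_mult real_sqrt_pow2 mult.commute)
    then have "(\<integral>\<^sup>+s. ennreal ((sqrt (?N x) * s) ^ 4) \<partial>std_normal) = (\<integral>\<^sup>+s. ennreal ((?N x)\<^sup>2) * ennreal (s ^ 4) \<partial>std_normal)"
      by (simp add: power_mult_distrib ennreal_mult)
    also have "\<dots> = ennreal ((?N x)\<^sup>2) * (\<integral>\<^sup>+s. ennreal (s ^ 4) \<partial>std_normal)"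
      by (rule nn_integral_cmult) measurable
    also have "(\<integral>\<^sup>+s. ennreal (s ^ 4) \<partial>std_normal) = 3"
      using nn_integral_std_normal_even_moment[of 2] by (simp add: fact_numeral)
    finally show ?thesis by (simp only: mult.commute)
  qed
  have M2: "(\<integral>\<^sup>+x. ennreal (?N x) \<partial>std_normal_vec M) = 1"
  proof -
    have "(\<integral>\<^sup>+x. ennreal (?N x) \<partial>std_normal_vec M) = (\<Sum>b<M. \<integral>\<^sup>+x. ennreal ((ip M (X b) x)\<^sup>2) \<partial>std_normal_vec M)"
      by (subst nn_integral_sum[symmetric]) (auto simp: sum_ennreal)
    also have "\<dots> = (\<Sum>b<M. ennreal (ip M (X b) (X b)))"
    proof (rule sum.cong[OF refl])
      fix b
      have "(\<integral>\<^sup>+x. ennreal ((ip M (X b) x)\<^sup>2) \<partial>std_normal_vec M) =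
          (\<integral>\<^sup>+s. ennreal ((sqrt (ip M (X b) (X b)) * s)\<^sup>2) \<partial>std_normal)"
        by (rule nn_integral_ip[of "\<lambda>t. ennreal (t\<^sup>2)"]) measurable
      also have "\<dots> = (\<integral>\<^sup>+s. ennreal (ip M (X b) (X b)) * ennreal (s\<^sup>2) \<partial>std_normal)"
        by (simp add: power_mult_distrib ennreal_mult)
      finally show "(\<integral>\<^sup>+x. ennreal ((ip M (X b) x)\<^sup>2) \<partial>std_normal_vec M) = ennreal (ip M (X b) (X b))"
        using nn_integral_std_normal_even_moment[of 1] by (simp add: nn_integral_cmult fact_numeral)
    qed
    also have "\<dots> = ennreal (\<Sum>b<M. ip M (X b) (X b))" by (simp add: sum_ennreal)
    also have "\<dots> = 1" using X by (simp add: frob2_def ip_self)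
    finally show ?thesis .
  qed
  have M4: "(\<integral>\<^sup>+x. ennreal ((?N x)\<^sup>2) \<partial>std_normal_vec M) \<le> 3"
  proof -
    have "(\<integral>\<^sup>+x. ennreal ((?N x)\<^sup>2) \<partial>std_normal_vec M) \<le> (\<integral>\<^sup>+s. ennreal ((s\<^sup>2)\<^sup>2) \<partial>std_normal)"
    proof (rule nn_integral_convex_square_norm_le[of "\<lambda>t. t\<^sup>2"])
      show "convex_on UNIV (\<lambda>t::real. t\<^sup>2)"
        by (rule convex_on_realI[where f' = "\<lambda>t. 2 * t"]) (auto intro!: derivative_eq_intros)
    qed (auto intro: power_mono X)
    then show ?thesis using nn_integral_std_normal_even_moment[of 2] by (simp add: fact_numeral)
  qed
  let ?e = "\<lambda>x. \<integral>\<^sup>+s. ennreal (exp (- \<bar>sqrt (?N x) * s\<bar> / 3)) \<partial>std_normal"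
  \<comment> \<open>The mean of the quadratic term is carried along on both sides and cancelled only
    at the end, once \<open>?E\<close> is known to be finite: 19/18 - 1/9 = 17/18.\<close>
  have "?E + ennreal (1 / 9) = (\<integral>\<^sup>+x. ?e x + ennreal (1 / 9) * ennreal (?N x) \<partial>std_normal_vec M)"
    unfolding E by (subst nn_integral_add) (simp_all add: nn_integral_cmult M2)
  also have "\<dots> = (\<integral>\<^sup>+x. \<integral>\<^sup>+s. ennreal (exp (- \<bar>sqrt (?N x) * s\<bar> / 3)) + ennreal (1 / 9) * ennreal ((sqrt (?N x) * s)\<^sup>2) \<partial>std_normal \<partial>std_normal_vec M)"
  proof (rule nn_integral_cong)
    fix x
    have "(\<integral>\<^sup>+s. ennreal (exp (- \<bar>sqrt (?N x) * s\<bar> / 3)) + ennreal (1 / 9) * ennreal ((sqrt (?N x) * s)\<^sup>2) \<partial>std_normal) =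
        ?e x + (\<integral>\<^sup>+s. ennreal (1 / 9) * ennreal ((sqrt (?N x) * s)\<^sup>2) \<partial>std_normal)"
      by (rule nn_integral_add) measurable
    also have "(\<integral>\<^sup>+s. ennreal (1 / 9) * ennreal ((sqrt (?N x) * s)\<^sup>2) \<partial>std_normal) =
        ennreal (1 / 9) * (\<integral>\<^sup>+s. ennreal ((sqrt (?N x) * s)\<^sup>2) \<partial>std_normal)"
      by (rule nn_integral_cmult) measurable
    finally show "?e x + ennreal (1 / 9) * ennreal (?N x) = (\<integral>\<^sup>+s. ennreal (exp (- \<bar>sqrt (?N x) * s\<bar> / 3)) + ennreal (1 / 9) * ennreal ((sqrt (?N x) * s)\<^sup>2) \<partial>std_normal)"
      by (simp only: m2)
  qed
  also have "\<dots> \<le> (\<integral>\<^sup>+x. \<integral>\<^sup>+s. 1 + ennreal (1 / 162) * ennreal ((sqrt (?N x) * s) ^ 4) \<partial>std_normal \<partial>std_normal_vec M)"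
  proof (intro nn_integral_mono)
    fix x s
    have "ennreal (exp (- \<bar>sqrt (?N x) * s\<bar> / 3) + (sqrt (?N x) * s)\<^sup>2 / 9) \<le> ennreal (1 + (sqrt (?N x) * s) ^ 4 / 162)"
      by (intro ennreal_leI exp_minus_abs_le)
    then show "ennreal (exp (- \<bar>sqrt (?N x) * s\<bar> / 3)) + ennreal (1 / 9) * ennreal ((sqrt (?N x) * s)\<^sup>2)
        \<le> 1 + ennreal (1 / 162) * ennreal ((sqrt (?N x) * s) ^ 4)"
      by (simp add: ennreal_mult[symmetric] ennreal_plus[symmetric] ennreal_1[symmetric] del: ennreal_plus ennreal_1)
  qed
  also have "\<dots> = (\<integral>\<^sup>+x. 1 + ennreal (1 / 162) * (3 * ennreal ((?N x)\<^sup>2)) \<partial>std_normal_vec M)"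
  proof (rule nn_integral_cong)
    fix x
    have "(\<integral>\<^sup>+s. 1 + ennreal (1 / 162) * ennreal ((sqrt (?N x) * s) ^ 4) \<partial>std_normal) =
        (\<integral>\<^sup>+s. 1 \<partial>std_normal) + (\<integral>\<^sup>+s. ennreal (1 / 162) * ennreal ((sqrt (?N x) * s) ^ 4) \<partial>std_normal)"
      by (rule nn_integral_add) measurable
    also have "(\<integral>\<^sup>+s. 1 \<partial>std_normal) = 1" using std_normal.emeasure_space_1 by simp
    also have "(\<integral>\<^sup>+s. ennreal (1 / 162) * ennreal ((sqrt (?N x) * s) ^ 4) \<partial>std_normal) =
        ennreal (1 / 162) * (\<integral>\<^sup>+s. ennreal ((sqrt (?N x) * s) ^ 4) \<partial>std_normal)"
      by (rule nn_integral_cmult) measurable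
    finally show "(\<integral>\<^sup>+s. 1 + ennreal (1 / 162) * ennreal ((sqrt (?N x) * s) ^ 4) \<partial>std_normal) = 1 + ennreal (1 / 162) * (3 * ennreal ((?N x)\<^sup>2))"
      by (simp only: m4)
  qed
  also have "\<dots> = (\<integral>\<^sup>+x. 1 \<partial>std_normal_vec M) + (\<integral>\<^sup>+x. ennreal (1 / 162) * (3 * ennreal ((?N x)\<^sup>2)) \<partial>std_normal_vec M)"
    by (rule nn_integral_add) measurable
  also have "(\<integral>\<^sup>+x. 1 \<partial>std_normal_vec M) = 1" using V.emeasure_space_1 by simp
  also have "(\<integral>\<^sup>+x. ennreal (1 / 162) * (3 * ennreal ((?N x)\<^sup>2)) \<partial>std_normal_vec M) =
      ennreal (1 / 162) * (\<integral>\<^sup>+x. 3 * ennreal ((?N x)\<^sup>2) \<partial>std_normal_vec M)"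
    by (rule nn_integral_cmult) measurable
  also have "(\<integral>\<^sup>+x. 3 * ennreal ((?N x)\<^sup>2) \<partial>std_normal_vec M) = 3 * (\<integral>\<^sup>+x. ennreal ((?N x)\<^sup>2) \<partial>std_normal_vec M)"
    by (rule nn_integral_cmult) measurable
  also have "1 + ennreal (1 / 162) * (3 * (\<integral>\<^sup>+x. ennreal ((?N x)\<^sup>2) \<partial>std_normal_vec M)) \<le> 1 + ennreal (1 / 162) * (3 * 3)"
    by (intro add_left_mono mult_left_mono M4) auto
  also have "\<dots> = ennreal (19 / 18)"
    by (simp add: ennreal_mult[symmetric] ennreal_plus[symmetric] ennreal_1[symmetric] ennreal_numeral[symmetric] del: ennreal_plus ennreal_1 ennreal_numeral)
  finally have le: "?E + ennreal (1 / 9) \<le> ennreal (19 / 18)" .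
  have "?E \<le> ennreal (19 / 18)" by (rule order_trans[OF _ le]) simp
  then have "?E < \<infinity>" by (rule le_less_trans) simp
  then obtain e where e: "?E = ennreal e" "0 \<le> e" by (auto simp: less_top_ennreal infinity_ennreal_def)
  then have "e \<le> 17 / 18" using le by (simp add: ennreal_plus[symmetric] del: ennreal_plus)
  then have "?E \<le> ennreal (17 / 18)" using e by (simp add: ennreal_leI)
  also have "\<dots> \<le> ennreal (exp (- 1 / 18))"
    using exp_ge_add_one_self[of "- 1 / 18 :: real"] by (intro ennreal_leI) simp
  finally show ?thesis .
qed


text \<open>The pairs of coordinates 2 l and 2 l + 1 are disjoint, hence independent. The induction
  integrates out the last two coordinates; those from 2 n on do not occur in the integrand and
  integrate to 1.\<close>

lemma nn_integral_prod_pairs: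
  fixes h :: "'a \<Rightarrow> 'a \<Rightarrow> ennreal"
  assumes V: "prob_space V" and [measurable]: "case_prod h \<in> borel_measurable (V \<Otimes>\<^sub>M V)" and "2 * n \<le> L"
  shows "(\<integral>\<^sup>+w. (\<Prod>l<n. h (w (2 * l)) (w (2 * l + 1))) \<partial>PiM {..<L} (\<lambda>_. V)) =
    (\<integral>\<^sup>+x. \<integral>\<^sup>+y. h x y \<partial>V \<partial>V) ^ n"
proof -
  interpret V: prob_space V by (rule V)
  interpret product_prob_space "\<lambda>_::nat. V" UNIV by standard
  let ?P = "\<lambda>L. PiM {..<L} (\<lambda>_. V)"
  have ins: "{..<Suc L} = insert L {..<L}" for L by auto
  have meas: "(\<lambda>w. \<Prod>l<n. h (w (2 * l)) (w (2 * l + 1))) \<in> borel_measurable (?P L)" if "2 * n \<le> L" for n L :: nat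
  proof (intro borel_measurable_prod_ennreal)
    fix l assume "l \<in> {..<n}"
    then have l: "2 * l \<in> {..<L}" "2 * l + 1 \<in> {..<L}" using that by auto
    have [measurable]: "(\<lambda>w. w (2 * l)) \<in> measurable (?P L) V" "(\<lambda>w. w (2 * l + 1)) \<in> measurable (?P L) V"
      using l by (intro measurable_component_singleton; simp)+
    show "(\<lambda>w. h (w (2 * l)) (w (2 * l + 1))) \<in> borel_measurable (?P L)" by measurable
  qed
  have even: "(\<integral>\<^sup>+w. (\<Prod>l<n. h (w (2 * l)) (w (2 * l + 1))) \<partial>(?P (2 * n))) = (\<integral>\<^sup>+x. \<integral>\<^sup>+y. h x y \<partial>V \<partial>V) ^ n" for n
  proof (induction n)
    case 0
    then show ?case by (simp add: PiM_empty nn_integral_count_space_finite)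
  next
    case (Suc n)
    define m where "m = 2 * n"
    let ?g = "\<lambda>w. \<Prod>l<n. h (w (2 * l)) (w (2 * l + 1))"
    let ?f = "\<lambda>w. \<Prod>l<Suc n. h (w (2 * l)) (w (2 * l + 1))"
    have f: "?f \<in> borel_measurable (?P (Suc (Suc m)))" by (rule meas) (simp add: m_def)
    have upd: "?f (w(m := x, Suc m := y)) = ?g w * h x y" for w x y
      by (auto simp: m_def intro!: arg_cong2[where f = times] prod.cong)
    have dim: "(\<lambda>(w, y). w(Suc m := y)) \<in> measurable (?P (Suc m) \<Otimes>\<^sub>M V) (?P (Suc (Suc m)))"
      unfolding ins[of "Suc m"] by (rule measurable_add_dim)
    have "(\<integral>\<^sup>+w. ?f w \<partial>(?P (Suc (Suc m)))) = (\<integral>\<^sup>+w. \<integral>\<^sup>+y. ?f (w(Suc m := y)) \<partial>V \<partial>(?P (Suc m)))"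
      using f unfolding ins[of "Suc m"] by (intro product_nn_integral_insert) auto
    also have "\<dots> = (\<integral>\<^sup>+w. \<integral>\<^sup>+x. \<integral>\<^sup>+y. ?f (w(m := x, Suc m := y)) \<partial>V \<partial>V \<partial>(?P m))"
    proof -
      have "(\<lambda>w. \<integral>\<^sup>+y. ?f (w(Suc m := y)) \<partial>V) \<in> borel_measurable (?P (Suc m))"
        using measurable_compose[OF dim f]
        by (intro V.borel_measurable_nn_integral) (simp only: split_def)
      then show ?thesis unfolding ins[of m] by (intro product_nn_integral_insert) auto
    qed
    also have "\<dots> = (\<integral>\<^sup>+w. ?g w * (\<integral>\<^sup>+x. \<integral>\<^sup>+y. h x y \<partial>V \<partial>V) \<partial>(?P m))"
      unfolding upd
    proof (rule nn_integral_cong)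
      fix w
      have "(\<integral>\<^sup>+x. \<integral>\<^sup>+y. ?g w * h x y \<partial>V \<partial>V) = (\<integral>\<^sup>+x. ?g w * (\<integral>\<^sup>+y. h x y \<partial>V) \<partial>V)"
        by (intro nn_integral_cong nn_integral_cmult) measurable
      also have "\<dots> = ?g w * (\<integral>\<^sup>+x. \<integral>\<^sup>+y. h x y \<partial>V \<partial>V)" by (rule nn_integral_cmult) measurable
      finally show "(\<integral>\<^sup>+x. \<integral>\<^sup>+y. ?g w * h x y \<partial>V \<partial>V) = ?g w * (\<integral>\<^sup>+x. \<integral>\<^sup>+y. h x y \<partial>V \<partial>V)" .
    qed
    also have "\<dots> = (\<integral>\<^sup>+w. ?g w \<partial>(?P m)) * (\<integral>\<^sup>+x. \<integral>\<^sup>+y. h x y \<partial>V \<partial>V)"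
      by (rule nn_integral_multc) (rule meas, simp add: m_def)
    finally have "(\<integral>\<^sup>+w. ?f w \<partial>(?P (2 * Suc n))) = (\<integral>\<^sup>+w. ?g w \<partial>(?P (2 * n))) * (\<integral>\<^sup>+x. \<integral>\<^sup>+y. h x y \<partial>V \<partial>V)"
      by (simp add: m_def)
    then show ?case by (simp only: Suc.IH power_Suc2)
  qed
  show ?thesis
    using \<open>2 * n \<le> L\<close>
  proof (induction L rule: dec_induct)
    case base
    then show ?case by (rule even)
  next
    case (step L)
    let ?g = "\<lambda>w. \<Prod>l<n. h (w (2 * l)) (w (2 * l + 1))"
    have "(\<integral>\<^sup>+w. ?g w \<partial>(?P (Suc L))) = (\<integral>\<^sup>+w. \<integral>\<^sup>+y. ?g (w(L := y)) \<partial>V \<partial>(?P L))"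
      unfolding ins using meas[of n "Suc L"] step(1) by (intro product_nn_integral_insert) (auto simp: ins)
    also have "\<dots> = (\<integral>\<^sup>+w. \<integral>\<^sup>+y. ?g w \<partial>V \<partial>(?P L))"
      using step(1) by (intro nn_integral_cong prod.cong) auto
    also have "\<dots> = (\<integral>\<^sup>+w. ?g w \<partial>(?P L))" by (simp add: V.emeasure_space_1)
    finally show ?case using step by simp
  qed
qed

text \<open>Taking differences removes the mean \<open>trace X\<close> of the individual measurements, for which no bound by
  the Frobenius norm with a constant independent of the rank exists.\<close>

definition sens :: "nat \<Rightarrow> nat \<Rightarrow> (nat \<Rightarrow> nat \<Rightarrow> real) \<Rightarrow> (nat \<Rightarrow> nat \<Rightarrow> real) \<Rightarrow> real" where
  "sens n M X \<omega> = (\<Sum>l<n. \<bar>bform M X (\<omega> (2 * l)) (\<omega> (2 * l)) - bform M X (\<omega> (2 * l + 1)) (\<omega> (2 * l + 1))\<bar> / 2)"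

section \<open>Tail bounds for a fixed matrix\<close>

lemma gaussian_vectors_alt: "gaussian_vectors L M = PiM {..<L} (\<lambda>_. std_normal_vec M)"
  by (simp add: gaussian_vectors_def)

lemma prob_space_gaussian_vectors: "prob_space (gaussian_vectors L M)"
  unfolding gaussian_vectors_alt by (intro prob_space_PiM prob_space_std_normal_vec)

lemma sens_measurable [measurable]:
  assumes "2 * n \<le> L"
  shows "sens n M X \<in> borel_measurable (gaussian_vectors L M)"
proof -
  have c: "(\<lambda>\<omega>. \<omega> l a) \<in> borel_measurable (gaussian_vectors L M)" if "l < L" "a < M" for l a
  proof -
    have "(\<lambda>\<omega>. \<omega> l) \<in> measurable (gaussian_vectors L M) (std_normal_vec M)"
      unfolding gaussian_vectors_alt using that by (intro measurable_component_singleton) auto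
    from measurable_compose[OF this component_measurable_borel[of a]] that show ?thesis by simp
  qed
  show ?thesis unfolding sens_def
    by (intro borel_measurable_sum borel_measurable_divide borel_measurable_abs borel_measurable_diff
        bform_measurable c borel_measurable_const) (use assms in auto)
qed

lemma nn_integral_exp_sens:
  assumes "2 * n \<le> L"
  shows "(\<integral>\<^sup>+\<omega>. ennreal (exp (t * sens n M X \<omega>)) \<partial>gaussian_vectors L M) =
    (\<integral>\<^sup>+x. \<integral>\<^sup>+y. ennreal (exp (t * (\<bar>bform M X x x - bform M X y y\<bar> / 2))) \<partial>std_normal_vec M \<partial>std_normal_vec M) ^ n"
proof -
  have "(\<integral>\<^sup>+\<omega>. ennreal (exp (t * sens n M X \<omega>)) \<partial>gaussian_vectors L M) =
     (\<integral>\<^sup>+\<omega>. (\<Prod>l<n. ennreal (exp (t * (\<bar>bform M X (\<omega> (2 * l)) (\<omega> (2 * l)) - bform M X (\<omega> (2 * l + 1)) (\<omega> (2 * l + 1))\<bar> / 2))))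
       \<partial>gaussian_vectors L M)"
    by (simp only: sens_def sum_distrib_left exp_sum[OF finite_lessThan] prod_ennreal exp_ge_zero)
  then show ?thesis
    unfolding gaussian_vectors_alt
    using nn_integral_prod_pairs[OF prob_space_std_normal_vec _ assms,
      of "\<lambda>x y. ennreal (exp (t * (\<bar>bform M X x x - bform M X y y\<bar> / 2)))" "{..<M}"] by simp
qed

text \<open>The rate \<open>t\<close> may have either sign, so that one bound serves the upper and
  the lower tail.\<close>

lemma sens_Chernoff:
  assumes n: "2 * n \<le> L"
    and b: "(\<integral>\<^sup>+x. \<integral>\<^sup>+y. ennreal (exp (t * (\<bar>bform M X x x - bform M X y y\<bar> / 2)))
      \<partial>std_normal_vec M \<partial>std_normal_vec M) \<le> ennreal (exp b)"
  shows "measure (gaussian_vectors L M) {\<omega> \<in> space (gaussian_vectors L M). c \<le> t * sens n M X \<omega>} \<le> exp (real n * b - c)"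
proof -
  let ?G = "gaussian_vectors L M"
  interpret G: prob_space ?G by (rule prob_space_gaussian_vectors)
  note [measurable] = sens_measurable[OF n]
  have "emeasure ?G {\<omega> \<in> space ?G. c \<le> t * sens n M X \<omega>} =
    emeasure ?G ({\<omega> \<in> space ?G. 1 \<le> ennreal (exp (- c)) * ennreal (exp (t * sens n M X \<omega>))})"
    by (intro arg_cong[where f = "emeasure ?G"] Collect_cong conj_cong refl)
      (simp add: ennreal_mult[symmetric] exp_add[symmetric] ennreal_1[symmetric] del: ennreal_1)
  also have "\<dots> \<le> ennreal (exp (- c)) * (\<integral>\<^sup>+\<omega>. ennreal (exp (t * sens n M X \<omega>)) * indicator (space ?G) \<omega> \<partial>?G)"
    by (rule nn_integral_Markov_inequality) measurable
  also have "(\<integral>\<^sup>+\<omega>. ennreal (exp (t * sens n M X \<omega>)) * indicator (space ?G) \<omega> \<partial>?G) =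
      (\<integral>\<^sup>+\<omega>. ennreal (exp (t * sens n M X \<omega>)) \<partial>?G)"
    by (rule nn_integral_cong) simp
  also have "\<dots> \<le> ennreal (exp b) ^ n"
    unfolding nn_integral_exp_sens[OF n] by (rule power_mono[OF b]) simp
  also have "ennreal (exp (- c)) * ennreal (exp b) ^ n = ennreal (exp (real n * b - c))"
    by (simp add: ennreal_power ennreal_mult[symmetric] exp_of_nat_mult[symmetric] mult_exp_exp)
  finally show ?thesis by (simp add: G.emeasure_eq_measure mult_left_mono)
qed

text \<open>The rates are 1/2 and - 1/3, matching the two exponential moments computed above. The
  exponents n - 2 n and - n / 18 + n / 36 leave - n and - n / 36.\<close>

lemma sens_tails:
  assumes n: "2 * n \<le> L" and X: "frob2 M X = 1" and sym: "\<And>a b. a < M \<Longrightarrow> b < M \<Longrightarrow> X a b = X b a"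
  shows "measure (gaussian_vectors L M) {\<omega> \<in> space (gaussian_vectors L M). 4 * real n \<le> sens n M X \<omega>} \<le> exp (- real n)"
    and "measure (gaussian_vectors L M) {\<omega> \<in> space (gaussian_vectors L M). sens n M X \<omega> \<le> real n / 12} \<le> exp (- real n / 36)"
proof -
  have e: "4 * real n \<le> s \<longleftrightarrow> 2 * real n \<le> 1/2 * s" "s \<le> real n / 12 \<longleftrightarrow> - real n / 36 \<le> - 1/3 * s" for s :: real
    by auto
  have "measure (gaussian_vectors L M) {\<omega> \<in> space (gaussian_vectors L M). 2 * real n \<le> 1/2 * sens n M X \<omega>} \<le> exp (real n * 1 - 2 * real n)"
    by (rule sens_Chernoff[OF n]) (use nn_integral_exp_abs_bform_le[OF X sym] in simp)
  then show "measure (gaussian_vectors L M) {\<omega> \<in> space (gaussian_vectors L M). 4 * real n \<le> sens n M X \<omega>} \<le> exp (- real n)"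
    unfolding e by simp
  have "measure (gaussian_vectors L M) {\<omega> \<in> space (gaussian_vectors L M). - real n / 36 \<le> - 1/3 * sens n M X \<omega>}
      \<le> exp (real n * (- 1 / 18) - (- real n / 36))"
    by (rule sens_Chernoff[OF n]) (use nn_integral_exp_minus_abs_bform_le[OF X sym] in simp)
  then show "measure (gaussian_vectors L M) {\<omega> \<in> space (gaussian_vectors L M). sens n M X \<omega> \<le> real n / 12} \<le> exp (- real n / 36)"
    unfolding e by simp
qed

section \<open>From a net to all matrices of low rank\<close>

lemma bform_add: "bform M (\<lambda>a b. X a b + Y a b) x y = bform M X x y + bform M Y x y"
  by (simp add: bform_def ip_def sum_distrib_left sum.distrib algebra_simps)

lemma bform_scale: "bform M (\<lambda>a b. c * X a b) x y = c * bform M X x y"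
  by (simp add: bform_def ip_def sum_distrib_left algebra_simps)

lemma bform_cong: "(\<And>a b. a < M \<Longrightarrow> b < M \<Longrightarrow> X a b = Y a b) \<Longrightarrow> bform M X x y = bform M Y x y"
  by (simp add: bform_def ip_def)

lemma sens_cong: "(\<And>a b. a < M \<Longrightarrow> b < M \<Longrightarrow> X a b = Y a b) \<Longrightarrow> sens n M X w = sens n M Y w"
  using bform_cong[of M X Y] by (simp add: sens_def)

lemma sens_nonneg: "0 \<le> sens n M X w"
  by (auto simp: sens_def intro: sum_nonneg)

lemma sens_scale: "sens n M (\<lambda>a b. c * X a b) w = \<bar>c\<bar> * sens n M X w"
  by (simp add: sens_def bform_scale sum_distrib_left abs_mult flip: right_diff_distrib)

lemma sens_triangle: "sens n M (\<lambda>a b. X a b + Y a b) w \<le> sens n M X w + sens n M Y w"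
proof -
  have aux: "\<bar>a + b - (c + d)\<bar> / 2 \<le> \<bar>a - c\<bar> / 2 + \<bar>b - d\<bar> / 2" for a b c d :: real
    using abs_triangle_ineq[of "a - c" "b - d"] by (simp add: algebra_simps add_divide_distrib[symmetric] divide_right_mono)
  show ?thesis unfolding sens_def bform_add sum.distrib[symmetric] by (intro sum_mono aux)
qed

lemma sens_triangle_lower: "sens n M X w - sens n M Y w \<le> sens n M (\<lambda>a b. X a b + Y a b) w"
proof -
  have "sens n M X w = sens n M (\<lambda>a b. (X a b + Y a b) + (-1) * Y a b) w" by (rule sens_cong) simp
  also have "\<dots> \<le> sens n M (\<lambda>a b. X a b + Y a b) w + sens n M (\<lambda>a b. (-1) * Y a b) w" by (rule sens_triangle)
  also have "sens n M (\<lambda>a b. (-1) * Y a b) w = sens n M Y w" by (subst sens_scale) simp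
  finally show ?thesis by simp
qed

lemma bform_bound: "\<bar>bform M X x x\<bar> \<le> sqrt (frob2 M X) * ip M x x"
proof -
  have "(bform M X x x)\<^sup>2 \<le> ip M x x * (\<Sum>a<M. (ip M (X a) x)\<^sup>2)"
    using ip_Cauchy_Schwarz[of M x "\<lambda>a. ip M (X a) x"] by (simp only: bform_def ip_self[of M "\<lambda>a. ip M (X a) x"])
  also have "\<dots> \<le> ip M x x * (\<Sum>a<M. ip M (X a) (X a) * ip M x x)"
    by (intro mult_left_mono sum_mono ip_Cauchy_Schwarz) auto
  also have "\<dots> = (sqrt (frob2 M X) * ip M x x)\<^sup>2"
    by (simp add: power_mult_distrib frob2_def ip_self power2_eq_square sum_distrib_right[symmetric] sum_nonneg)
  finally have "\<bar>bform M X x x\<bar> \<le> \<bar>sqrt (frob2 M X) * ip M x x\<bar>" by (simp only: abs_le_square_iff)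
  then show ?thesis by simp
qed

text \<open>Covers the matrices that cannot be normalised.\<close>

lemma sens_frob_zero:
  assumes "frob2 M X = 0"
  shows "sens n M X w = 0"
proof -
  have "bform M X x x = 0" for x using bform_bound[of M X x] assms by simp
  then show ?thesis by (simp add: sens_def)
qed

lemma low_rank_normalize:
  assumes "low_rank M r c X" "frob2 M X > 0"
  defines "s \<equiv> sqrt (frob2 M X)"
  shows "low_rank M r 1 (\<lambda>a b. (1 / s) * X a b)" "frob2 M (\<lambda>a b. (1 / s) * X a b) = 1"
proof -
  obtain \<mu> q where X: "\<And>a b. a < M \<Longrightarrow> b < M \<Longrightarrow> X a b = (\<Sum>i<r. \<mu> i * q i a * q i b)"
    using assms(1) unfolding low_rank_def by blast
  show 1: "frob2 M (\<lambda>a b. (1 / s) * X a b) = 1"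
    unfolding frob2_scale s_def using assms(2) by (simp add: power_divide)
  have "low_rank M r (sqrt (frob2 M (\<lambda>a b. (1 / s) * X a b))) (\<lambda>a b. (1 / s) * X a b)"
  proof (rule low_rank_factorization)
    show "1 / s * X a b = 1 / s * X b a" if "a < M" "b < M" for a b
      using low_rank_symmetric[OF assms(1) that] by simp
    show "1 / s * X a b = (\<Sum>k<r. (1 / s * (\<mu> k * q k a)) * q k b)" if "a < M" "b < M" for a b
      by (simp add: X that sum_distrib_left mult.assoc)
  qed
  then show "low_rank M r 1 (\<lambda>a b. (1 / s) * X a b)" using 1 by simp
qed

text \<open>Both bounds pass from the net to the whole class: the supremum \<open>s\<close> over the class satisfies
  \<open>s \<le> 4 n + 2 \<rho> s\<close> because the error splits into two matrices of the class, scaled by \<open>\<rho>\<close>.\<close>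

lemma sens_uniform:
  assumes net: "\<And>X. low_rank M r 1 X \<Longrightarrow> frob2 M X = 1 \<Longrightarrow> \<exists>Y\<in>\<N>. low_rank M (r + r) (1 / 384) (\<lambda>a b. X a b - Y a b)"
    and bounds: "\<And>Y. Y \<in> \<N> \<Longrightarrow> real n / 12 \<le> sens n M Y w \<and> sens n M Y w \<le> 4 * real n"
    and X: "low_rank M r c X"
  shows "sens n M X w \<le> 8 * real n * sqrt (frob2 M X)" "real n * sqrt (frob2 M X) / 24 \<le> sens n M X w"
proof -
  define A where "A = {X. low_rank M r 1 X \<and> frob2 M X = 1}"
  define s where "s = Sup ((\<lambda>X. sens n M X w) ` A)"
  \<comment> \<open>A crude bound that depends on \<open>w\<close>; it serves only to make the
    supremum \<open>s\<close> finite.\<close>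
  define b where "b = (\<Sum>l<n. (ip M (w (2 * l)) (w (2 * l)) + ip M (w (2 * l + 1)) (w (2 * l + 1))) / 2)"
  have bdd: "bdd_above ((\<lambda>X. sens n M X w) ` A)"
  proof (rule bdd_aboveI2[of _ _ b])
    fix X assume "X \<in> A"
    then have f: "frob2 M X = 1" by (simp add: A_def)
    show "sens n M X w \<le> b"
      unfolding sens_def b_def
    proof (intro sum_mono divide_right_mono)
      fix l
      show "\<bar>bform M X (w (2 * l)) (w (2 * l)) - bform M X (w (2 * l + 1)) (w (2 * l + 1))\<bar>
          \<le> ip M (w (2 * l)) (w (2 * l)) + ip M (w (2 * l + 1)) (w (2 * l + 1))"
        using bform_bound[of M X "w (2 * l)"] bform_bound[of M X "w (2 * l + 1)"] f by simp
    qed simp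
  qed
  have le_s: "sens n M X w \<le> s" if "X \<in> A" for X
    unfolding s_def using that bdd by (intro cSup_upper) auto
  have scaled: "sens n M X w \<le> s * sqrt (frob2 M X)" if "low_rank M r c X" for X c
  proof (cases "frob2 M X = 0")
    case False
    then have pos: "frob2 M X > 0" using frob2_nonneg[of M X] by linarith
    let ?t = "sqrt (frob2 M X)"
    have "sens n M (\<lambda>a b. (1 / ?t) * X a b) w \<le> s"
      using low_rank_normalize[OF that pos] by (intro le_s) (simp add: A_def)
    then show ?thesis using pos by (simp only: sens_scale) (simp add: field_simps)
  qed (simp add: sens_frob_zero)
  have approx: "\<exists>Y\<in>\<N>. \<exists>d. sens n M X w \<le> sens n M Y w + d \<and> sens n M Y w - d \<le> sens n M X w \<and> d \<le> 2 * (1 / 384) * s"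
    if XA: "X \<in> A" for X
  proof -
    obtain Y where Y: "Y \<in> \<N>" "low_rank M (r + r) (1 / 384) (\<lambda>a b. X a b - Y a b)"
      using net[of X] XA unfolding A_def by blast
    obtain Z1 Z2 where Z: "low_rank M r (1 / 384) Z1" "low_rank M r (1 / 384) Z2"
      "\<And>a b. a < M \<Longrightarrow> b < M \<Longrightarrow> X a b - Y a b = Z1 a b + Z2 a b"
      using low_rank_split[OF Y(2)] by metis
    let ?Z = "\<lambda>a b. Z1 a b + Z2 a b"
    have XY: "sens n M X w = sens n M (\<lambda>a b. Y a b + ?Z a b) w" using Z(3) by (intro sens_cong) (simp add: algebra_simps)
    have s0: "0 \<le> s" using le_s[OF XA] sens_nonneg[of n M X w] by linarith
    have "sens n M Z w \<le> s * (1 / 384)" if "low_rank M r (1 / 384) Z" for Z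
      using order_trans[OF scaled[OF that] mult_left_mono[OF low_rank_frob[OF that] s0]] by simp
    from this[OF Z(1)] this[OF Z(2)]
    have "sens n M ?Z w \<le> 2 * (1 / 384) * s" using sens_triangle[of n M Z1 Z2 w] by simp
    then show ?thesis
      using Y(1) sens_triangle[of n M Y ?Z w] sens_triangle_lower[of n M Y w ?Z] unfolding XY
      by (intro bexI[of _ Y] exI[of _ "sens n M ?Z w"]) auto
  qed
  have s8: "s \<le> 8 * real n" if "X \<in> A" for X
  proof -
    have "s \<le> 4 * real n + 2 * (1 / 384) * s"
      unfolding s_def
    proof (rule cSup_least)
      show "(\<lambda>X. sens n M X w) ` A \<noteq> {}" using that by blast
      fix v assume "v \<in> (\<lambda>X. sens n M X w) ` A"
      then obtain X where "X \<in> A" "v = sens n M X w" by blast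
      then show "v \<le> 4 * real n + 2 * (1 / 384) * Sup ((\<lambda>X. sens n M X w) ` A)"
        using approx[of X] bounds unfolding s_def by fastforce
    qed
    then show ?thesis by simp
  qed
  have both: "sens n M X w \<le> 8 * real n * sqrt (frob2 M X) \<and> real n * sqrt (frob2 M X) / 24 \<le> sens n M X w"
  proof (cases "frob2 M X = 0")
    case False
    then have pos: "frob2 M X > 0" using frob2_nonneg[of M X] by linarith
    let ?t = "sqrt (frob2 M X)" and ?X' = "\<lambda>a b. (1 / sqrt (frob2 M X)) * X a b"
    have X': "?X' \<in> A" using low_rank_normalize[OF X pos] by (simp add: A_def)
    have 1: "sens n M X w = ?t * sens n M ?X' w" using pos by (simp only: sens_scale) simp
    have "sens n M ?X' w \<le> 8 * real n" using le_s[OF X'] s8[OF X'] by simp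
    \<comment> \<open>The mesh 1 / 384 is fixed by this step: the approximation error is at most 2 /
      384 times \<open>s \<le> 8 * real n\<close>, that is n / 24, half of the lower bound n / 12 on
      the net.\<close>
    moreover have "real n / 24 \<le> sens n M ?X' w"
      using approx[OF X'] bounds s8[OF X'] by fastforce
    ultimately show ?thesis unfolding 1 using pos by (simp add: field_simps)
  qed (simp add: sens_frob_zero)
  show "sens n M X w \<le> 8 * real n * sqrt (frob2 M X)" using both by (rule conjunct1)
  show "real n * sqrt (frob2 M X) / 24 \<le> sens n M X w" using both by (rule conjunct2)
qed

text \<open>Union bound over the net for rank \<open>\<kappa> * R\<close>: each of its matrices
  fails with probability at most \<open>2 * exp (- real n / 36)\<close>. The event \<open>E\<close>
  avoids finitely many measurable bad sets, so it is measurable although it controls uncountably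
  many matrices.\<close>

lemma sens_event:
  fixes \<kappa> :: nat
  assumes \<kappa>: "1 \<le> \<kappa>"
  obtains C :: real where "0 < C"
    "\<And>R M L. 1 \<le> R \<Longrightarrow> 1 \<le> M \<Longrightarrow> C * real R * real M \<le> real L \<Longrightarrow>
      2 \<le> L \<and> (\<exists>E\<in>sets (gaussian_vectors L M). measure (gaussian_vectors L M) E > 1 - exp (- real M) \<and>
        (\<forall>w\<in>E. \<forall>X c. low_rank M (\<kappa> * R) c X \<longrightarrow>
          sens (L div 2) M X w \<le> 8 * real (L div 2) * sqrt (frob2 M X) \<and>
          real (L div 2) * sqrt (frob2 M X) / 24 \<le> sens (L div 2) M X w))"
proof -
  have "(0 :: real) < 1 / 384" by simp
  from low_rank_net[OF this] obtain D :: real where D: "1 \<le> D" and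
    net: "\<forall>M r. 1 \<le> M \<longrightarrow> 1 \<le> r \<longrightarrow> (\<exists>\<N>. finite \<N> \<and> real (card \<N>) \<le> D ^ (M * r) \<and>
      (\<forall>X\<in>\<N>. low_rank M r 1 X \<and> frob2 M X = 1) \<and>
      (\<forall>X. low_rank M r 1 X \<and> frob2 M X = 1 \<longrightarrow>
        (\<exists>Y\<in>\<N>. low_rank M (r + r) (1 / 384) (\<lambda>a b. X a b - Y a b))))"
    by (elim exE conjE) (rule that)
  \<comment> \<open>108 = 3 * 36, from \<open>n \<ge> L / 3\<close> and the rate 1 / 36. The summand
    3 pays for the factor 2 \<le> exp 1, for the wanted \<open>exp (- real M)\<close>, and for
    strictness.\<close>
  define C where "C = 108 * (real \<kappa> * ln D + 3)"
  have lnD: "0 \<le> ln D" using D by simp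
  have C: "324 \<le> C" using lnD by (simp add: C_def)
  show thesis
  proof (rule that[of C])
    show "0 < C" using C by simp
    fix R M L :: nat assume R: "1 \<le> R" and M: "1 \<le> M" and L: "C * real R * real M \<le> real L"
    define n where "n = L div 2"
    have RM: "1 \<le> real R * real M" using R M by (simp add: mult_ge1_I)
    have "324 * 1 \<le> C * (real R * real M)" using C RM by (intro mult_mono) auto
    then have L324: "324 \<le> real L" using L by simp
    have n: "2 * n \<le> L" "real L / 3 \<le> real n"
      using L324 by (auto simp: n_def)
    have "1 \<le> \<kappa> * R" using \<kappa> R by simp
    from net[rule_format, OF M this] obtain \<N> where "finite \<N>" "real (card \<N>) \<le> D ^ (M * (\<kappa> * R))"
      and N: "\<forall>X\<in>\<N>. low_rank M (\<kappa> * R) 1 X \<and> frob2 M X = 1"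
        "\<forall>X. low_rank M (\<kappa> * R) 1 X \<and> frob2 M X = 1 \<longrightarrow>
          (\<exists>Y\<in>\<N>. low_rank M (\<kappa> * R + \<kappa> * R) (1 / 384) (\<lambda>a b. X a b - Y a b))"
      by (elim exE conjE) (rule that)
    then have \<N>: "finite \<N>" "real (card \<N>) \<le> D ^ (M * (\<kappa> * R))"
      "\<And>X. X \<in> \<N> \<Longrightarrow> low_rank M (\<kappa> * R) 1 X" "\<And>X. X \<in> \<N> \<Longrightarrow> frob2 M X = 1"
      "\<And>X. low_rank M (\<kappa> * R) 1 X \<Longrightarrow> frob2 M X = 1 \<Longrightarrow>
        \<exists>Y\<in>\<N>. low_rank M (\<kappa> * R + \<kappa> * R) (1 / 384) (\<lambda>a b. X a b - Y a b)"
      by simp_all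
    let ?G = "gaussian_vectors L M"
    interpret G: prob_space ?G by (rule prob_space_gaussian_vectors)
    note [measurable] = sens_measurable[OF n(1)]
    define bad1 where "bad1 Y = {w \<in> space ?G. 4 * real n \<le> sens n M Y w}" for Y
    define bad2 where "bad2 Y = {w \<in> space ?G. sens n M Y w \<le> real n / 12}" for Y
    have [measurable]: "bad1 Y \<in> sets ?G" "bad2 Y \<in> sets ?G" for Y unfolding bad1_def bad2_def by measurable
    define bad where "bad = (\<Union>Y\<in>\<N>. bad1 Y \<union> bad2 Y)"
    have bad_sets [measurable]: "bad \<in> sets ?G" unfolding bad_def by (rule sets.finite_UN[OF \<N>(1)]) auto
    have "G.prob bad \<le> (\<Sum>Y\<in>\<N>. G.prob (bad1 Y \<union> bad2 Y))"
      unfolding bad_def by (rule G.finite_measure_subadditive_finite[OF \<N>(1)]) auto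
    also have "\<dots> \<le> (\<Sum>Y\<in>\<N>. 2 * exp (- real n / 36))"
    proof (rule sum_mono)
      fix Y assume Y: "Y \<in> \<N>"
      have "G.prob (bad1 Y \<union> bad2 Y) \<le> G.prob (bad1 Y) + G.prob (bad2 Y)"
        by (rule measure_Un_le) auto
      also have "\<dots> \<le> exp (- real n) + exp (- real n / 36)"
        unfolding bad1_def bad2_def
        by (intro add_mono sens_tails[OF n(1) \<N>(4)[OF Y] low_rank_symmetric[OF \<N>(3)[OF Y]]])
      also have "exp (- real n) \<le> exp (- real n / 36)" by simp
      finally show "G.prob (bad1 Y \<union> bad2 Y) \<le> 2 * exp (- real n / 36)" by simp
    qed
    also have "\<dots> = real (card \<N>) * (2 * exp (- real n / 36))" by simp
    also have "\<dots> \<le> D ^ (M * (\<kappa> * R)) * (2 * exp (- real n / 36))"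
      by (intro mult_right_mono \<N>(2)) simp
    also have "D ^ (M * (\<kappa> * R)) = exp (real (M * (\<kappa> * R)) * ln D)"
      using D by (simp only: exp_of_nat_mult) simp
    also have "exp (real (M * (\<kappa> * R)) * ln D) * (2 * exp (- real n / 36)) \<le>
      exp (real (M * (\<kappa> * R)) * ln D) * (exp 1 * exp (- real n / 36))"
      using exp_ge_add_one_self[of "1::real"] by (intro mult_left_mono mult_right_mono) auto
    also have "\<dots> = exp (real M * real R * (real \<kappa> * ln D) + 1 - real n / 36)"
      by (simp add: mult_exp_exp algebra_simps)
    also have "\<dots> < exp (- real M)"
    proof (subst exp_less_cancel_iff)
      have "108 * ((real \<kappa> * ln D + 3) * real R * real M) \<le> real L"
        using L unfolding C_def by (simp only: mult.assoc)
      then have "(real \<kappa> * ln D + 3) * real R * real M \<le> real n / 36" using n(2) by linarith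
      then have "real n / 36 \<ge> real M * real R * (real \<kappa> * ln D) + 3 * (real R * real M)" by (simp add: algebra_simps)
      moreover have "1 * real M \<le> real R * real M" using R by (intro mult_right_mono) auto
      ultimately show "real M * real R * (real \<kappa> * ln D) + 1 - real n / 36 < - real M" using RM by linarith
    qed
    finally have prob: "G.prob bad < exp (- real M)" .
    show "2 \<le> L \<and> (\<exists>E\<in>sets ?G. measure ?G E > 1 - exp (- real M) \<and>
        (\<forall>w\<in>E. \<forall>X c. low_rank M (\<kappa> * R) c X \<longrightarrow>
          sens (L div 2) M X w \<le> 8 * real (L div 2) * sqrt (frob2 M X) \<and>
          real (L div 2) * sqrt (frob2 M X) / 24 \<le> sens (L div 2) M X w))"
    proof (intro conjI bexI[of _ "space ?G - bad"] ballI allI impI)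
      show "2 \<le> L" using L324 by linarith
      show "measure ?G (space ?G - bad) > 1 - exp (- real M)"
        using G.prob_compl[OF bad_sets] prob by simp
      fix w X c assume w: "w \<in> space ?G - bad" and X: "low_rank M (\<kappa> * R) c X"
      have "real n / 12 \<le> sens n M Y w \<and> sens n M Y w \<le> 4 * real n" if "Y \<in> \<N>" for Y
        using w that by (force simp: bad_def bad1_def bad2_def)
      note u = sens_uniform[OF \<N>(5) this X]
      show "sens (L div 2) M X w \<le> 8 * real (L div 2) * sqrt (frob2 M X)"
        "real (L div 2) * sqrt (frob2 M X) / 24 \<le> sens (L div 2) M X w"
        using u by (auto simp: n_def)
    qed auto
  qed
qed

section \<open>Joint-sparse recovery\<close>

lemma top_subset:
  fixes a :: "'i \<Rightarrow> real"
  assumes "finite S" "s \<le> card S"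
  shows "\<exists>T\<subseteq>S. card T = s \<and> (\<forall>i\<in>T. \<forall>j\<in>S - T. a j \<le> a i)"
  using assms(2)
proof (induction s)
  case (Suc s)
  then obtain T where T: "T \<subseteq> S" "card T = s" "\<forall>i\<in>T. \<forall>j\<in>S - T. a j \<le> a i" by auto
  have "S - T \<noteq> {}" using T Suc.prems by (metis Diff_eq_empty_iff Suc_n_not_le_n subset_antisym)
  moreover have fin: "finite (a ` (S - T))" using assms(1) by simp
  ultimately have "Max (a ` (S - T)) \<in> a ` (S - T)" by (intro Max_in) auto
  then obtain m where "m \<in> S - T" "Max (a ` (S - T)) = a m" by auto
  then have m: "m \<in> S - T" "\<And>j. j \<in> S - T \<Longrightarrow> a j \<le> a m" using Max_ge[OF fin] by auto
  have "finite T" using T(1) assms(1) finite_subset by blast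
  then show ?case using T m by (intro exI[of _ "insert m T"]) auto
qed auto

text \<open>Sorting by size and cutting into blocks of length \<open>s\<close>: every entry of a block is at most the
  average of the preceding block.\<close>

lemma block_decomposition:
  fixes a :: "'i \<Rightarrow> real"
  assumes "finite S" "\<And>i. i \<in> S \<Longrightarrow> 0 \<le> a i" "1 \<le> s"
  shows "\<exists>T \<T>. T \<subseteq> S \<and> card T \<le> s \<and> finite \<T> \<and> \<Union>\<T> = S - T \<and> disjoint \<T> \<and>
    (\<forall>B\<in>\<T>. card B \<le> s) \<and>
    (\<Sum>B\<in>\<T>. sqrt (\<Sum>i\<in>B. (a i)\<^sup>2)) \<le> (\<Sum>i\<in>S. a i) / sqrt (real s)"
  using assms
proof (induction S rule: finite_psubset_induct)
  case (psubset S)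
  show ?case
  proof (cases "card S \<le> s")
    case True
    have "0 \<le> (\<Sum>i\<in>S. a i)" using psubset.prems by (intro sum_nonneg) auto
    then show ?thesis using True by (intro exI[of _ S] exI[of _ "{}"]) auto
  next
    case False
    then obtain T where T: "T \<subseteq> S" "card T = s" "\<And>i j. i \<in> T \<Longrightarrow> j \<in> S - T \<Longrightarrow> a j \<le> a i"
      using top_subset[OF psubset(1), of s a] by auto
    have fT: "finite T" "T \<noteq> {}" using T(2) psubset.prems(2) by (auto intro: card_ge_0_finite)
    have sub: "S - T \<subset> S" using T(1) fT by blast
    have "\<exists>T' \<T>. T' \<subseteq> S - T \<and> card T' \<le> s \<and> finite \<T> \<and> \<Union>\<T> = S - T - T' \<and> disjoint \<T> \<and>
      (\<forall>B\<in>\<T>. card B \<le> s) \<and> (\<Sum>B\<in>\<T>. sqrt (\<Sum>i\<in>B. (a i)\<^sup>2)) \<le> (\<Sum>i\<in>S - T. a i) / sqrt (real s)"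
      by (rule psubset.IH[OF sub _ psubset.prems(2)]) (use psubset.prems(1) in simp)
    then obtain T' \<T> where IH: "T' \<subseteq> S - T" "card T' \<le> s" "finite \<T>" "\<Union>\<T> = S - T - T'" "disjoint \<T>"
      "\<forall>B\<in>\<T>. card B \<le> s" "(\<Sum>B\<in>\<T>. sqrt (\<Sum>i\<in>B. (a i)\<^sup>2)) \<le> (\<Sum>i\<in>S - T. a i) / sqrt (real s)"
      by (elim exE conjE) (rule that)
    have fT': "finite T'" using IH(1) psubset(1) by (meson finite_Diff finite_subset)
    define avg where "avg = (\<Sum>i\<in>T. a i) / s"
    have le_avg: "a j \<le> avg" if "j \<in> S - T" for j
    proof -
      have "real s * a j = (\<Sum>i\<in>T. a j)" using T(2) by simp
      also have "\<dots> \<le> (\<Sum>i\<in>T. a i)" using T(3) that by (intro sum_mono) auto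
      finally show ?thesis using psubset.prems(2) by (simp add: avg_def field_simps)
    qed
    have "0 \<le> avg" unfolding avg_def using psubset.prems T(1) by (intro divide_nonneg_nonneg sum_nonneg) auto
    have "(\<Sum>i\<in>T'. (a i)\<^sup>2) \<le> (\<Sum>i\<in>T'. avg\<^sup>2)"
      using IH(1) le_avg psubset.prems(1) by (intro sum_mono power_mono) auto
    also have "\<dots> \<le> real s * avg\<^sup>2" using IH(2) by (simp add: mult_right_mono)
    finally have "sqrt (\<Sum>i\<in>T'. (a i)\<^sup>2) \<le> sqrt (real s * avg\<^sup>2)" by (rule real_sqrt_le_mono)
    also have "\<dots> = sqrt (real s) * avg" using \<open>0 \<le> avg\<close> by (simp add: real_sqrt_mult)
    also have "\<dots> = (\<Sum>i\<in>T. a i) / sqrt (real s)"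
    proof -
      have "0 < sqrt (real s)" using psubset.prems(2) by simp
      moreover have "real s = sqrt (real s) * sqrt (real s)" by simp
      ultimately show ?thesis unfolding avg_def by (metis divide_divide_eq_left less_irrefl nonzero_mult_div_cancel_left times_divide_eq_right)
    qed
    finally have T'_le: "sqrt (\<Sum>i\<in>T'. (a i)\<^sup>2) \<le> (\<Sum>i\<in>T. a i) / sqrt (real s)" .
    \<comment> \<open>\<open>T'\<close> can already belong to \<open>\<T>\<close> only if it is
      empty, since the members cover just \<open>S - T - T'\<close>; then the insertion adds
      nothing.\<close>
    have "(\<Sum>B\<in>insert T' \<T>. sqrt (\<Sum>i\<in>B. (a i)\<^sup>2)) \<le> sqrt (\<Sum>i\<in>T'. (a i)\<^sup>2) + (\<Sum>B\<in>\<T>. sqrt (\<Sum>i\<in>B. (a i)\<^sup>2))"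
      using IH(3) by (cases "T' \<in> \<T>") (auto simp: insert_absorb sum_nonneg)
    also have "\<dots> \<le> (\<Sum>i\<in>T. a i) / sqrt (real s) + (\<Sum>i\<in>S - T. a i) / sqrt (real s)"
      by (intro add_mono T'_le IH)
    also have "\<dots> = (\<Sum>i\<in>S. a i) / sqrt (real s)"
      using sum.subset_diff[OF T(1) psubset(1), of a] by (simp add: add_divide_distrib)
    finally have sum_le: "(\<Sum>B\<in>insert T' \<T>. sqrt (\<Sum>i\<in>B. (a i)\<^sup>2)) \<le> (\<Sum>i\<in>S. a i) / sqrt (real s)" .
    show ?thesis
    proof (intro exI[of _ T] exI[of _ "insert T' \<T>"] conjI ballI sum_le)
      show "\<Union>(insert T' \<T>) = S - T" using IH(1,4) by auto
      show "disjoint (insert T' \<T>)" using IH(4,5) by (auto simp: pairwise_insert disjnt_def)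
    qed (use T IH in auto)
  qed
qed

text \<open>The differences of two \<open>K\<close>-sparse vectors are the
  \<open>2 * K\<close>-sparse ones, so this is an isometry of level \<open>2 * K\<close>. That
  leaves room for two disjoint blocks of size \<open>K\<close>, as in the recovery argument.\<close>

definition rip_fun :: "nat \<Rightarrow> nat \<Rightarrow> nat \<Rightarrow> (nat \<Rightarrow> nat \<Rightarrow> real) \<Rightarrow> real \<Rightarrow> bool" where
  "rip_fun K M N P \<delta> \<longleftrightarrow> (\<forall>x z. card {n. n < N \<and> x n \<noteq> 0} \<le> K \<longrightarrow> card {n. n < N \<and> z n \<noteq> 0} \<le> K \<longrightarrow>
     (1 - \<delta>) * ip N (\<lambda>n. x n - z n) (\<lambda>n. x n - z n) \<le> (\<Sum>a<M. (ip N (P a) (\<lambda>n. x n - z n))\<^sup>2) \<and>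
     (\<Sum>a<M. (ip N (P a) (\<lambda>n. x n - z n))\<^sup>2) \<le> (1 + \<delta>) * ip N (\<lambda>n. x n - z n) (\<lambda>n. x n - z n))"

lemma rip_funD:
  assumes "rip_fun K M N P \<delta>" "card {n. n < N \<and> x n \<noteq> 0} \<le> K" "card {n. n < N \<and> z n \<noteq> 0} \<le> K"
  shows "(1 - \<delta>) * ip N (\<lambda>n. x n - z n) (\<lambda>n. x n - z n) \<le> (\<Sum>a<M. (ip N (P a) (\<lambda>n. x n - z n))\<^sup>2)"
    "(\<Sum>a<M. (ip N (P a) (\<lambda>n. x n - z n))\<^sup>2) \<le> (1 + \<delta>) * ip N (\<lambda>n. x n - z n) (\<lambda>n. x n - z n)"
  using assms unfolding rip_fun_def by auto

definition restr :: "nat set \<Rightarrow> (nat \<Rightarrow> real) \<Rightarrow> nat \<Rightarrow> real" where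
  "restr T x n = (if n \<in> T then x n else 0)"

lemma card_restr_support:
  assumes "T \<subseteq> {..<N}" "card T \<le> K"
  shows "card {n. n < N \<and> restr T x n \<noteq> 0} \<le> K" "card {n. n < N \<and> - restr T x n \<noteq> 0} \<le> K"
    "card {n. n < N \<and> t * restr T x n \<noteq> 0} \<le> K"
proof -
  have "finite T" using assms(1) finite_subset by blast
  then have "card A \<le> K" if "A \<subseteq> T" for A using card_mono[OF _ that] assms(2) by linarith
  then show "card {n. n < N \<and> restr T x n \<noteq> 0} \<le> K" "card {n. n < N \<and> - restr T x n \<noteq> 0} \<le> K"
    "card {n. n < N \<and> t * restr T x n \<noteq> 0} \<le> K"
    by (auto simp: restr_def intro!: \<open>\<And>A. A \<subseteq> T \<Longrightarrow> card A \<le> K\<close>)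
qed

lemma restr_ip_disjoint: "T \<inter> T' = {} \<Longrightarrow> ip N (restr T x) (restr T' z) = 0"
  unfolding ip_def by (intro sum.neutral) (auto simp: restr_def)

lemma ip_restr: "T \<subseteq> {..<N} \<Longrightarrow> ip N (restr T x) (restr T x) = (\<Sum>n\<in>T. (x n)\<^sup>2)"
  unfolding ip_self by (rule sum.mono_neutral_cong_right) (auto simp: restr_def)

text \<open>Polarisation: the inner product of the images is a difference of squared lengths of the
  images of t x + z and t x - z, two vectors of equal length because the supports are disjoint.
  Setting the free factor \<open>t\<close> to the ratio of the norms turns the sum of squares into
  their product.\<close>

lemma rip_inner_le:
  assumes rip: "rip_fun K M N P \<delta>" and T: "T \<subseteq> {..<N}" "card T \<le> K" and T': "T' \<subseteq> {..<N}" "card T' \<le> K"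
    and disj: "T \<inter> T' = {}" and \<delta>: "0 \<le> \<delta>"
  shows "(\<Sum>a<M. ip N (P a) (restr T x) * ip N (P a) (restr T' z)) \<le>
    \<delta> * sqrt (ip N (restr T x) (restr T x)) * sqrt (ip N (restr T' z) (restr T' z))"
proof -
  let ?x = "restr T x" and ?z = "restr T' z"
  define I where "I = (\<Sum>a<M. ip N (P a) ?x * ip N (P a) ?z)"
  define X where "X = ip N ?x ?x"
  define Z where "Z = ip N ?z ?z"
  have XZ: "0 \<le> X" "0 \<le> Z" by (auto simp: X_def Z_def)
  have scaled: "2 * t * I \<le> \<delta> * (t\<^sup>2 * X + Z)" for t
  proof -
    have n: "ip N (\<lambda>n. t * ?x n - - ?z n) (\<lambda>n. t * ?x n - - ?z n) = t\<^sup>2 * X + Z"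
      "ip N (\<lambda>n. t * ?x n - ?z n) (\<lambda>n. t * ?x n - ?z n) = t\<^sup>2 * X + Z"
      using restr_ip_disjoint[OF disj, of N x z]
      by (simp_all add: X_def Z_def ip_def algebra_simps power2_eq_square sum.distrib sum_subtractf
        flip: sum_distrib_left)
    have u: "(\<Sum>a<M. (ip N (P a) (\<lambda>n. t * ?x n - - ?z n))\<^sup>2) \<le> (1 + \<delta>) * (t\<^sup>2 * X + Z)"
      unfolding n(1)[symmetric]
      by (rule rip_funD(2)[OF rip card_restr_support(3)[OF T] card_restr_support(2)[OF T']])
    have l: "(1 - \<delta>) * (t\<^sup>2 * X + Z) \<le> (\<Sum>a<M. (ip N (P a) (\<lambda>n. t * ?x n - ?z n))\<^sup>2)"
      unfolding n(2)[symmetric]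
      by (rule rip_funD(1)[OF rip card_restr_support(3)[OF T] card_restr_support(1)[OF T']])
    have "(\<Sum>a<M. (ip N (P a) (\<lambda>n. t * ?x n - - ?z n))\<^sup>2) - (\<Sum>a<M. (ip N (P a) (\<lambda>n. t * ?x n - ?z n))\<^sup>2) =
      (\<Sum>a<M. 4 * t * (ip N (P a) ?x * ip N (P a) ?z))"
      unfolding sum_subtractf[symmetric]
    proof (rule sum.cong[OF refl])
      fix a
      have "ip N (P a) (\<lambda>n. t * ?x n - - ?z n) = t * ip N (P a) ?x + ip N (P a) ?z"
        "ip N (P a) (\<lambda>n. t * ?x n - ?z n) = t * ip N (P a) ?x - ip N (P a) ?z"
        by (simp_all add: ip_def algebra_simps sum.distrib sum_subtractf sum_distrib_left)
      then show "(ip N (P a) (\<lambda>n. t * ?x n - - ?z n))\<^sup>2 - (ip N (P a) (\<lambda>n. t * ?x n - ?z n))\<^sup>2 =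
        4 * t * (ip N (P a) ?x * ip N (P a) ?z)" by (simp only:) (simp add: power2_eq_square algebra_simps)
    qed
    also have "\<dots> = 4 * t * I" by (simp add: I_def sum_distrib_left)
    finally have "4 * t * I \<le> (1 + \<delta>) * (t\<^sup>2 * X + Z) - (1 - \<delta>) * (t\<^sup>2 * X + Z)" using u l by linarith
    then show ?thesis by (simp add: algebra_simps)
  qed
  have zero: "ip N (P a) v = 0" if "ip N v v = 0" for a v
    using ip_Cauchy_Schwarz[of N "P a" v] that by simp
  have "I \<le> \<delta> * sqrt X * sqrt Z"
  proof (cases "X = 0 \<or> Z = 0")
    case True
    then have "I = 0" using zero by (auto simp: I_def X_def Z_def)
    then show ?thesis using \<delta> XZ by simp
  next
    case False
    then have pos: "0 < X" "0 < Z" using XZ by auto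
    have "2 * (sqrt Z / sqrt X) * I \<le> \<delta> * ((sqrt Z / sqrt X)\<^sup>2 * X + Z)" by (rule scaled)
    also have "\<dots> = 2 * \<delta> * Z" using pos by (simp add: power_divide)
    also have "\<dots> = 2 * (sqrt Z / sqrt X) * (\<delta> * sqrt X * sqrt Z)" using pos by simp
    finally show ?thesis using pos by (subst (asm) mult_le_cancel_left_pos) auto
  qed
  then show ?thesis by (simp add: I_def X_def Z_def)
qed


lemma restr_sum_disjoint:
  assumes "finite \<T>" "disjoint \<T>"
  shows "restr (\<Union>\<T>) x n = (\<Sum>B\<in>\<T>. restr B x n)"
  using assms
proof (induction \<T>)
  case empty
  then show ?case by (simp add: restr_def)
next
  case (insert B \<T>)
  have "B \<inter> \<Union>\<T> = {}" using insert(2,4) by (auto simp: pairwise_insert disjnt_def)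
  then have "restr (\<Union>(insert B \<T>)) x n = restr B x n + restr (\<Union>\<T>) x n"
    by (auto simp: restr_def)
  then show ?case using insert by (simp add: pairwise_insert)
qed

lemma sum_squares_le_square_sum:
  fixes f :: "'i \<Rightarrow> real"
  assumes "finite I" "\<And>i. i \<in> I \<Longrightarrow> 0 \<le> f i"
  shows "(\<Sum>i\<in>I. (f i)\<^sup>2) \<le> (\<Sum>i\<in>I. f i)\<^sup>2"
  using assms
proof (induction I)
  case (insert i I)
  have "0 \<le> f i * (\<Sum>i\<in>I. f i)" using insert.prems by (intro mult_nonneg_nonneg sum_nonneg) auto
  then show ?case using insert by (simp add: power2_sum)
qed simp

lemma mult_sum_le_sqrt:
  fixes f g :: "'i \<Rightarrow> real"
  assumes nonneg: "\<And>i. i \<in> I \<Longrightarrow> 0 \<le> f i" "\<And>i. i \<in> I \<Longrightarrow> 0 \<le> g i"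
  shows "(\<Sum>i\<in>I. sqrt (f i) * sqrt (g i)) \<le> sqrt (\<Sum>i\<in>I. f i) * sqrt (\<Sum>i\<in>I. g i)"
proof -
  have "(\<Sum>i\<in>I. \<bar>sqrt (f i)\<bar> * \<bar>sqrt (g i)\<bar>) \<le> L2_set (\<lambda>i. sqrt (f i)) I * L2_set (\<lambda>i. sqrt (g i)) I"
    by (rule L2_set_mult_ineq)
  also have "L2_set (\<lambda>i. sqrt (f i)) I = sqrt (\<Sum>i\<in>I. f i)" using nonneg by (simp add: L2_set_def)
  also have "L2_set (\<lambda>i. sqrt (g i)) I = sqrt (\<Sum>i\<in>I. g i)" using nonneg by (simp add: L2_set_def)
  finally show ?thesis using nonneg by simp
qed

text \<open>Candes' argument for \<open>\<ell>\<^sub>1\<close>-recovery, with rows in the place of entries. \<open>H\<close> is the difference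
  of two feasible matrices and \<open>T\<^sub>0\<close> the row support of the sparse one.\<close>

lemma joint_sparse_recovery:
  fixes P H :: "nat \<Rightarrow> nat \<Rightarrow> real"
  assumes rip: "rip_fun K M N P \<delta>" and \<delta>: "0 \<le> \<delta>" "\<delta> \<le> 1 / 10" and K: "1 \<le> K"
    and T0: "T0 \<subseteq> {..<N}" "card T0 \<le> K"
    and cone: "(\<Sum>n\<in>{..<N} - T0. sqrt (\<Sum>c<R. (H n c)\<^sup>2)) \<le> (\<Sum>n\<in>T0. sqrt (\<Sum>c<R. (H n c)\<^sup>2))"
  shows "sqrt (\<Sum>n<N. \<Sum>c<R. (H n c)\<^sup>2) \<le> 3 * sqrt (\<Sum>c<R. \<Sum>a<M. (ip N (P a) (\<lambda>n. H n c))\<^sup>2)"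
proof -
  define g where "g n = (\<Sum>c<R. (H n c)\<^sup>2)" for n
  have g: "0 \<le> g n" for n by (auto simp: g_def intro: sum_nonneg)
  define h where "h T = sqrt (\<Sum>n\<in>T. g n)" for T
  have h: "0 \<le> h T" "(h T)\<^sup>2 = (\<Sum>n\<in>T. g n)" for T using g by (simp_all add: h_def sum_nonneg)
  obtain T1 \<T> where T1: "T1 \<subseteq> {..<N} - T0" "card T1 \<le> K" and \<T>: "finite \<T>" "\<Union>\<T> = {..<N} - T0 - T1" "disjoint \<T>"
    "\<And>B. B \<in> \<T> \<Longrightarrow> card B \<le> K" and blocks: "(\<Sum>B\<in>\<T>. sqrt (\<Sum>n\<in>B. (sqrt (g n))\<^sup>2)) \<le> (\<Sum>n\<in>{..<N} - T0. sqrt (g n)) / sqrt (real K)"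
    using block_decomposition[of "{..<N} - T0" "\<lambda>n. sqrt (g n)" K] K g by auto
  have fin: "finite T0" "finite T1" using T0 T1 finite_subset by blast+
  have B: "B \<subseteq> {..<N}" "B \<inter> T0 = {}" "B \<inter> T1 = {}" "finite B" if "B \<in> \<T>" for B
  proof -
    show "B \<subseteq> {..<N}" "B \<inter> T0 = {}" "B \<inter> T1 = {}" using \<T>(2) that by blast+
    then show "finite B" using finite_subset by blast
  qed
  define x0 where "x0 = h T0"
  define x1 where "x1 = h T1"
  define x where "x = sqrt (x0\<^sup>2 + x1\<^sup>2)"
  have x: "0 \<le> x0" "0 \<le> x1" "0 \<le> x" "x\<^sup>2 = x0\<^sup>2 + x1\<^sup>2" using h(1) by (auto simp: x0_def x1_def x_def)
  have x0x: "x0 \<le> x" "x1 \<le> x" using x by (auto simp: x_def intro!: real_le_rsqrt)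
  \<comment> \<open>All blocks after \<open>T1\<close> together weigh no more than
    \<open>T0\<close>: the block estimate, the cone condition and Cauchy-Schwarz on the at most
    \<open>K\<close> rows of \<open>T0\<close> lose no constant.\<close>
  have tail: "(\<Sum>B\<in>\<T>. h B) \<le> x0"
  proof -
    have "(\<Sum>B\<in>\<T>. h B) \<le> (\<Sum>n\<in>{..<N} - T0. sqrt (g n)) / sqrt (real K)"
      using blocks g by (simp add: h_def)
    also have "\<dots> \<le> (\<Sum>n\<in>T0. sqrt 1 * sqrt (g n)) / sqrt (real K)"
      using cone by (simp add: g_def divide_right_mono)
    also have "\<dots> \<le> (sqrt (\<Sum>n\<in>T0. 1) * sqrt (\<Sum>n\<in>T0. g n)) / sqrt (real K)"
      by (intro divide_right_mono mult_sum_le_sqrt g) auto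
    also have "\<dots> \<le> (sqrt (real K) * x0) / sqrt (real K)"
      using T0(2) h(1) by (intro divide_right_mono mult_mono) (auto simp: x0_def h_def)
    finally show ?thesis using K by simp
  qed
  define pr where "pr T T' = (\<Sum>c<R. \<Sum>a<M. ip N (P a) (restr T (\<lambda>n. H n c)) * ip N (P a) (restr T' (\<lambda>n. H n c)))" for T T'
  have norm_restr: "(\<Sum>c<R. ip N (restr T (\<lambda>n. H n c)) (restr T (\<lambda>n. H n c))) = (h T)\<^sup>2" if "T \<subseteq> {..<N}" for T
    unfolding h(2) g_def using ip_restr[OF that] by (simp add: sum.swap[of _ "{..<R}"])
  have pr_le: "- pr T T' \<le> \<delta> * h T * h T'"
    if T: "T \<subseteq> {..<N}" "card T \<le> K" and T': "T' \<subseteq> {..<N}" "card T' \<le> K" and disj: "T \<inter> T' = {}" for T T'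
  proof -
    have "- pr T T' = (\<Sum>c<R. \<Sum>a<M. ip N (P a) (restr T (\<lambda>n. H n c)) * ip N (P a) (restr T' (\<lambda>n. - H n c)))"
    proof -
      have "ip N (P a) (restr T' (\<lambda>n. - H n c)) = - ip N (P a) (restr T' (\<lambda>n. H n c))" for a c
        by (simp add: ip_def restr_def sum_negf[symmetric] if_distrib cong: if_cong)
      then show ?thesis by (simp add: pr_def sum_negf)
    qed
    also have "\<dots> \<le> (\<Sum>c<R. \<delta> * sqrt (ip N (restr T (\<lambda>n. H n c)) (restr T (\<lambda>n. H n c))) * sqrt (ip N (restr T' (\<lambda>n. - H n c)) (restr T' (\<lambda>n. - H n c))))"
      by (intro sum_mono rip_inner_le[OF rip T T' disj \<delta>(1)])
    also have "\<dots> = \<delta> * (\<Sum>c<R. sqrt (ip N (restr T (\<lambda>n. H n c)) (restr T (\<lambda>n. H n c))) * sqrt (ip N (restr T' (\<lambda>n. H n c)) (restr T' (\<lambda>n. H n c))))"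
      using ip_restr[OF T'(1)] by (simp add: sum_distrib_left mult.assoc)
    also have "\<dots> \<le> \<delta> * (sqrt ((h T)\<^sup>2) * sqrt ((h T')\<^sup>2))"
      unfolding norm_restr[OF T(1), symmetric] norm_restr[OF T'(1), symmetric]
      by (intro mult_left_mono mult_sum_le_sqrt \<delta>) auto
    finally show ?thesis using h(1) by (simp add: mult.assoc)
  qed
  define E where "E = sqrt (\<Sum>c<R. \<Sum>a<M. (ip N (P a) (\<lambda>n. H n c))\<^sup>2)"
  define u where "u c a = ip N (P a) (restr T0 (\<lambda>n. H n c)) + ip N (P a) (restr T1 (\<lambda>n. H n c))" for c a
  have H_split: "ip N (P a) (\<lambda>n. H n c) = u c a + (\<Sum>B\<in>\<T>. ip N (P a) (restr B (\<lambda>n. H n c)))" for a c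
  proof -
    have "H n c = restr T0 (\<lambda>n. H n c) n + restr T1 (\<lambda>n. H n c) n + (\<Sum>B\<in>\<T>. restr B (\<lambda>n. H n c) n)" if "n < N" for n
      unfolding restr_sum_disjoint[OF \<T>(1,3), symmetric] \<T>(2) using T0 T1 that by (auto simp: restr_def)
    then have "ip N (P a) (\<lambda>n. H n c) = ip N (P a) (\<lambda>n. restr T0 (\<lambda>n. H n c) n + restr T1 (\<lambda>n. H n c) n + (\<Sum>B\<in>\<T>. restr B (\<lambda>n. H n c) n))"
      by (simp add: ip_def)
    also have "\<dots> = u c a + ip N (P a) (\<lambda>n. \<Sum>B\<in>\<T>. 1 * restr B (\<lambda>n. H n c) n)"
      by (simp add: ip_def u_def distrib_left sum.distrib)
    finally show ?thesis unfolding ip_sum_right by simp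
  qed
  define U where "U = (\<Sum>c<R. \<Sum>a<M. (u c a)\<^sup>2)"
  have u_alt: "u c a = ip N (P a) (\<lambda>n. restr T0 (\<lambda>n. H n c) n - - restr T1 (\<lambda>n. H n c) n)" for c a
    by (simp add: u_def ip_def distrib_left sum.distrib)
  have T1': "T1 \<subseteq> {..<N}" "T0 \<inter> T1 = {}" using T1 by auto
  have norm01: "(\<Sum>c<R. ip N (\<lambda>n. restr T0 (\<lambda>n. H n c) n - - restr T1 (\<lambda>n. H n c) n) (\<lambda>n. restr T0 (\<lambda>n. H n c) n - - restr T1 (\<lambda>n. H n c) n)) = x\<^sup>2"
  proof -
    have "ip N (\<lambda>n. restr T0 y n - - restr T1 y n) (\<lambda>n. restr T0 y n - - restr T1 y n) =
        ip N (restr T0 y) (restr T0 y) + ip N (restr T1 y) (restr T1 y)" for y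
      using restr_ip_disjoint[OF T1'(2), of N y y]
      by (simp add: ip_def algebra_simps sum.distrib flip: sum_distrib_left)
    then show ?thesis
      using norm_restr[OF T0(1)] norm_restr[OF T1'(1)] by (simp add: sum.distrib x(4) x0_def x1_def)
  qed
  have U_lower: "(1 - \<delta>) * x\<^sup>2 \<le> U"
    unfolding U_def u_alt norm01[symmetric] sum_distrib_left
    by (intro sum_mono rip_funD(1)[OF rip] card_restr_support T0 T1' T1(2))
  have U_upper: "U \<le> (1 + \<delta>) * x\<^sup>2"
    unfolding U_def u_alt norm01[symmetric] sum_distrib_left
    by (intro sum_mono rip_funD(2)[OF rip] card_restr_support T0 T1' T1(2))
  \<comment> \<open>\<open>U\<close> is the squared norm of the image of the rows in
    \<open>T0\<close> and \<open>T1\<close>. One of its two factors is written as the image of all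
    of \<open>H\<close>, which \<open>E\<close> measures, minus the tail blocks, which are nearly
    orthogonal to the other factor.\<close>
  have U_eq: "U = (\<Sum>c<R. \<Sum>a<M. u c a * ip N (P a) (\<lambda>n. H n c)) + (\<Sum>B\<in>\<T>. - pr T0 B - pr T1 B)"
  proof -
    have "pr T0 B + pr T1 B = (\<Sum>c<R. \<Sum>a<M. u c a * ip N (P a) (restr B (\<lambda>n. H n c)))" for B
      by (simp only: pr_def u_def sum.distrib distrib_right)
    then have "- pr T0 B - pr T1 B = - (\<Sum>c<R. \<Sum>a<M. u c a * ip N (P a) (restr B (\<lambda>n. H n c)))" for B
      by (metis minus_add_distrib uminus_add_conv_diff add.commute)
    then have "(\<Sum>B\<in>\<T>. - pr T0 B - pr T1 B) = - (\<Sum>B\<in>\<T>. \<Sum>c<R. \<Sum>a<M. u c a * ip N (P a) (restr B (\<lambda>n. H n c)))"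
      by (simp only: sum_negf)
    also have "(\<Sum>B\<in>\<T>. \<Sum>c<R. \<Sum>a<M. u c a * ip N (P a) (restr B (\<lambda>n. H n c))) =
        (\<Sum>c<R. \<Sum>a<M. u c a * (\<Sum>B\<in>\<T>. ip N (P a) (restr B (\<lambda>n. H n c))))"
      unfolding sum_distrib_left by (subst sum.swap, intro sum.cong refl, subst sum.swap, simp)
    finally have "(\<Sum>c<R. \<Sum>a<M. u c a * ip N (P a) (\<lambda>n. H n c)) + (\<Sum>B\<in>\<T>. - pr T0 B - pr T1 B) =
        (\<Sum>c<R. \<Sum>a<M. u c a * (ip N (P a) (\<lambda>n. H n c) - (\<Sum>B\<in>\<T>. ip N (P a) (restr B (\<lambda>n. H n c)))))"
      by (simp add: right_diff_distrib sum_subtractf)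
    also have "\<dots> = U" unfolding U_def H_split by (simp add: power2_eq_square)
    finally show ?thesis by simp
  qed
  have first: "(\<Sum>c<R. \<Sum>a<M. u c a * ip N (P a) (\<lambda>n. H n c)) \<le> sqrt U * E"
  proof -
    have "(\<Sum>p\<in>{..<R} \<times> {..<M}. (case p of (c, a) \<Rightarrow> u c a) * (case p of (c, a) \<Rightarrow> ip N (P a) (\<lambda>n. H n c))) \<le>
      (\<Sum>p\<in>{..<R} \<times> {..<M}. \<bar>case p of (c, a) \<Rightarrow> u c a\<bar> * \<bar>case p of (c, a) \<Rightarrow> ip N (P a) (\<lambda>n. H n c)\<bar>)"
      by (intro sum_mono) (metis abs_ge_self abs_mult)
    also have "\<dots> \<le> L2_set (\<lambda>(c, a). u c a) ({..<R} \<times> {..<M}) * L2_set (\<lambda>(c, a). ip N (P a) (\<lambda>n. H n c)) ({..<R} \<times> {..<M})"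
      by (rule L2_set_mult_ineq)
    finally show ?thesis
      by (simp add: L2_set_def U_def E_def sum.cartesian_product split_def)
  qed
  have second: "(\<Sum>B\<in>\<T>. - pr T0 B - pr T1 B) \<le> \<delta> * (x0 + x1) * x0"
  proof -
    have "(\<Sum>B\<in>\<T>. - pr T0 B - pr T1 B) \<le> (\<Sum>B\<in>\<T>. \<delta> * (x0 + x1) * h B)"
    proof (rule sum_mono)
      fix B' assume B': "B' \<in> \<T>"
      have "- pr T0 B' \<le> \<delta> * h T0 * h B'" "- pr T1 B' \<le> \<delta> * h T1 * h B'"
        using B[OF B'] \<T>(4)[OF B'] T0 T1 T1' by (auto intro!: pr_le)
      then show "- pr T0 B' - pr T1 B' \<le> \<delta> * (x0 + x1) * h B'" by (simp add: x0_def x1_def algebra_simps)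
    qed
    also have "\<dots> \<le> \<delta> * (x0 + x1) * x0"
      unfolding sum_distrib_left[symmetric] using \<delta> x tail by (intro mult_left_mono) auto
    finally show ?thesis .
  qed
  have E: "0 \<le> E" by (auto simp: E_def intro!: sum_nonneg)
  \<comment> \<open>21 / 20 is a rational upper bound for the square root of 1 + 1 / 10.\<close>
  have "sqrt U \<le> sqrt ((21 / 20 * x)\<^sup>2)"
  proof (rule real_sqrt_le_mono)
    have "U \<le> (1 + 1 / 10) * x\<^sup>2" using order_trans[OF U_upper mult_right_mono[of "1 + \<delta>" "1 + 1 / 10"]] \<delta> by simp
    also have "\<dots> \<le> (21 / 20 * x)\<^sup>2" by (simp add: power_mult_distrib power2_eq_square)
    finally show "U \<le> (21 / 20 * x)\<^sup>2" .
  qed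
  then have sqrtU: "sqrt U \<le> 21 / 20 * x" using x by simp
  have "9 / 10 * x\<^sup>2 \<le> (1 - \<delta>) * x\<^sup>2" using \<delta> by (intro mult_right_mono) auto
  also have "\<dots> \<le> U" by (rule U_lower)
  also have "\<dots> \<le> sqrt U * E + \<delta> * (x0 + x1) * x0" using first second U_eq by linarith
  also have "\<dots> \<le> 21 / 20 * x * E + 1 / 10 * (x + x) * x"
    using sqrtU E x x0x \<delta> by (intro add_mono mult_mono mult_right_mono) auto
  \<comment> \<open>7 / 10 = 9 / 10 - 2 / 10: the cross terms take at most
    \<open>2 * \<delta>\<close> times \<open>x\<^sup>2\<close> from the lower isometry bound, and
    \<open>\<delta> \<le> 1 / 10\<close> keeps the coefficient positive.\<close>
  finally have "7 / 10 * x * x \<le> 21 / 20 * E * x" by (simp add: power2_eq_square)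
  then have xE: "x \<le> 3 / 2 * E" using x(3) E by (cases "x = 0") auto
  have "(\<Sum>n<N. g n) \<le> (3 * E)\<^sup>2"
  proof -
    have "(\<Sum>n<N. g n) = (\<Sum>n\<in>T0. g n) + (\<Sum>n\<in>T1. g n) + (\<Sum>n\<in>\<Union>\<T>. g n)"
      using sum.subset_diff[OF T0(1), of g] sum.subset_diff[OF T1(1), of g] \<T>(2) by simp
    also have "(\<Sum>n\<in>\<Union>\<T>. g n) = (\<Sum>B\<in>\<T>. (h B)\<^sup>2)"
      using \<T>(3) B(4) by (subst sum.Union_disjoint) (auto simp: h(2) pairwise_def disjnt_def)
    also have "\<dots> \<le> (\<Sum>B\<in>\<T>. h B)\<^sup>2"
      by (intro sum_squares_le_square_sum \<T>(1) h(1))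
    also have "\<dots> \<le> x0\<^sup>2" using tail h(1) by (intro power_mono sum_nonneg) auto
    finally have "(\<Sum>n<N. g n) \<le> x\<^sup>2 + x\<^sup>2"
      using power_mono[OF x0x(1) x(1), of 2] by (simp add: x(4) x0_def x1_def h(2))
    also have "\<dots> \<le> (2 * x)\<^sup>2" by (simp add: power_mult_distrib)
    also have "\<dots> \<le> (3 * E)\<^sup>2" using xE x by (intro power_mono) auto
    finally show ?thesis .
  qed
  then have "sqrt (\<Sum>n<N. g n) \<le> 3 * E" using E by (intro real_le_lsqrt) (auto intro: sum_nonneg g)
  then show ?thesis by (simp add: E_def g_def)
qed

section \<open>Trace minimisation\<close>

text \<open>A version of \<open>low_rank_factorization\<close> for any finite index set, so that
  disjoint sums of index sets need no renumbering.\<close>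

lemma low_rank_sum:
  fixes f g :: "'i \<Rightarrow> nat \<Rightarrow> real"
  assumes I: "finite I" "card I \<le> r"
    and sym: "\<And>a b. a < M \<Longrightarrow> b < M \<Longrightarrow> X a b = X b a"
    and X: "\<And>a b. a < M \<Longrightarrow> b < M \<Longrightarrow> X a b = (\<Sum>i\<in>I. f i a * g i b)"
  shows "low_rank M r (sqrt (frob2 M X)) X"
proof -
  obtain h where h: "bij_betw h {..<card I} I"
    using ex_bij_betw_nat_finite[OF I(1)] by (auto simp: atLeast0LessThan)
  show ?thesis
  proof (rule low_rank_factorization[OF sym])
    fix a b assume ab: "a < M" "b < M"
    have "X a b = (\<Sum>k<card I. f (h k) a * g (h k) b)"
      unfolding X[OF ab] by (rule sum.reindex_bij_betw[OF h, symmetric])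
    also have "\<dots> = (\<Sum>k<r. (if k < card I then f (h k) a else 0) * g (h k) b)"
      by (rule sum.mono_neutral_cong_left) (use I(2) in auto)
    finally show "X a b = (\<Sum>k<r. (if k < card I then f (h k) a else 0) * g (h k) b)" .
  qed
qed

text \<open>The part of a spectral decomposition carried by a set of indices: blocks of eigenvalues
  are cut out by changing \<open>S\<close> alone.\<close>

definition spec_sum :: "(nat \<Rightarrow> real) \<Rightarrow> (nat \<Rightarrow> nat \<Rightarrow> real) \<Rightarrow> nat set \<Rightarrow> nat \<Rightarrow> nat \<Rightarrow> real" where
  "spec_sum l p S a b = (\<Sum>i\<in>S. l i * p i a * p i b)"

lemma spec_sum_symmetric: "spec_sum l p S a b = spec_sum l p S b a"
  by (simp add: spec_sum_def mult.assoc mult.left_commute) (simp add: mult.commute)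

lemma spec_sum_Un:
  "finite S \<Longrightarrow> finite T \<Longrightarrow> S \<inter> T = {} \<Longrightarrow> spec_sum l p (S \<union> T) a b = spec_sum l p S a b + spec_sum l p T a b"
  unfolding spec_sum_def by (rule sum.union_disjoint)

lemma spec_sum_full:
  assumes "S \<subseteq> {..<M}"
  shows "spec_sum l p S a b = spec_sum (\<lambda>i. if i \<in> S then l i else 0) p {..<M} a b"
  unfolding spec_sum_def by (rule sum.mono_neutral_cong_left) (use assms in auto)

lemma frob_spec_sum_le:
  assumes p: "orthfam M M p" and S: "S \<subseteq> {..<M}"
  shows "sqrt (frob2 M (spec_sum l p S)) \<le> sqrt (\<Sum>i\<in>S. (l i)\<^sup>2)"
proof (rule real_sqrt_le_mono)
  let ?l = "\<lambda>i. if i \<in> S then l i else 0"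
  have "frob2 M (spec_sum l p S) = frob2 M (\<lambda>a b. \<Sum>i<M. (?l i * p i a) * p i b)"
    unfolding spec_sum_full[OF S, abs_def] by (simp add: spec_sum_def)
  also have "\<dots> \<le> (\<Sum>i<M. ip M (\<lambda>a. ?l i * p i a) (\<lambda>a. ?l i * p i a))" by (rule frob2_outer_le[OF p])
  also have "\<dots> = (\<Sum>i<M. (?l i)\<^sup>2 * ip M (p i) (p i))"
    by (simp only: ip_self power_mult_distrib sum_distrib_left)
  also have "\<dots> \<le> (\<Sum>i<M. (?l i)\<^sup>2)"
    by (intro sum_mono mult_left_le) (use orthfam_bound[OF p] in auto)
  also have "\<dots> = (\<Sum>i\<in>S. (l i)\<^sup>2)"
    by (rule sum.mono_neutral_cong_right) (use S in auto)
  finally show "frob2 M (spec_sum l p S) \<le> (\<Sum>i\<in>S. (l i)\<^sup>2)" .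
qed

lemma low_rank_spec_sum:
  assumes "finite S" "card S \<le> r"
  shows "low_rank M r (sqrt (frob2 M (spec_sum l p S))) (spec_sum l p S)"
  by (rule low_rank_sum[where f = "\<lambda>i a. l i * p i a" and g = p, OF assms])
    (use spec_sum_symmetric in \<open>simp_all add: spec_sum_def\<close>)

text \<open>\<open>t i\<close> is the share of the eigenvector \<open>p i\<close> in the span of the
  \<open>q k\<close>; these shares lie between 0 and 1 and add up to at most \<open>R\<close>. The
  squared distance is at least the sum of the \<open>(l i)\<^sup>2 * (1 - t i)\<close>, which is
  smallest when the whole budget \<open>R\<close> is spent on the \<open>R\<close> largest
  squares.\<close>

lemma Eckart_Young:
  assumes p: "\<And>i j. i < M \<Longrightarrow> j < M \<Longrightarrow> ip M (p i) (p j) = (if i = j then 1 else 0)"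
    and q: "orthfam M R q" and R: "R \<le> M"
    and top: "\<And>i j. i < R \<Longrightarrow> R \<le> j \<Longrightarrow> j < M \<Longrightarrow> (l j)\<^sup>2 \<le> (l i)\<^sup>2"
  shows "(\<Sum>i\<in>{R..<M}. (l i)\<^sup>2) \<le> frob2 M (\<lambda>a b. spec_sum l p {..<M} a b - spec_sum \<mu> q {..<R} a b)"
proof -
  let ?Z = "\<lambda>a b. spec_sum l p {..<M} a b - spec_sum \<mu> q {..<R} a b"
  have op: "orthfam M M p" using p by (auto simp: orthfam_def)
  define t where "t i = (\<Sum>k<R. (ip M (p i) (q k))\<^sup>2)" for i
  have t: "0 \<le> t i" "i < M \<Longrightarrow> t i \<le> 1" for i
    using Bessel[OF q, of "p i"] p[of i i] by (auto simp: t_def intro: sum_nonneg)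
  have sum_t: "(\<Sum>i<M. t i) \<le> R"
  proof -
    have "(\<Sum>i<M. t i) = (\<Sum>k<R. \<Sum>i<M. (ip M (q k) (p i))\<^sup>2)"
      unfolding t_def by (subst sum.swap) (simp add: ip_commute)
    also have "\<dots> \<le> (\<Sum>k<R. 1)"
      using order_trans[OF Bessel[OF op] orthfam_bound[OF q]] by (intro sum_mono) auto
    finally show ?thesis by simp
  qed
  have row: "ip M (?Z a) (p i) = l i * p i a - (\<Sum>k<R. (\<mu> k * ip M (q k) (p i)) * q k a)" if "i < M" for i a
  proof -
    have "ip M (?Z a) (p i) = ip M (\<lambda>b. \<Sum>j<M. (l j * p j a) * p j b) (p i) - ip M (\<lambda>b. \<Sum>k<R. (\<mu> k * q k a) * q k b) (p i)"
      by (simp add: ip_def spec_sum_def left_diff_distrib sum_subtractf)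
    also have "ip M (\<lambda>b. \<Sum>j<M. (l j * p j a) * p j b) (p i) = l i * p i a"
      using orthfam_ip_basis[OF op that, of "\<lambda>j. l j * p j a"] p[OF that that] by simp
    also have "ip M (\<lambda>b. \<Sum>k<R. (\<mu> k * q k a) * q k b) (p i) = (\<Sum>k<R. (\<mu> k * ip M (q k) (p i)) * q k a)"
      unfolding ip_sum_left by (intro sum.cong) auto
    finally show ?thesis .
  qed
  have "(\<Sum>i<M. (l i)\<^sup>2 * (1 - t i)) \<le> (\<Sum>i<M. \<Sum>a<M. (ip M (?Z a) (p i))\<^sup>2)"
  proof (rule sum_mono)
    fix i assume "i \<in> {..<M}"
    then have i: "i < M" by simp
    have "(l i)\<^sup>2 * (1 - t i) = ip M (\<lambda>a. l i * p i a) (\<lambda>a. l i * p i a) - (\<Sum>k<R. (ip M (\<lambda>a. l i * p i a) (q k))\<^sup>2)"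
    proof -
      have "ip M (\<lambda>a. l i * p i a) x = l i * ip M (p i) x" "ip M x (\<lambda>a. l i * p i a) = l i * ip M x (p i)" for x
        by (simp_all add: ip_def sum_distrib_left algebra_simps)
      then show ?thesis using p[OF i i]
        by (simp add: t_def power_mult_distrib right_diff_distrib sum_distrib_left) (simp add: power2_eq_square)
    qed
    also have "\<dots> \<le> ip M (\<lambda>a. l i * p i a - (\<Sum>k<R. (\<mu> k * ip M (q k) (p i)) * q k a)) (\<lambda>a. l i * p i a - (\<Sum>k<R. (\<mu> k * ip M (q k) (p i)) * q k a))"
      by (rule orthfam_ip_residual[OF q])
    also have "\<dots> = (\<Sum>a<M. (ip M (?Z a) (p i))\<^sup>2)" unfolding ip_self row[OF i] ..
    finally show "(l i)\<^sup>2 * (1 - t i) \<le> (\<Sum>a<M. (ip M (?Z a) (p i))\<^sup>2)" .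
  qed
  also have "\<dots> = (\<Sum>a<M. \<Sum>i<M. (ip M (?Z a) (p i))\<^sup>2)" by (rule sum.swap)
  also have "\<dots> \<le> (\<Sum>a<M. ip M (?Z a) (?Z a))" by (intro sum_mono Bessel[OF op])
  also have "\<dots> = frob2 M ?Z" by (simp add: frob2_def ip_self)
  finally have main: "(\<Sum>i<M. (l i)\<^sup>2 * (1 - t i)) \<le> frob2 M ?Z" .
  \<comment> \<open>A threshold between the first \<open>R\<close> squared eigenvalues and the
    others, 0 if there are no others. Moving budget across it proves that the top choice is
    optimal.\<close>
  obtain \<theta> where \<theta>: "0 \<le> \<theta>" "\<And>i. i < R \<Longrightarrow> \<theta> \<le> (l i)\<^sup>2" "\<And>j. R \<le> j \<Longrightarrow> j < M \<Longrightarrow> (l j)\<^sup>2 \<le> \<theta>"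
  proof (cases "R < M")
    case True
    let ?A = "(\<lambda>j. (l j)\<^sup>2) ` {R..<M}"
    have "Max ?A \<in> ?A" using True by (intro Max_in) auto
    then obtain j where j: "j \<in> {R..<M}" "Max ?A = (l j)\<^sup>2" by blast
    have "\<And>i. R \<le> i \<Longrightarrow> i < M \<Longrightarrow> (l i)\<^sup>2 \<le> Max ?A" by (intro Max_ge) auto
    then show ?thesis using j top by (intro that[of "(l j)\<^sup>2"]) auto
  next
    case False
    then show ?thesis by (intro that[of 0]) auto
  qed
  have split: "(\<Sum>i<M. f i) = (\<Sum>i<R. f i) + (\<Sum>i\<in>{R..<M}. f i)" for f :: "nat \<Rightarrow> real"
    using sum.atLeastLessThan_concat[OF le0 R, of f] by (simp add: atLeast0LessThan)
  have "(\<Sum>i\<in>{R..<M}. (l i)\<^sup>2 * t i) \<le> (\<Sum>i\<in>{R..<M}. \<theta> * t i)"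
    using \<theta> t by (intro sum_mono mult_right_mono) auto
  also have "\<dots> = \<theta> * (\<Sum>i\<in>{R..<M}. t i)" by (simp add: sum_distrib_left)
  also have "\<dots> \<le> \<theta> * (real R - (\<Sum>i<R. t i))"
    using sum_t split[of t] \<theta>(1) by (intro mult_left_mono) auto
  also have "\<dots> = (\<Sum>i<R. \<theta> * (1 - t i))" by (simp add: sum_distrib_left[symmetric] sum_subtractf)
  also have "\<dots> \<le> (\<Sum>i<R. (l i)\<^sup>2 * (1 - t i))"
    using \<theta> t R by (intro sum_mono mult_right_mono) auto
  finally have "(\<Sum>i\<in>{R..<M}. (l i)\<^sup>2 * t i) \<le> (\<Sum>i<R. (l i)\<^sup>2 * (1 - t i))" .
  moreover have "(\<Sum>i\<in>{R..<M}. (l i)\<^sup>2 * (1 - t i)) = (\<Sum>i\<in>{R..<M}. (l i)\<^sup>2) - (\<Sum>i\<in>{R..<M}. (l i)\<^sup>2 * t i)"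
    by (simp add: right_diff_distrib sum_subtractf)
  ultimately show ?thesis using main split[of "\<lambda>i. (l i)\<^sup>2 * (1 - t i)"] by linarith
qed

text \<open>Both matrices are tested on the vectors \<open>q k\<close>: the one built from
  \<open>q\<close> yields its trace, the other at most the sum of the \<open>l i\<close>, by Bessel.
  The difference is a sum of \<open>R\<close> numbers whose squares add up to at most the squared
  Frobenius norm, whence \<open>sqrt R\<close>.\<close>

lemma trace_excess_le:
  assumes p: "\<And>i j. i < M \<Longrightarrow> j < M \<Longrightarrow> ip M (p i) (p j) = (if i = j then 1 else 0)"
    and q: "orthfam M R q" and R: "R \<le> M" and l: "\<And>i. i < R \<Longrightarrow> 0 \<le> l i"
  shows "(\<Sum>a<M. spec_sum \<mu> q {..<R} a a) - (\<Sum>i<R. l i) \<le>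
    sqrt R * sqrt (frob2 M (\<lambda>a b. spec_sum l p {..<R} a b - spec_sum \<mu> q {..<R} a b))"
proof -
  let ?D = "\<lambda>a b. spec_sum l p {..<R} a b - spec_sum \<mu> q {..<R} a b"
  have quad: "bform M (spec_sum l p S) x x = (\<Sum>i\<in>S. l i * (ip M (p i) x)\<^sup>2)" for l p S x
  proof -
    have "ip M (spec_sum l p S a) x = (\<Sum>i\<in>S. (l i * ip M (p i) x) * p i a)" for a
      unfolding spec_sum_def by (subst ip_sum_left[of M "\<lambda>i. l i * p i a"]) (auto intro: sum.cong)
    then show ?thesis unfolding bform_def by (simp only: ip_sum_right) (simp add: ip_commute power2_eq_square mult.assoc)
  qed
  have "(\<Sum>a<M. spec_sum \<mu> q {..<R} a a) = (\<Sum>i<R. \<mu> i * ip M (q i) (q i))"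
    unfolding spec_sum_def by (subst sum.swap) (simp add: ip_def sum_distrib_left mult.assoc)
  also have "\<dots> = (\<Sum>k<R. bform M (spec_sum \<mu> q {..<R}) (q k) (q k))"
  proof (rule sum.cong[OF refl])
    fix k assume k: "k \<in> {..<R}"
    have "(\<Sum>i<R. \<mu> i * (ip M (q i) (q k))\<^sup>2) = (\<Sum>i\<in>{k}. \<mu> i * (ip M (q i) (q k))\<^sup>2)"
      by (rule sum.mono_neutral_right) (use k q in \<open>auto simp: orthfam_def\<close>)
    then show "\<mu> k * ip M (q k) (q k) = bform M (spec_sum \<mu> q {..<R}) (q k) (q k)"
      unfolding quad using k q by (auto simp: orthfam_def power2_eq_square)
  qed
  finally have tr: "(\<Sum>a<M. spec_sum \<mu> q {..<R} a a) = (\<Sum>k<R. bform M (spec_sum \<mu> q {..<R}) (q k) (q k))" .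
  have "(\<Sum>k<R. bform M (spec_sum l p {..<R}) (q k) (q k)) = (\<Sum>i<R. l i * (\<Sum>k<R. (ip M (p i) (q k))\<^sup>2))"
    unfolding quad sum_distrib_left by (rule sum.swap)
  also have "\<dots> \<le> (\<Sum>i<R. l i * 1)"
    using order_trans[OF Bessel[OF q]] p R l by (intro sum_mono mult_left_mono) auto
  finally have pp: "(\<Sum>k<R. bform M (spec_sum l p {..<R}) (q k) (q k)) \<le> (\<Sum>i<R. l i)" by simp
  have "(\<Sum>a<M. spec_sum \<mu> q {..<R} a a) - (\<Sum>i<R. l i) \<le>
      (\<Sum>k<R. bform M (spec_sum \<mu> q {..<R}) (q k) (q k)) - (\<Sum>k<R. bform M (spec_sum l p {..<R}) (q k) (q k))"
    using tr pp by simp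
  also have "\<dots> = (\<Sum>k<R. - bform M ?D (q k) (q k))"
    by (simp add: bform_def ip_def sum_subtractf left_diff_distrib right_diff_distrib)
  also have "\<dots> \<le> (\<Sum>k<R. \<bar>1\<bar> * \<bar>bform M ?D (q k) (q k)\<bar>)" by (intro sum_mono) auto
  also have "\<dots> \<le> L2_set (\<lambda>_. 1) {..<R} * L2_set (\<lambda>k. bform M ?D (q k) (q k)) {..<R}"
    by (rule L2_set_mult_ineq)
  also have "\<dots> \<le> sqrt R * sqrt (frob2 M ?D)"
  proof (intro mult_mono)
    have "(\<Sum>k<R. (bform M ?D (q k) (q k))\<^sup>2) \<le> (\<Sum>k<R. \<Sum>a<M. (ip M (?D a) (q k))\<^sup>2)"
    proof (rule sum_mono)
      fix k assume k: "k \<in> {..<R}"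
      have "(bform M ?D (q k) (q k))\<^sup>2 \<le> ip M (q k) (q k) * (\<Sum>a<M. (ip M (?D a) (q k))\<^sup>2)"
        unfolding bform_def ip_self[of M "\<lambda>a. ip M (?D a) (q k)", symmetric] by (rule ip_Cauchy_Schwarz)
      also have "\<dots> \<le> 1 * (\<Sum>a<M. (ip M (?D a) (q k))\<^sup>2)"
        using orthfam_bound[OF q] k by (intro mult_right_mono sum_nonneg) auto
      finally show "(bform M ?D (q k) (q k))\<^sup>2 \<le> (\<Sum>a<M. (ip M (?D a) (q k))\<^sup>2)" by simp
    qed
    also have "\<dots> = (\<Sum>a<M. \<Sum>k<R. (ip M (?D a) (q k))\<^sup>2)" by (rule sum.swap)
    also have "\<dots> \<le> (\<Sum>a<M. ip M (?D a) (?D a))" by (intro sum_mono Bessel[OF q])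
    also have "\<dots> = frob2 M ?D" by (simp add: frob2_def ip_self)
    finally show "L2_set (\<lambda>k. bform M ?D (q k) (q k)) {..<R} \<le> sqrt (frob2 M ?D)"
      unfolding L2_set_def by (rule real_sqrt_le_mono)
  qed (auto simp: L2_set_def sum_nonneg)
  finally show ?thesis .
qed

lemma sens_sum_le: "finite I \<Longrightarrow> sens n M (\<lambda>a b. \<Sum>i\<in>I. X i a b) w \<le> (\<Sum>i\<in>I. sens n M (X i) w)"
proof (induction I rule: finite_induct)
  case empty
  then show ?case by (simp add: sens_def bform_def ip_def)
next
  case (insert i I)
  then show ?case using sens_triangle[of n M "X i" "\<lambda>a b. \<Sum>i\<in>I. X i a b" w] by simp
qed

lemma frob_sum_le: "finite I \<Longrightarrow> sqrt (frob2 M (\<lambda>a b. \<Sum>i\<in>I. X i a b)) \<le> (\<Sum>i\<in>I. sqrt (frob2 M (X i)))"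
proof (induction I rule: finite_induct)
  case empty
  then show ?case by (simp add: frob2_def)
next
  case (insert i I)
  then show ?case using frob_triangle[of M "X i" "\<lambda>a b. \<Sum>i\<in>I. X i a b"] by simp
qed

text \<open>The cone condition is stated relative to the low-rank part \<open>D\<close> that consists of the \<open>R\<close> leading
  eigenvectors of the minimiser and of the first block, so that no projection onto a tangent space is needed.
  The block length is \<open>589824 R = 768\<^sup>2 R\<close>: the remaining blocks then contribute at most
  \<open>8 / 384\<close>, which is half of the lower bound \<open>1 / 24\<close>.\<close>

lemma trace_minimizer_error:
  assumes p: "\<And>i j. i < M \<Longrightarrow> j < M \<Longrightarrow> ip M (p i) (p j) = (if i = j then 1 else 0)"
    and q: "orthfam M R q" and R: "1 \<le> R" "R \<le> M" and l: "\<And>i. i < M \<Longrightarrow> 0 \<le> l i"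
    and top: "\<And>i j. i < R \<Longrightarrow> R \<le> j \<Longrightarrow> j < M \<Longrightarrow> l j \<le> l i"
    and trace: "(\<Sum>i<M. l i) \<le> (\<Sum>a<M. spec_sum \<mu> q {..<R} a a)"
    and n: "0 < n"
    and sens: "\<And>X c. low_rank M (589826 * R) c X \<Longrightarrow>
      sens n M X w \<le> 8 * real n * sqrt (frob2 M X) \<and> real n * sqrt (frob2 M X) / 24 \<le> sens n M X w"
  defines "H \<equiv> (\<lambda>a b. spec_sum l p {..<M} a b - spec_sum \<mu> q {..<R} a b)"
  shows "real n * sqrt (frob2 M H) \<le> 96 * sens n M H w"
proof -
  have op: "orthfam M M p" using p by (auto simp: orthfam_def)
  let ?s = "589824 * R"
  have "\<exists>T \<T>. T \<subseteq> {R..<M} \<and> card T \<le> ?s \<and> finite \<T> \<and> \<Union>\<T> = {R..<M} - T \<and> disjoint \<T> \<and>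
    (\<forall>B\<in>\<T>. card B \<le> ?s) \<and> (\<Sum>B\<in>\<T>. sqrt (\<Sum>i\<in>B. (l i)\<^sup>2)) \<le> (\<Sum>i\<in>{R..<M}. l i) / sqrt (real ?s)"
    by (rule block_decomposition) (use l R in auto)
  then obtain T \<T> where T: "T \<subseteq> {R..<M}" "card T \<le> ?s" and \<T>: "finite \<T>" "\<Union>\<T> = {R..<M} - T" "disjoint \<T>"
    "\<forall>B\<in>\<T>. card B \<le> ?s" and blocks: "(\<Sum>B\<in>\<T>. sqrt (\<Sum>i\<in>B. (l i)\<^sup>2)) \<le> (\<Sum>i\<in>{R..<M}. l i) / sqrt (real ?s)"
    by (elim exE conjE) (rule that)
  have fT: "finite T" using T(1) finite_subset by blast
  have B: "B \<subseteq> {..<M}" "finite B" if "B \<in> \<T>" for B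
  proof -
    have "B \<subseteq> {R..<M} - T" using \<T>(2) that by blast
    then show "B \<subseteq> {..<M}" by auto
    then show "finite B" using finite_subset by blast
  qed
  define D where "D = (\<lambda>a b. spec_sum l p ({..<R} \<union> T) a b - spec_sum \<mu> q {..<R} a b)"
  define D0 where "D0 = (\<lambda>a b. spec_sum l p {..<R} a b - spec_sum \<mu> q {..<R} a b)"
  define d where "d = sqrt (frob2 M D)"
  have d: "0 \<le> d" by (simp add: d_def)
  \<comment> \<open>In the minimiser cut off after \<open>T\<close>, the block \<open>T\<close> is
    the spectrum beyond rank \<open>R\<close>; by Eckart-Young no matrix of rank \<open>R\<close> is
    closer to it than the norm of this block.\<close>
  have T_le: "sqrt (\<Sum>i\<in>T. (l i)\<^sup>2) \<le> d"
  proof -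
    let ?l = "\<lambda>i. if i \<in> {..<R} \<union> T then l i else 0"
    have sub: "{..<R} \<union> T \<subseteq> {..<M}" using T(1) R by auto
    have "(\<Sum>i\<in>T. (l i)\<^sup>2) \<le> (\<Sum>i\<in>{R..<M}. (?l i)\<^sup>2)"
      by (rule order_trans[OF eq_refl sum_mono2[OF _ T(1)]]) (auto intro: sum.cong)
    also have "\<dots> \<le> frob2 M (\<lambda>a b. spec_sum ?l p {..<M} a b - spec_sum \<mu> q {..<R} a b)"
      by (rule Eckart_Young[OF p q R(2)]) (use top l R in \<open>auto intro!: power_mono\<close>)
    also have "\<dots> = frob2 M D" unfolding D_def spec_sum_full[OF sub] ..
    finally show ?thesis unfolding d_def by (rule real_sqrt_le_mono)
  qed
  have D0_le: "sqrt (frob2 M D0) \<le> 2 * d"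
  proof -
    have D0: "D0 = (\<lambda>a b. D a b + - 1 * spec_sum l p T a b)"
      unfolding D_def D0_def using T(1) fT by (subst spec_sum_Un) auto
    have "sqrt (frob2 M D0) \<le> d + sqrt (frob2 M (\<lambda>a b. - 1 * spec_sum l p T a b))"
      unfolding D0 d_def by (rule frob_triangle)
    also have "frob2 M (\<lambda>a b. - 1 * spec_sum l p T a b) = frob2 M (spec_sum l p T)"
      by (subst frob2_scale) simp
    also have "sqrt (frob2 M (spec_sum l p T)) \<le> d"
      by (rule order_trans[OF frob_spec_sum_le[OF op] T_le]) (use T(1) in auto)
    finally show ?thesis by simp
  qed
  \<comment> \<open>Minimality of the trace enters here: the eigenvalues beyond \<open>R\<close>
    have at most the mass by which the first \<open>R\<close> fall short of the true trace.\<close>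
  have "(\<Sum>i\<in>{R..<M}. l i) = (\<Sum>i<M. l i) - (\<Sum>i<R. l i)"
    using sum.atLeastLessThan_concat[OF le0 R(2), of l] by (simp add: atLeast0LessThan)
  also have "\<dots> \<le> sqrt R * sqrt (frob2 M D0)"
    using trace trace_excess_le[OF p q R(2), of l \<mu>] l R unfolding D0_def by simp
  also have "\<dots> \<le> sqrt R * (2 * d)" by (intro mult_left_mono D0_le) simp
  finally have rest: "(\<Sum>i\<in>{R..<M}. l i) \<le> sqrt R * (2 * d)" .
  have tail: "(\<Sum>B\<in>\<T>. sqrt (\<Sum>i\<in>B. (l i)\<^sup>2)) \<le> d / 384"
  proof -
    have "sqrt 589824 = (768 :: real)" by (rule real_sqrt_unique) auto
    then have s: "sqrt (real ?s) = 768 * sqrt R" by (simp add: real_sqrt_mult)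
    have "(\<Sum>B\<in>\<T>. sqrt (\<Sum>i\<in>B. (l i)\<^sup>2)) \<le> sqrt R * (2 * d) / sqrt (real ?s)"
      by (rule order_trans[OF blocks divide_right_mono[OF rest]]) simp
    also have "\<dots> = d / 384" unfolding s using R(1) by simp
    finally show ?thesis .
  qed
  define Y where "Y = (\<lambda>a b. \<Sum>B\<in>\<T>. spec_sum l p B a b)"
  have H: "H = (\<lambda>a b. D a b + Y a b)"
  proof (intro ext)
    fix a b
    have "{..<M} = ({..<R} \<union> T) \<union> \<Union>\<T>" using \<T>(2) T(1) R(2) by auto
    then have "spec_sum l p {..<M} a b = spec_sum l p ({..<R} \<union> T) a b + spec_sum l p (\<Union>\<T>) a b"
      using \<T>(2) fT by (simp only:) (rule spec_sum_Un, auto)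
    also have "spec_sum l p (\<Union>\<T>) a b = Y a b"
      unfolding spec_sum_def Y_def using B(2) \<T>(3) by (subst sum.Union_disjoint) (auto simp: pairwise_def disjnt_def)
    finally show "H a b = D a b + Y a b" by (simp add: H_def D_def)
  qed
  have frob_B: "sqrt (frob2 M (spec_sum l p B)) \<le> sqrt (\<Sum>i\<in>B. (l i)\<^sup>2)" if "B \<in> \<T>" for B
    by (rule frob_spec_sum_le[OF op B(1)[OF that]])
  have "sens n M Y w \<le> (\<Sum>B\<in>\<T>. sens n M (spec_sum l p B) w)"
    unfolding Y_def by (rule sens_sum_le[OF \<T>(1)])
  also have "\<dots> \<le> (\<Sum>B\<in>\<T>. 8 * real n * sqrt (\<Sum>i\<in>B. (l i)\<^sup>2))"
  proof (rule sum_mono)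
    fix B' assume B': "B' \<in> \<T>"
    have "card B' \<le> 589826 * R" using \<T>(4) B' by fastforce
    then have "sens n M (spec_sum l p B') w \<le> 8 * real n * sqrt (frob2 M (spec_sum l p B'))"
      using sens[OF low_rank_spec_sum[OF B(2)[OF B']]] by blast
    also have "\<dots> \<le> 8 * real n * sqrt (\<Sum>i\<in>B'. (l i)\<^sup>2)" by (intro mult_left_mono frob_B B') simp
    finally show "sens n M (spec_sum l p B') w \<le> 8 * real n * sqrt (\<Sum>i\<in>B'. (l i)\<^sup>2)" .
  qed
  also have "\<dots> \<le> 8 * real n * (d / 384)"
    unfolding sum_distrib_left[symmetric] by (intro mult_left_mono tail) simp
  finally have sens_Y: "sens n M Y w \<le> real n * d / 48" by (simp add: mult.commute)
  \<comment> \<open>Rank \<open>R\<close> from the leading eigenvectors, \<open>589824 * R\<close>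
    from \<open>T\<close>, and \<open>R\<close> from the matrix to be recovered.\<close>
  have "low_rank M (589826 * R) (sqrt (frob2 M D)) D"
  proof (rule low_rank_sum[where I = "({..<R} \<union> T) <+> {..<R}"
        and f = "case_sum (\<lambda>i a. l i * p i a) (\<lambda>k a. - \<mu> k * q k a)" and g = "case_sum p q"])
    show "finite (({..<R} \<union> T) <+> {..<R})" using fT by simp
    have "card ({..<R} \<union> T) \<le> R + ?s" using card_Un_le[of "{..<R}" T] T(2) by simp
    then show "card (({..<R} \<union> T) <+> {..<R}) \<le> 589826 * R" using fT by (simp add: card_Plus)
    show "D a b = D b a" for a b unfolding D_def by (simp only: spec_sum_symmetric[of _ _ _ a b])
    show "D a b = (\<Sum>i\<in>({..<R} \<union> T) <+> {..<R}. case_sum (\<lambda>i a. l i * p i a) (\<lambda>k a. - \<mu> k * q k a) i a * case_sum p q i b)" for a b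
      using fT by (simp add: sum.Plus D_def spec_sum_def sum_negf)
  qed
  from sens[OF this] have "real n * d / 24 \<le> sens n M D w" by (simp add: d_def)
  then have "real n * d / 24 - real n * d / 48 \<le> sens n M H w"
    using sens_triangle_lower[of n M D w Y] sens_Y unfolding H by linarith
  then have nd: "real n * d \<le> 48 * sens n M H w" by (simp add: mult.commute)
  have "sqrt (frob2 M H) \<le> d + sqrt (frob2 M Y)" unfolding H d_def by (rule frob_triangle)
  also have "sqrt (frob2 M Y) \<le> (\<Sum>B\<in>\<T>. sqrt (frob2 M (spec_sum l p B)))"
    unfolding Y_def by (rule frob_sum_le[OF \<T>(1)])
  also have "\<dots> \<le> d / 384" by (rule order_trans[OF sum_mono[OF frob_B] tail])
  finally have "sqrt (frob2 M H) \<le> 2 * d" using d by simp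
  then have "real n * sqrt (frob2 M H) \<le> real n * (2 * d)" by (rule mult_left_mono) simp
  then show ?thesis using nd by simp
qed

section \<open>Frobenius norms\<close>

text \<open>The bridge from matrices to functions: \<open>rowf A\<close> stands for the whole
  matrix, \<open>rowf A i\<close> for one of its rows.\<close>

definition rowf :: "real mat \<Rightarrow> nat \<Rightarrow> nat \<Rightarrow> real" where
  "rowf A i j = A $$ (i, j)"

definition colf :: "real mat \<Rightarrow> nat \<Rightarrow> nat \<Rightarrow> real" where
  "colf A j i = A $$ (i, j)"

lemma mult_entry:
  assumes "A \<in> carrier_mat m n" "B \<in> carrier_mat n r" "i < m" "j < r"
  shows "(A * B) $$ (i, j) = ip n (rowf A i) (colf B j)"
  using assms by (simp add: scalar_prod_def ip_def rowf_def colf_def atLeast0LessThan)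

lemma frobenius_norm_rows:
  assumes "A \<in> carrier_mat m n"
  shows "frobenius_norm A = sqrt (\<Sum>i<m. ip n (rowf A i) (rowf A i))"
  using assms by (simp add: frobenius_norm_def ip_self rowf_def)

lemma frobenius_norm_frob2:
  assumes "A \<in> carrier_mat n n"
  shows "frobenius_norm A = sqrt (frob2 n (rowf A))"
  using assms by (simp add: frobenius_norm_def frob2_def rowf_def)

lemma frobenius_norm_nonneg [simp]: "0 \<le> frobenius_norm A"
  by (auto simp: frobenius_norm_def intro!: sum_nonneg)

lemma frobenius_norm_transpose: "frobenius_norm (transpose_mat A) = frobenius_norm A"
proof -
  have "(\<Sum>i<dim_col A. \<Sum>j<dim_row A. (transpose_mat A $$ (i, j))\<^sup>2) = (\<Sum>i<dim_col A. \<Sum>j<dim_row A. (A $$ (j, i))\<^sup>2)"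
    by (intro sum.cong refl) auto
  also have "\<dots> = (\<Sum>j<dim_row A. \<Sum>i<dim_col A. (A $$ (j, i))\<^sup>2)" by (rule sum.swap)
  finally show ?thesis by (simp add: frobenius_norm_def)
qed

lemma frobenius_norm_L2_set:
  assumes "A \<in> carrier_mat m n"
  shows "frobenius_norm A = L2_set (\<lambda>p. A $$ p) ({..<m} \<times> {..<n})"
  using assms by (simp add: frobenius_norm_def L2_set_def sum.cartesian_product split_def)

lemma frobenius_norm_triangle:
  assumes "A \<in> carrier_mat m n" "B \<in> carrier_mat m n"
  shows "frobenius_norm (A + B) \<le> frobenius_norm A + frobenius_norm B"
proof -
  have "A + B \<in> carrier_mat m n" using assms by simp
  then have "frobenius_norm (A + B) = L2_set (\<lambda>p. (A + B) $$ p) ({..<m} \<times> {..<n})" by (rule frobenius_norm_L2_set)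
  also have "\<dots> = L2_set (\<lambda>p. A $$ p + B $$ p) ({..<m} \<times> {..<n})"
    by (rule L2_set_cong) (use assms in auto)
  also have "\<dots> \<le> L2_set (\<lambda>p. A $$ p) ({..<m} \<times> {..<n}) + L2_set (\<lambda>p. B $$ p) ({..<m} \<times> {..<n})"
    by (rule L2_set_triangle_ineq)
  finally show ?thesis using assms by (simp add: frobenius_norm_L2_set)
qed

lemma frobenius_norm_minus_commute:
  assumes "A \<in> carrier_mat m n" "B \<in> carrier_mat m n"
  shows "frobenius_norm (A - B) = frobenius_norm (B - A)"
proof -
  have "(\<Sum>i<m. \<Sum>j<n. ((A - B) $$ (i, j))\<^sup>2) = (\<Sum>i<m. \<Sum>j<n. ((B - A) $$ (i, j))\<^sup>2)"
    using assms by (intro sum.cong refl) (auto simp: power2_commute)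
  then show ?thesis using assms by (simp add: frobenius_norm_def)
qed

lemma frobenius_norm_triangle_diff:
  assumes "A \<in> carrier_mat m n" "B \<in> carrier_mat m n" "C \<in> carrier_mat m n"
  shows "frobenius_norm (A - C) \<le> frobenius_norm (A - B) + frobenius_norm (B - C)"
proof -
  have "A - C = (A - B) + (B - C)" by (rule eq_matI) (use assms in auto)
  then show ?thesis
    using frobenius_norm_triangle[OF minus_carrier_mat[OF assms(2)] minus_carrier_mat[OF assms(3)]] by simp
qed

definition isometry :: "nat \<Rightarrow> nat \<Rightarrow> real mat \<Rightarrow> bool" where
  "isometry n r U \<longleftrightarrow> U \<in> carrier_mat n r \<and> transpose_mat U * U = 1\<^sub>m r"

lemma isometry_carrier: "isometry n r U \<Longrightarrow> U \<in> carrier_mat n r"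
  by (simp add: isometry_def)

lemma isometry_ip:
  assumes "isometry n r U" "i < r" "j < r"
  shows "ip n (colf U i) (colf U j) = (if i = j then 1 else 0)"
proof -
  have U: "U \<in> carrier_mat n r" using assms by (simp add: isometry_def)
  have "(transpose_mat U * U) $$ (i, j) = ip n (rowf (transpose_mat U) i) (colf U j)"
    by (rule mult_entry) (use U assms in auto)
  also have "rowf (transpose_mat U) i a = colf U i a" if "a < n" for a
    using U assms that by (simp add: rowf_def colf_def)
  then have "ip n (rowf (transpose_mat U) i) (colf U j) = ip n (colf U i) (colf U j)" by (simp add: ip_def)
  finally show ?thesis using assms by (simp add: isometry_def)
qed

lemma isometry_orthfam: "isometry n r U \<Longrightarrow> orthfam n r (colf U)"
  by (simp add: orthfam_def isometry_ip)

lemma frobenius_norm_mult_isometry_le: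
  assumes A: "A \<in> carrier_mat m n" and U: "isometry n r U"
  shows "frobenius_norm (A * U) \<le> frobenius_norm A"
proof -
  have AU: "A * U \<in> carrier_mat m r" using A isometry_carrier[OF U] by simp
  have "(\<Sum>i<m. ip r (rowf (A * U) i) (rowf (A * U) i)) \<le> (\<Sum>i<m. ip n (rowf A i) (rowf A i))"
  proof (rule sum_mono)
    fix i assume i: "i \<in> {..<m}"
    have "ip r (rowf (A * U) i) (rowf (A * U) i) = (\<Sum>j<r. (ip n (rowf A i) (colf U j))\<^sup>2)"
      unfolding ip_self using i mult_entry[OF A isometry_carrier[OF U]] by (simp add: rowf_def[of "A * U"])
    then show "ip r (rowf (A * U) i) (rowf (A * U) i) \<le> ip n (rowf A i) (rowf A i)"
      using Bessel[OF isometry_orthfam[OF U]] by simp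
  qed
  then show ?thesis by (simp add: frobenius_norm_rows[OF A] frobenius_norm_rows[OF AU])
qed

lemma frobenius_norm_mult_isometry_transpose_le:
  assumes A: "A \<in> carrier_mat m r" and U: "isometry n r U"
  shows "frobenius_norm (A * transpose_mat U) \<le> frobenius_norm A"
proof -
  note Uc = isometry_carrier[OF U]
  have AU: "A * transpose_mat U \<in> carrier_mat m n" using A Uc by simp
  have "(\<Sum>i<m. ip n (rowf (A * transpose_mat U) i) (rowf (A * transpose_mat U) i)) \<le> (\<Sum>i<m. ip r (rowf A i) (rowf A i))"
  proof (rule sum_mono)
    fix i assume i: "i \<in> {..<m}"
    have row: "rowf (A * transpose_mat U) i j = (\<Sum>k<r. rowf A i k * colf U k j)" if "j < n" for j
    proof -
      have "(A * transpose_mat U) $$ (i, j) = ip r (rowf A i) (colf (transpose_mat U) j)"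
        by (rule mult_entry) (use A Uc i that in auto)
      then show ?thesis using Uc that by (simp add: rowf_def[of "A * _"] ip_def colf_def)
    qed
    then have "ip n (rowf (A * transpose_mat U) i) (rowf (A * transpose_mat U) i) =
      ip n (\<lambda>j. \<Sum>k<r. rowf A i k * colf U k j) (\<lambda>j. \<Sum>k<r. rowf A i k * colf U k j)" by (simp add: ip_def)
    also have "\<dots> \<le> (\<Sum>k<r. (rowf A i k)\<^sup>2)" by (rule orthfam_combination_le[OF isometry_orthfam[OF U]])
    finally show "ip n (rowf (A * transpose_mat U) i) (rowf (A * transpose_mat U) i) \<le> ip r (rowf A i) (rowf A i)"
      by (simp add: ip_self)
  qed
  then show ?thesis by (simp add: frobenius_norm_rows[OF A] frobenius_norm_rows[OF AU])
qed

text \<open>Row by row, this is the projection onto the orthogonal complement of the column span of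
  \<open>U\<close>, which does not lengthen vectors.\<close>

lemma frobenius_norm_residual_le:
  assumes A: "A \<in> carrier_mat m n" and U: "isometry n r U"
  shows "frobenius_norm (A - A * U * transpose_mat U) \<le> frobenius_norm A"
proof -
  note Uc = isometry_carrier[OF U]
  let ?R = "A - A * U * transpose_mat U"
  have "A * U * transpose_mat U \<in> carrier_mat m n" using mult_carrier_mat[OF mult_carrier_mat[OF A Uc]] Uc by simp
  then have R: "?R \<in> carrier_mat m n" by (rule minus_carrier_mat)
  have "(\<Sum>i<m. ip n (rowf ?R i) (rowf ?R i)) \<le> (\<Sum>i<m. ip n (rowf A i) (rowf A i))"
  proof (rule sum_mono)
    fix i assume i: "i \<in> {..<m}"
    let ?c = "\<lambda>k. ip n (rowf A i) (colf U k)"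
    have row: "rowf ?R i j = rowf A i j - (\<Sum>k<r. ?c k * colf U k j)" if "j < n" for j
    proof -
      have "(A * U * transpose_mat U) $$ (i, j) = ip r (rowf (A * U) i) (colf (transpose_mat U) j)"
        by (rule mult_entry) (use A Uc i that in auto)
      also have "\<dots> = (\<Sum>k<r. ?c k * colf U k j)"
        unfolding ip_def[of r] using Uc i that mult_entry[OF A Uc]
        by (intro sum.cong refl) (simp add: rowf_def[of "A * U"] colf_def[of "transpose_mat U"] colf_def[of U])
      finally show ?thesis using A Uc i that by (simp add: rowf_def)
    qed
    have "ip n (rowf ?R i) (rowf ?R i) = ip n (\<lambda>j. rowf A i j - (\<Sum>k<r. ?c k * colf U k j)) (\<lambda>j. rowf A i j - (\<Sum>k<r. ?c k * colf U k j))"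
      using row by (simp add: ip_def)
    also have "\<dots> = ip n (rowf A i) (rowf A i) - (\<Sum>k<r. (?c k)\<^sup>2)"
      by (rule orthfam_ip_residual_eq[OF isometry_orthfam[OF U]])
    finally show "ip n (rowf ?R i) (rowf ?R i) \<le> ip n (rowf A i) (rowf A i)"
      using sum_nonneg[of "{..<r}" "\<lambda>k. (?c k)\<^sup>2"] by simp
  qed
  then show ?thesis by (simp add: frobenius_norm_rows[OF A] frobenius_norm_rows[OF R])
qed

lemma isometry_first_cols:
  assumes P: "orthogonal_matrix_n n P" and r: "r \<le> n"
  shows "isometry n r (first_cols r P)"
proof -
  have Pc: "P \<in> carrier_mat n n" and P1: "isometry n n P" using P by (auto simp: orthogonal_matrix_n_def isometry_def)
  have c: "first_cols r P \<in> carrier_mat n r" using Pc by (simp add: first_cols_def)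
  have "transpose_mat (first_cols r P) * first_cols r P = 1\<^sub>m r"
  proof (rule eq_matI)
    fix i j assume ij: "i < dim_row (1\<^sub>m r)" "j < dim_col (1\<^sub>m r)"
    have "(transpose_mat (first_cols r P) * first_cols r P) $$ (i, j) =
        ip n (rowf (transpose_mat (first_cols r P)) i) (colf (first_cols r P) j)"
      by (rule mult_entry) (use c ij in auto)
    also have "\<dots> = ip n (colf P i) (colf P j)"
      unfolding ip_def using Pc c ij by (intro sum.cong refl) (auto simp: rowf_def colf_def first_cols_def)
    also have "\<dots> = (if i = j then 1 else 0)" using isometry_ip[OF P1, of i j] ij r by simp
    finally show "(transpose_mat (first_cols r P) * first_cols r P) $$ (i, j) = 1\<^sub>m r $$ (i, j)" using ij by simp
  qed (use c in auto)
  then show ?thesis using c by (simp add: isometry_def)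
qed

section \<open>Sparse estimation\<close>

lemma rip_imp_rip_fun:
  assumes rip: "rip K N \<Psi> \<delta>" and \<Psi>: "\<Psi> \<in> carrier_mat M N"
  shows "rip_fun K M N (rowf \<Psi>) \<delta>"
  unfolding rip_fun_def
proof (intro allI impI)
  fix x z :: "nat \<Rightarrow> real"
  assume x: "card {n. n < N \<and> x n \<noteq> 0} \<le> K" and z: "card {n. n < N \<and> z n \<noteq> 0} \<le> K"
  let ?x = "Matrix.vec N x" and ?z = "Matrix.vec N z"
  have sp: "sparse_vec K ?x" "sparse_vec K ?z"
    using x z by (simp_all add: sparse_vec_def cong: conj_cong)
  have n: "(l2_norm v)\<^sup>2 = scalar_prod v v" for v :: "real Matrix.vec"
    by (simp add: l2_norm_def scalar_prod_def sum_nonneg)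
  have 1: "(l2_norm (?x - ?z))\<^sup>2 = ip N (\<lambda>n. x n - z n) (\<lambda>n. x n - z n)"
    unfolding n by (simp add: scalar_prod_def ip_def atLeast0LessThan)
  have 2: "(l2_norm (\<Psi> *\<^sub>v (?x - ?z)))\<^sup>2 = (\<Sum>a<M. (ip N (rowf \<Psi> a) (\<lambda>n. x n - z n))\<^sup>2)"
    unfolding n using \<Psi>
    by (simp add: scalar_prod_def ip_def rowf_def atLeast0LessThan power2_eq_square)
  show "(1 - \<delta>) * ip N (\<lambda>n. x n - z n) (\<lambda>n. x n - z n) \<le> (\<Sum>a<M. (ip N (rowf \<Psi> a) (\<lambda>n. x n - z n))\<^sup>2) \<and>
     (\<Sum>a<M. (ip N (rowf \<Psi> a) (\<lambda>n. x n - z n))\<^sup>2) \<le> (1 + \<delta>) * ip N (\<lambda>n. x n - z n) (\<lambda>n. x n - z n)"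
    using rip sp unfolding rip_def 1[symmetric] 2[symmetric] by auto
qed

lemma frobenius_norm_mult_cols:
  assumes \<Psi>: "\<Psi> \<in> carrier_mat M N" and Z: "Z \<in> carrier_mat N R"
  shows "frobenius_norm (\<Psi> * Z) = sqrt (\<Sum>c<R. \<Sum>a<M. (ip N (rowf \<Psi> a) (colf Z c))\<^sup>2)"
proof -
  have "(\<Sum>a<M. \<Sum>c<R. ((\<Psi> * Z) $$ (a, c))\<^sup>2) = (\<Sum>a<M. \<Sum>c<R. (ip N (rowf \<Psi> a) (colf Z c))\<^sup>2)"
    by (intro sum.cong refl) (simp add: mult_entry[OF \<Psi> Z])
  also have "\<dots> = (\<Sum>c<R. \<Sum>a<M. (ip N (rowf \<Psi> a) (colf Z c))\<^sup>2)" by (rule sum.swap)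
  finally show ?thesis using \<Psi> Z by (simp add: frobenius_norm_def)
qed

text \<open>Transfers a bound on \<open>\<Psi> * Z\<close> back to \<open>Z\<close>: every column is
  sparse, with support in the common set \<open>T\<close>. The factor 53 / 50 is a rational upper
  bound for the square root of 10 / 9.\<close>

lemma row_sparse_frobenius_norm_le:
  assumes rip: "rip_fun K M N (rowf \<Psi>) \<delta>" and \<delta>: "\<delta> \<le> 1 / 10" and \<Psi>: "\<Psi> \<in> carrier_mat M N" and Z: "Z \<in> carrier_mat N R"
    and T: "T \<subseteq> {..<N}" "card T \<le> K" and supp: "\<And>n c. n < N \<Longrightarrow> n \<notin> T \<Longrightarrow> c < R \<Longrightarrow> Z $$ (n, c) = 0"
  shows "frobenius_norm Z \<le> 53 / 50 * frobenius_norm (\<Psi> * Z)"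
proof -
  let ?S = "\<Sum>c<R. \<Sum>a<M. (ip N (rowf \<Psi> a) (colf Z c))\<^sup>2"
  let ?Z = "\<Sum>c<R. ip N (colf Z c) (colf Z c)"
  have "finite T" using T finite_subset by blast
  have "9 / 10 * ?Z \<le> ?S"
    unfolding sum_distrib_left
  proof (rule sum_mono)
    fix c assume c: "c \<in> {..<R}"
    have "{n. n < N \<and> colf Z c n \<noteq> 0} \<subseteq> T" using supp c by (auto simp: colf_def)
    then have "card {n. n < N \<and> colf Z c n \<noteq> 0} \<le> K" using card_mono[OF \<open>finite T\<close>] T(2) by (meson order_trans)
    from rip_funD(1)[OF rip this, of "\<lambda>_. 0"]
    have "(1 - \<delta>) * ip N (colf Z c) (colf Z c) \<le> (\<Sum>a<M. (ip N (rowf \<Psi> a) (colf Z c))\<^sup>2)" by simp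
    moreover have "9 / 10 * ip N (colf Z c) (colf Z c) \<le> (1 - \<delta>) * ip N (colf Z c) (colf Z c)"
      using \<delta> by (intro mult_right_mono) auto
    ultimately show "9 / 10 * ip N (colf Z c) (colf Z c) \<le> (\<Sum>a<M. (ip N (rowf \<Psi> a) (colf Z c))\<^sup>2)" by linarith
  qed
  moreover have "0 \<le> ?S" by (auto intro!: sum_nonneg)
  ultimately have "?Z \<le> (53 / 50)\<^sup>2 * ?S" by (simp add: power2_eq_square)
  then have "sqrt ?Z \<le> sqrt ((53 / 50)\<^sup>2 * ?S)" by (rule real_sqrt_le_mono)
  moreover have "frobenius_norm Z = sqrt ?Z"
  proof -
    have "(\<Sum>n<N. \<Sum>c<R. (Z $$ (n, c))\<^sup>2) = ?Z"
      unfolding ip_self colf_def by (rule sum.swap)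
    then show ?thesis using Z by (simp add: frobenius_norm_def)
  qed
  ultimately show ?thesis
    unfolding frobenius_norm_mult_cols[OF \<Psi> Z] by (simp add: real_sqrt_mult)
qed

lemma norm_1_2_alt:
  assumes "Q \<in> carrier_mat N R"
  shows "norm_1_2 Q = (\<Sum>n<N. sqrt (\<Sum>c<R. (Q $$ (n, c))\<^sup>2))"
  using assms
  by (simp add: norm_1_2_def l2_norm_def scalar_prod_def atLeast0LessThan power2_eq_square)

text \<open>The comparison matrix \<open>Q'\<close> only has to be feasible and supported on
  \<open>K\<close> rows. Minimality of \<open>Q\<close> gives the cone condition for the difference,
  the images of two feasible matrices are at distance at most \<open>2 * \<tau>\<close>, and the
  recovery factor 3 makes this 6.\<close>

lemma sparse_program_error:
  assumes \<Psi>: "\<Psi> \<in> carrier_mat M N" and rip: "rip_fun K M N (rowf \<Psi>) \<delta>" and \<delta>: "0 \<le> \<delta>" "\<delta> \<le> 1 / 10" and K: "1 \<le> K"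
    and A: "A \<in> carrier_mat M R" and Q: "sparse_program N R \<Psi> A \<tau> Q"
    and Q': "Q' \<in> carrier_mat N R" "frobenius_norm (\<Psi> * Q' - A) \<le> \<tau>"
    and T: "T \<subseteq> {..<N}" "card T \<le> K" and supp: "\<And>n c. n < N \<Longrightarrow> n \<notin> T \<Longrightarrow> c < R \<Longrightarrow> Q' $$ (n, c) = 0"
  shows "Q \<in> carrier_mat N R" "frobenius_norm (Q - Q') \<le> 6 * \<tau>"
proof -
  show Qc: "Q \<in> carrier_mat N R" using Q by (simp add: sparse_program_def is_arg_min_def)
  have feas: "frobenius_norm (\<Psi> * Q - A) \<le> \<tau>" and min: "norm_1_2 Q \<le> norm_1_2 Q'"
    using Q Q' by (auto simp: sparse_program_def is_arg_min_def not_less)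
  define H where "H = rowf (Q - Q')"
  have H: "H n c = Q $$ (n, c) - Q' $$ (n, c)" if "n < N" "c < R" for n c
    using that Qc Q'(1) by (simp add: H_def rowf_def)
  let ?q = "\<lambda>X n. sqrt (\<Sum>c<R. (X n c)\<^sup>2)"
  have L2: "?q X n = L2_set (X n) {..<R}" for X n by (simp add: L2_set_def)
  have fT: "finite T" using T finite_subset by blast
  have split: "(\<Sum>n<N. f n) = (\<Sum>n\<in>T. f n) + (\<Sum>n\<in>{..<N} - T. f n)" for f :: "nat \<Rightarrow> real"
    using sum.subset_diff[OF T(1), of f] by simp
  have "(\<Sum>n<N. ?q (rowf Q) n) \<le> (\<Sum>n<N. ?q (rowf Q') n)"
    using min by (simp add: norm_1_2_alt[OF Qc] norm_1_2_alt[OF Q'(1)] rowf_def)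
  moreover have "(\<Sum>n\<in>{..<N} - T. ?q (rowf Q') n) = 0"
    using supp by (intro sum.neutral) (simp add: rowf_def)
  moreover have "(\<Sum>n\<in>{..<N} - T. ?q H n) = (\<Sum>n\<in>{..<N} - T. ?q (rowf Q) n)"
    using supp by (intro sum.cong refl) (simp add: H rowf_def)
  moreover have "(\<Sum>n\<in>T. ?q (rowf Q') n) \<le> (\<Sum>n\<in>T. ?q (rowf Q) n + ?q H n)"
  proof (rule sum_mono)
    fix n assume n: "n \<in> T"
    have "?q (rowf Q') n = L2_set (\<lambda>c. rowf Q n c + - H n c) {..<R}"
      unfolding L2 using n T(1) by (intro L2_set_cong refl) (auto simp: H rowf_def)
    also have "\<dots> \<le> L2_set (rowf Q n) {..<R} + L2_set (\<lambda>c. - H n c) {..<R}" by (rule L2_set_triangle_ineq)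
    also have "L2_set (\<lambda>c. - H n c) {..<R} = L2_set (H n) {..<R}" by (simp add: L2_set_def)
    finally show "?q (rowf Q') n \<le> ?q (rowf Q) n + ?q H n" by (simp only: L2)
  qed
  ultimately have cone: "(\<Sum>n\<in>{..<N} - T. ?q H n) \<le> (\<Sum>n\<in>T. ?q H n)"
    unfolding split by (simp add: sum.distrib)
  have D: "Q - Q' \<in> carrier_mat N R" by (rule minus_carrier_mat[OF Q'(1)])
  have "frobenius_norm (Q - Q') = sqrt (\<Sum>n<N. \<Sum>c<R. (H n c)\<^sup>2)"
    using Qc Q'(1) by (simp add: frobenius_norm_def H_def rowf_def)
  also have "\<dots> \<le> 3 * sqrt (\<Sum>c<R. \<Sum>a<M. (ip N (rowf \<Psi> a) (\<lambda>n. H n c))\<^sup>2)"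
    by (rule joint_sparse_recovery[OF rip \<delta> K T cone])
  also have "(\<lambda>c n. H n c) = colf (Q - Q')" by (simp add: H_def rowf_def colf_def fun_eq_iff)
  then have "(\<Sum>c<R. \<Sum>a<M. (ip N (rowf \<Psi> a) (\<lambda>n. H n c))\<^sup>2) = (\<Sum>c<R. \<Sum>a<M. (ip N (rowf \<Psi> a) (colf (Q - Q') c))\<^sup>2)"
    by (metis (no_types))
  also have "sqrt \<dots> = frobenius_norm (\<Psi> * (Q - Q'))" by (rule frobenius_norm_mult_cols[OF \<Psi> D, symmetric])
  also have "\<Psi> * (Q - Q') = \<Psi> * Q - \<Psi> * Q'" by (rule mult_minus_distrib_mat[OF \<Psi> Qc Q'(1)])
  also have "frobenius_norm (\<Psi> * Q - \<Psi> * Q') \<le> frobenius_norm (\<Psi> * Q - A) + frobenius_norm (A - \<Psi> * Q')"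
    by (rule frobenius_norm_triangle_diff[of _ M R]) (use \<Psi> Qc Q' A in auto)
  also have "frobenius_norm (A - \<Psi> * Q') = frobenius_norm (\<Psi> * Q' - A)"
    by (rule frobenius_norm_minus_commute[of _ M R]) (use \<Psi> Q' A in auto)
  finally show "frobenius_norm (Q - Q') \<le> 6 * \<tau>" using feas Q'(2) by simp
qed

text \<open>Turns the rank into a factorisation, the form in which the spectral argument uses it: a
  maximal independent set of columns has \<open>R\<close> members and spans all columns.\<close>

lemma rank_factorization:
  fixes S :: "real mat"
  assumes S: "S \<in> carrier_mat N N" and R: "vec_space.rank N S = R"
  shows "\<exists>F G. \<forall>a<N. \<forall>b<N. S $$ (a, b) = (\<Sum>k<R. F a k * G k b)"
proof -
  interpret vec_space "TYPE(real)" N .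
  have cols: "set (cols S) \<subseteq> carrier_vec N" using cols_dim S by blast
  obtain X where fX: "finite X" and max: "maximal X (\<lambda>T. T \<subseteq> set (cols S) \<and> lin_indpt T)"
    using maximal_exists_superset[of "set (cols S)" "\<lambda>T. T \<subseteq> set (cols S) \<and> lin_indpt T" "{}"] finite_lin_indpt2[of "{}"]
    by auto
  have X: "X \<subseteq> set (cols S)" "lin_indpt X" "card X = R"
    using max rank_card_indpt[OF S max] R by (auto simp: maximal_def)
  then have Xc: "X \<subseteq> carrier_vec N" using cols by blast
  have "\<exists>c. lincomb c X = v" if v: "v \<in> set (cols S)" for v
  proof -
    have vc: "v \<in> carrier_vec N" using v cols by blast
    have "v \<in> span X"
    proof (rule ccontr)
      assume n: "v \<notin> span X"
      have "v \<notin> X" using n span_mem[OF Xc] by blast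
      then have "lin_indpt (X \<union> {v})" using lin_dep_iff_in_span[OF Xc X(2) vc] n by blast
      moreover have "X \<union> {v} \<subseteq> set (cols S)" using X(1) v by auto
      ultimately have "X \<union> {v} = X" using max unfolding maximal_def by blast
      then show False using \<open>v \<notin> X\<close> by blast
    qed
    then show ?thesis using finite_in_span[OF fX Xc] by blast
  qed
  then have "\<forall>b. \<exists>c. b < N \<longrightarrow> lincomb c X = col S b"
    using S by (metis carrier_matD(2) cols_length cols_nth nth_mem)
  then obtain c where c: "\<And>b. b < N \<Longrightarrow> lincomb (c b) X = col S b" by metis
  obtain h where h: "bij_betw h {..<R} X"
    using ex_bij_betw_nat_finite[OF fX] X(3) by (auto simp: atLeast0LessThan)
  have "S $$ (a, b) = (\<Sum>k<R. (h k $ a) * c b (h k))" if "a < N" "b < N" for a b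
  proof -
    have "S $$ (a, b) = lincomb (c b) X $ a" using c[OF that(2)] S that by simp
    also have "\<dots> = (\<Sum>x\<in>X. c b x * x $ a)" by (rule lincomb_index[OF that(1) Xc])
    also have "\<dots> = (\<Sum>k<R. c b (h k) * h k $ a)" by (rule sum.reindex_bij_betw[OF h, symmetric])
    finally show ?thesis by (simp add: mult.commute)
  qed
  then show ?thesis by (intro exI[of _ "\<lambda>a k. h k $ a"] exI[of _ "\<lambda>k b. c b (h k)"]) auto
qed

section \<open>Error of the low-rank stage\<close>

lemma sum_pairs_le:
  fixes f :: "nat \<Rightarrow> real"
  assumes "\<And>l. 0 \<le> f l" "2 * n \<le> L"
  shows "(\<Sum>l<n. f (2 * l) + f (2 * l + 1)) \<le> (\<Sum>l<L. f l)"
proof -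
  have "(\<Sum>l<n. f (2 * l) + f (2 * l + 1)) = (\<Sum>l<2 * n. f l)" by (induction n) auto
  also have "\<dots> \<le> (\<Sum>l<L. f l)" using assms by (intro sum_mono2) auto
  finally show ?thesis .
qed

lemma quad_meas_index:
  assumes "B \<in> carrier_mat M M" "l < L"
  shows "quad_meas L (\<lambda>l. Matrix.vec M (\<omega> l)) B $ l = bform M (rowf B) (\<omega> l) (\<omega> l)"
  using assms by (simp add: quad_meas_def bform_def ip_def rowf_def scalar_prod_def atLeast0LessThan)

lemma l2_norm_L2_set: "v \<in> carrier_vec n \<Longrightarrow> l2_norm v = L2_set (\<lambda>i. v $ i) {..<n}"
  by (simp add: l2_norm_def L2_set_def scalar_prod_def atLeast0LessThan power2_eq_square)

text \<open>Both \<open>B\<close> and \<open>Bs\<close> fit the data up to \<epsilon>, so the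
  measurements of their difference have norm at most \<open>2 * \<epsilon>\<close>. The last claim
  holds because truncation to the top \<open>R\<close> eigenvectors is a best approximation of rank
  \<open>R\<close>, and \<open>Bs\<close> is a competitor.\<close>

lemma stage_1_error:
  fixes B Bs U :: "real mat"
  assumes R: "1 \<le> R" and L: "2 \<le> L"
    and sens: "\<And>X c. low_rank M (589826 * R) c X \<Longrightarrow>
      sens (L div 2) M X \<omega> \<le> 8 * real (L div 2) * sqrt (frob2 M X) \<and>
      real (L div 2) * sqrt (frob2 M X) / 24 \<le> sens (L div 2) M X \<omega>"
    and Bs: "sym_psd M Bs" and fac: "\<And>a b. a < M \<Longrightarrow> b < M \<Longrightarrow> Bs $$ (a, b) = (\<Sum>k<R. F a k * G k b)"
    and z: "z \<in> carrier_vec L" "l2_norm z \<le> \<epsilon>"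
    and B: "stage_1 M L (\<lambda>l. Matrix.vec M (\<omega> l)) (quad_meas L (\<lambda>l. Matrix.vec M (\<omega> l)) Bs + z) \<epsilon> B"
    and U: "top_eigenvectors M R B U"
  shows "B \<in> carrier_mat M M" "isometry M R U"
    "frobenius_norm (B - Bs) \<le> 300 * \<epsilon> / sqrt (real L)"
    "frobenius_norm (B - B * U * transpose_mat U) \<le> frobenius_norm (B - Bs)"
proof -
  let ?w = "\<lambda>l. Matrix.vec M (\<omega> l)"
  let ?y = "quad_meas L ?w Bs + z"
  have Bpsd: "sym_psd M B" and Bfeas: "l2_norm (quad_meas L ?w B - ?y) \<le> \<epsilon>"
    and Bmin: "\<And>A. sym_psd M A \<Longrightarrow> l2_norm (quad_meas L ?w A - ?y) \<le> \<epsilon> \<Longrightarrow> trace_mat B \<le> trace_mat A"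
    using B by (auto simp: stage_1_def is_arg_min_def not_less)
  show Bc: "B \<in> carrier_mat M M" using Bpsd by (simp add: sym_psd_def)
  have Bsc: "Bs \<in> carrier_mat M M" and Bst: "transpose_mat Bs = Bs" using Bs by (auto simp: sym_psd_def)
  have qc: "quad_meas L ?w A \<in> carrier_vec L" for A by (simp add: quad_meas_def)
  obtain P ev where RM: "R \<le> M" and P: "orthogonal_matrix_n M P"
    and eig: "\<And>j. j < M \<Longrightarrow> eigenvector B (Matrix.col P j) (ev j)"
    and top: "\<And>i j. i < R \<Longrightarrow> R \<le> j \<Longrightarrow> j < M \<Longrightarrow> ev j \<le> ev i" and UP: "U = first_cols R P"
    using U unfolding top_eigenvectors_def by blast
  show Uiso: "isometry M R U" unfolding UP by (rule isometry_first_cols[OF P RM])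
  have Pc: "P \<in> carrier_mat M M" and Piso: "isometry M M P" using P by (auto simp: orthogonal_matrix_n_def isometry_def)
  define p where "p = colf P"
  have p: "ip M (p i) (p j) = (if i = j then 1 else 0)" if "i < M" "j < M" for i j
    unfolding p_def by (rule isometry_ip[OF Piso that])
  have Bp: "ip M (rowf B a) (p j) = ev j * p j a" if "a < M" "j < M" for a j
  proof -
    have "(B *\<^sub>v col P j) $ a = (ev j \<cdot>\<^sub>v col P j) $ a" using eig[OF that(2)] by (simp add: eigenvector_def)
    then show ?thesis using Bc Pc that by (simp add: scalar_prod_def ip_def rowf_def p_def colf_def atLeast0LessThan)
  qed
  \<comment> \<open>The spectral form of \<open>B\<close> is built from the eigenbasis that the
    procedure has picked, because \<open>U\<close> consists of the first columns of that
    basis.\<close>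
  have B_spec: "rowf B a b = spec_sum ev p {..<M} a b" if "a < M" "b < M" for a b
  proof -
    have PPt: "P * transpose_mat P = 1\<^sub>m M"
      using mat_mult_left_right_inverse[of "transpose_mat P" M P] P Pc by (simp add: orthogonal_matrix_n_def)
    have "B = B * P * transpose_mat P" using Bc Pc PPt by (simp add: assoc_mult_mat[of B M M P M])
    then have "B $$ (a, b) = (B * P * transpose_mat P) $$ (a, b)" by simp
    also have "\<dots> = ip M (rowf (B * P) a) (colf (transpose_mat P) b)"
      by (rule mult_entry) (use Bc Pc that in auto)
    also have "\<dots> = (\<Sum>i<M. (ev i * p i a) * p i b)"
      unfolding ip_def[of M "rowf (B * P) a"]
    proof (intro sum.cong refl arg_cong2[where f = times])
      fix i assume i: "i \<in> {..<M}"
      show "rowf (B * P) a i = ev i * p i a"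
        using mult_entry[OF Bc Pc that(1), of i] Bp[OF that(1), of i] i by (simp add: rowf_def[of "B * P"] p_def)
      show "colf (transpose_mat P) b i = p i b" using Pc that i by (simp add: colf_def p_def)
    qed
    finally show ?thesis by (simp add: rowf_def spec_sum_def)
  qed
  have ev: "0 \<le> ev i" if "i < M" for i
  proof -
    have "0 \<le> scalar_prod (col P i) (B *\<^sub>v col P i)"
      using Bpsd Pc that by (auto simp: sym_psd_def)
    also have "scalar_prod (col P i) (B *\<^sub>v col P i) = ip M (p i) (\<lambda>a. ip M (rowf B a) (p i))"
      using Bc Pc that by (simp add: scalar_prod_def ip_def rowf_def p_def colf_def atLeast0LessThan)
    also have "\<dots> = ip M (p i) (\<lambda>a. ev i * p i a)" using Bp[OF _ that] by (simp add: ip_def)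
    also have "\<dots> = ev i * ip M (p i) (p i)" by (simp add: ip_def sum_distrib_left algebra_simps)
    finally show ?thesis using p[OF that that] by simp
  qed
  have sym: "rowf Bs a b = rowf Bs b a" if "a < M" "b < M" for a b
  proof -
    have "transpose_mat Bs $$ (a, b) = Bs $$ (b, a)" using Bsc that by simp
    then show ?thesis using Bst by (simp add: rowf_def)
  qed
  have "low_rank M R (sqrt (frob2 M (rowf Bs))) (rowf Bs)"
    by (rule low_rank_factorization[OF sym]) (use fac in \<open>simp_all add: rowf_def\<close>)
  then obtain \<mu> q where q: "orthfam M R q" and Bs_spec: "\<And>a b. a < M \<Longrightarrow> b < M \<Longrightarrow> rowf Bs a b = spec_sum \<mu> q {..<R} a b"
    unfolding low_rank_def spec_sum_def by blast
  have "trace_mat B \<le> trace_mat Bs"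
  proof (rule Bmin[OF Bs])
    have "quad_meas L ?w Bs - ?y = - z" using z(1) qc[of Bs] by (intro eq_vecI) auto
    then show "l2_norm (quad_meas L ?w Bs - ?y) \<le> \<epsilon>" using z by (simp add: l2_norm_def)
  qed
  moreover have "trace_mat B = (\<Sum>i<M. ev i)"
  proof -
    have "trace_mat B = (\<Sum>a<M. spec_sum ev p {..<M} a a)"
      using Bc B_spec by (simp add: trace_mat_def rowf_def)
    also have "\<dots> = (\<Sum>i<M. ev i * ip M (p i) (p i))"
      unfolding spec_sum_def by (subst sum.swap) (simp add: ip_def sum_distrib_left mult.assoc)
    finally show ?thesis by (simp add: p)
  qed
  moreover have "trace_mat Bs = (\<Sum>a<M. spec_sum \<mu> q {..<R} a a)"
    using Bsc Bs_spec by (simp add: trace_mat_def rowf_def)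
  ultimately have trace: "(\<Sum>i<M. ev i) \<le> (\<Sum>a<M. spec_sum \<mu> q {..<R} a a)" by simp
  define n where "n = L div 2"
  have n: "0 < n" "2 * n \<le> L" "real L \<le> 3 * real n"
  proof -
    have "L \<le> 3 * (L div 2)" using L by presburger
    then have "real L \<le> real (3 * (L div 2))" by (rule of_nat_mono)
    then show "real L \<le> 3 * real n" by (simp add: n_def)
  qed (use L in \<open>auto simp: n_def\<close>)
  define H where "H = (\<lambda>a b. spec_sum ev p {..<M} a b - spec_sum \<mu> q {..<R} a b)"
  have H: "H a b = rowf B a b - rowf Bs a b" if "a < M" "b < M" for a b
    using B_spec Bs_spec that by (simp add: H_def)
  have fro: "frobenius_norm (B - Bs) = sqrt (frob2 M H)"
  proof -
    have "frob2 M H = frob2 M (rowf (B - Bs))"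
      by (rule frob2_cong) (use Bc Bsc H in \<open>simp add: rowf_def\<close>)
    then show ?thesis using frobenius_norm_frob2[OF minus_carrier_mat[OF Bsc]] by simp
  qed
  have main: "real n * sqrt (frob2 M H) \<le> 96 * sens n M H \<omega>"
    unfolding H_def
    by (rule trace_minimizer_error[OF p q R RM ev top trace n(1)]) (use sens in \<open>simp_all add: n_def\<close>)
  define d where "d l = bform M H (\<omega> l) (\<omega> l)" for l
  have d: "d l = (quad_meas L ?w B - ?y) $ l + z $ l" if "l < L" for l
  proof -
    have "d l = bform M (\<lambda>a b. rowf B a b - rowf Bs a b) (\<omega> l) (\<omega> l)"
      unfolding d_def by (rule bform_cong) (rule H)
    also have "\<dots> = bform M (rowf B) (\<omega> l) (\<omega> l) - bform M (rowf Bs) (\<omega> l) (\<omega> l)"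
      by (simp add: bform_def ip_def sum_subtractf left_diff_distrib right_diff_distrib)
    finally show ?thesis
      using that qc[of Bs] z(1) quad_meas_index[OF Bc that, of \<omega>] quad_meas_index[OF Bsc that, of \<omega>] by simp
  qed
  have "sens n M H \<omega> \<le> (\<Sum>l<n. \<bar>d (2 * l)\<bar> + \<bar>d (2 * l + 1)\<bar>) / 2"
    unfolding sens_def d_def[symmetric] sum_divide_distrib
    by (intro sum_mono divide_right_mono abs_triangle_ineq4) simp
  \<comment> \<open>For odd \<open>L\<close> the last measurement has no partner and is dropped from
    the pairs.\<close>
  also have "\<dots> \<le> (\<Sum>l<L. \<bar>d l\<bar>) / 2" using sum_pairs_le[of "\<lambda>l. \<bar>d l\<bar>", OF _ n(2)] by simp
  also have "(\<Sum>l<L. \<bar>d l\<bar>) = (\<Sum>l<L. \<bar>1\<bar> * \<bar>d l\<bar>)" by simp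
  also have "\<dots> \<le> L2_set (\<lambda>_. 1) {..<L} * L2_set d {..<L}" by (rule L2_set_mult_ineq)
  also have "L2_set (\<lambda>_. 1 :: real) {..<L} = sqrt (real L)" by (simp add: L2_set_def)
  finally have "sens n M H \<omega> \<le> sqrt (real L) * L2_set d {..<L} / 2" by simp
  moreover have "L2_set d {..<L} \<le> 2 * \<epsilon>"
  proof -
    have "L2_set d {..<L} = L2_set (\<lambda>l. (quad_meas L ?w B - ?y) $ l + z $ l) {..<L}"
      by (rule L2_set_cong) (use d in auto)
    also have "\<dots> \<le> L2_set (\<lambda>l. (quad_meas L ?w B - ?y) $ l) {..<L} + L2_set (\<lambda>l. z $ l) {..<L}"
      by (rule L2_set_triangle_ineq)
    also have "\<dots> = l2_norm (quad_meas L ?w B - ?y) + l2_norm z"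
      using z(1) qc by (subst (1 2) l2_norm_L2_set[of _ L]) auto
    finally show ?thesis using Bfeas z(2) by simp
  qed
  ultimately have "sens n M H \<omega> \<le> sqrt (real L) * \<epsilon>"
    using mult_left_mono[of "L2_set d {..<L}" "2 * \<epsilon>" "sqrt (real L)"] by simp
  then have "real n * sqrt (frob2 M H) \<le> 96 * (sqrt (real L) * \<epsilon>)" using main by simp
  moreover have "real L * sqrt (frob2 M H) \<le> 3 * real n * sqrt (frob2 M H)" using n(3) by (intro mult_right_mono) auto
  \<comment> \<open>288 = 3 * 96, with the 3 from \<open>L \<le> 3 * n\<close>; it is rounded up to
    300 below.\<close>
  ultimately have "real L * sqrt (frob2 M H) \<le> 288 * (sqrt (real L) * \<epsilon>)" by simp
  then have "sqrt (real L) * (sqrt (real L) * sqrt (frob2 M H)) \<le> sqrt (real L) * (288 * \<epsilon>)"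
    by (simp add: mult.assoc[symmetric])
  then have "sqrt (real L) * sqrt (frob2 M H) \<le> 288 * \<epsilon>" using L by simp
  moreover have "0 \<le> \<epsilon>"
  proof -
    have "0 \<le> l2_norm z" using z(1) by (simp add: l2_norm_L2_set[of _ L])
    then show ?thesis using z(2) by simp
  qed
  ultimately have "sqrt (frob2 M H) * sqrt (real L) \<le> 300 * \<epsilon>" by (simp add: mult.commute)
  then show "frobenius_norm (B - Bs) \<le> 300 * \<epsilon> / sqrt (real L)"
    unfolding fro using L by (simp add: pos_le_divide_eq)
  have "frobenius_norm (B - B * U * transpose_mat U) = sqrt (frob2 M (spec_sum ev p {R..<M}))"
  proof -
    note Uc = isometry_carrier[OF Uiso]
    have BUU: "B * U * transpose_mat U \<in> carrier_mat M M" using mult_carrier_mat[OF mult_carrier_mat[OF Bc Uc]] Uc by simp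
    have "rowf (B - B * U * transpose_mat U) a b = spec_sum ev p {R..<M} a b" if ab: "a < M" "b < M" for a b
    proof -
      have "(B * U * transpose_mat U) $$ (a, b) = ip R (rowf (B * U) a) (colf (transpose_mat U) b)"
        by (rule mult_entry) (use Bc Uc ab in auto)
      also have "\<dots> = (\<Sum>i<R. (ev i * p i a) * p i b)"
        unfolding ip_def[of R]
      proof (intro sum.cong refl arg_cong2[where f = times])
        fix i assume i: "i \<in> {..<R}"
        have Ui: "colf U i c = p i c" if "c < M" for c
          using Pc that i RM by (simp add: UP first_cols_def colf_def p_def)
        have "rowf (B * U) a i = ip M (rowf B a) (colf U i)"
          using mult_entry[OF Bc Uc ab(1), of i] i by (simp add: rowf_def[of "B * U"])
        also have "\<dots> = ip M (rowf B a) (p i)" using Ui by (simp add: ip_def)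
        finally show "rowf (B * U) a i = ev i * p i a" using Bp[OF ab(1), of i] i RM by simp
        have "colf (transpose_mat U) b i = colf U i b" using Uc ab i by (simp add: colf_def)
        then show "colf (transpose_mat U) b i = p i b" using Ui ab by simp
      qed
      finally have "rowf (B - B * U * transpose_mat U) a b = spec_sum ev p {..<M} a b - spec_sum ev p {..<R} a b"
        using BUU ab B_spec[OF ab] Bc Uc by (simp add: rowf_def spec_sum_def)
      then show ?thesis
        using sum.atLeastLessThan_concat[OF le0 RM, of "\<lambda>i. ev i * p i a * p i b"] by (simp add: spec_sum_def atLeast0LessThan)
    qed
    then have "frob2 M (rowf (B - B * U * transpose_mat U)) = frob2 M (spec_sum ev p {R..<M})"
      by (rule frob2_cong)
    then show ?thesis using frobenius_norm_frob2[OF minus_carrier_mat[OF BUU]] by simp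
  qed
  also have "\<dots> \<le> sqrt (\<Sum>i\<in>{R..<M}. (ev i)\<^sup>2)"
    by (rule frob_spec_sum_le) (use p in \<open>auto simp: orthfam_def\<close>)
  also have "\<dots> \<le> sqrt (frob2 M H)"
    unfolding H_def by (intro real_sqrt_le_mono Eckart_Young[OF p q RM] power_mono top ev) auto
  finally show "frobenius_norm (B - B * U * transpose_mat U) \<le> frobenius_norm (B - Bs)" by (simp only: fro)
qed

text \<open>\<open>Q\<close> has only \<open>R\<close> columns, so its nonzero singular values are
  among the first \<open>R\<close>: the columns of \<open>V\<close> span the whole column space, and
  projecting onto them loses nothing.\<close>

lemma left_singular_vectors_project:
  assumes "top_left_singular_vectors N R R Q V" and RN: "R \<le> N"
  shows "isometry N R V" "transpose_mat Q * V * transpose_mat V = transpose_mat Q"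
proof -
  obtain P W sv where P: "orthogonal_matrix_n N P" and W: "orthogonal_matrix_n R W"
    and Q: "Q = P * Matrix.mat N R (\<lambda>(i, j). if i = j then sv i else 0) * transpose_mat W" and V: "V = first_cols R P"
    using assms(1) unfolding top_left_singular_vectors_def by blast
  let ?D = "Matrix.mat N R (\<lambda>(i, j). if i = j then sv i else 0 :: real)"
  let ?E = "Matrix.mat R R (\<lambda>(i, j). if i = j then sv i else 0 :: real)"
  have Pc: "P \<in> carrier_mat N N" and Wc: "W \<in> carrier_mat R R" using P W by (auto simp: orthogonal_matrix_n_def)
  show V_iso: "isometry N R V" unfolding V by (rule isometry_first_cols[OF P RN])
  note Vc = isometry_carrier[OF V_iso]
  have VtV: "transpose_mat V * V = 1\<^sub>m R" using V_iso by (simp add: isometry_def)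
  have PD: "P * ?D = V * ?E"
  proof (rule eq_matI)
    fix i j assume ij: "i < dim_row (V * ?E)" "j < dim_col (V * ?E)"
    then have ij: "i < N" "j < R" using Vc by auto
    have "(P * ?D) $$ (i, j) = ip N (rowf P i) (colf ?D j)" by (rule mult_entry) (use Pc ij in auto)
    also have "\<dots> = P $$ (i, j) * sv j"
      using ij RN by (simp add: ip_def rowf_def colf_def if_distrib cong: if_cong)
    also have "\<dots> = ip R (rowf V i) (colf ?E j)"
      using ij Pc by (simp add: ip_def rowf_def colf_def V first_cols_def if_distrib cong: if_cong)
    also have "\<dots> = (V * ?E) $$ (i, j)" by (rule mult_entry[symmetric]) (use Vc ij in auto)
    finally show "(P * ?D) $$ (i, j) = (V * ?E) $$ (i, j)" .
  qed (use Pc Vc in auto)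
  define X where "X = ?E * transpose_mat W"
  have Xc: "X \<in> carrier_mat R R" unfolding X_def by (rule mult_carrier_mat[of _ R R]) (use Wc in auto)
  have QX: "Q = V * X" unfolding Q PD X_def by (rule assoc_mult_mat) (use Vc Wc in auto)
  have Qt: "transpose_mat Q = transpose_mat X * transpose_mat V" unfolding QX by (rule transpose_mult[OF Vc Xc])
  have "transpose_mat Q * V = transpose_mat X * (transpose_mat V * V)"
    unfolding Qt by (rule assoc_mult_mat) (use Vc Xc in auto)
  also have "\<dots> = transpose_mat X" using Xc by (simp add: VtV)
  finally show "transpose_mat Q * V * transpose_mat V = transpose_mat Q" by (simp only: Qt)
qed

section \<open>Combination of the two sparse programs\<close>

lemma index_minus_carrier:
  "A \<in> carrier_mat m n \<Longrightarrow> B \<in> carrier_mat m n \<Longrightarrow> i < m \<Longrightarrow> j < n \<Longrightarrow>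
    (A - B) $$ (i, j) = A $$ (i, j) - B $$ (i, j)"
  by auto

lemma minus_minus_cancel_mat:
  fixes A :: "real mat"
  assumes "A \<in> carrier_mat m n" "B \<in> carrier_mat m n" "C \<in> carrier_mat m n"
  shows "A - C = (A - B) - (C - B)"
  by (rule eq_matI) (use assms in auto)

text \<open>In units of \<open>e = 300 * \<epsilon> / sqrt (real L)\<close>:
  \<open>\<Psi> * \<Sigma>\<close> is known up to 203 / 25, rounded up to 9, which gives the second
  tolerance 2700. The second program then errs by 6 * 9 and the projection by \<open>V\<close> costs
  at most 9 more; the total 63 is rounded up to 64, and 64 * 300 = 19200.\<close>

lemma two_stage_error:
  fixes \<Psi> \<Sigma> S :: "real mat"
  assumes \<Psi>: "\<Psi> \<in> carrier_mat M N" and rip: "rip K N \<Psi> \<delta>" and \<delta>: "0 \<le> \<delta>" "\<delta> \<le> 1 / 10"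
    and R: "1 \<le> R" "R \<le> K" "K \<le> N" and L: "2 \<le> L"
    and sens: "\<And>X c. low_rank M (589826 * R) c X \<Longrightarrow>
      sens (L div 2) M X \<omega> \<le> 8 * real (L div 2) * sqrt (frob2 M X) \<and>
      real (L div 2) * sqrt (frob2 M X) / 24 \<le> sens (L div 2) M X \<omega>"
    and \<Sigma>: "sym_psd N \<Sigma>" "vec_space.rank N \<Sigma> = R" "row_sparse K \<Sigma>"
    and z: "z \<in> carrier_vec L" "l2_norm z \<le> \<epsilon>"
    and out: "two_stage_output M N L R \<Psi> (\<lambda>l. Matrix.vec M (\<omega> l))
      (quad_meas L (\<lambda>l. Matrix.vec M (\<omega> l)) (\<Psi> * \<Sigma> * transpose_mat \<Psi>) + z) \<epsilon> 300 2700 S"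
  shows "frobenius_norm (S - \<Sigma>) \<le> 19200 * \<epsilon> / sqrt (real L)"
proof -
  define Bs where "Bs = \<Psi> * \<Sigma> * transpose_mat \<Psi>"
  define e where "e = 300 * \<epsilon> / sqrt (real L)"
  obtain B U Q1 V Q2 where B: "stage_1 M L (\<lambda>l. Matrix.vec M (\<omega> l)) (quad_meas L (\<lambda>l. Matrix.vec M (\<omega> l)) Bs + z) \<epsilon> B"
    and U: "top_eigenvectors M R B U" and Q1: "sparse_program N R \<Psi> (B * U) e Q1"
    and V: "top_left_singular_vectors N R R Q1 V"
    and Q2: "sparse_program N R \<Psi> (U * transpose_mat Q1 * V) (9 * e) Q2" and S: "S = Q2 * transpose_mat V"
    using out unfolding two_stage_output_def Bs_def e_def by (auto simp: mult.assoc)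
  have \<Sigma>c: "\<Sigma> \<in> carrier_mat N N" and \<Sigma>t: "transpose_mat \<Sigma> = \<Sigma>" using \<Sigma>(1) by (auto simp: sym_psd_def)
  have \<Psi>t: "transpose_mat \<Psi> \<in> carrier_mat N M" using \<Psi> by simp
  have \<Psi>\<Sigma>: "\<Psi> * \<Sigma> \<in> carrier_mat M N" using \<Psi> \<Sigma>c by simp
  have \<Sigma>\<Psi>t: "\<Sigma> * transpose_mat \<Psi> \<in> carrier_mat N M" using \<Psi> \<Sigma>c by simp
  have Bsc: "Bs \<in> carrier_mat M M" using mult_carrier_mat[OF \<Psi>\<Sigma> \<Psi>t] by (simp add: Bs_def)
  have Bs_alt: "Bs = \<Psi> * (\<Sigma> * transpose_mat \<Psi>)" unfolding Bs_def by (rule assoc_mult_mat[OF \<Psi> \<Sigma>c \<Psi>t])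
  have tr\<Psi>\<Sigma>: "transpose_mat (\<Psi> * \<Sigma>) = \<Sigma> * transpose_mat \<Psi>"
    by (simp only: transpose_mult[OF \<Psi> \<Sigma>c] \<Sigma>t)
  have "sym_psd M Bs"
    unfolding sym_psd_def
  proof (intro conjI ballI Bsc)
    show "transpose_mat Bs = Bs"
      unfolding Bs_def transpose_mult[OF \<Psi>\<Sigma> \<Psi>t] tr\<Psi>\<Sigma> by (simp add: assoc_mult_mat[OF \<Psi> \<Sigma>c \<Psi>t])
    fix x :: "real Matrix.vec" assume x: "x \<in> carrier_vec M"
    let ?u = "transpose_mat \<Psi> *\<^sub>v x"
    have u: "?u \<in> carrier_vec N" using \<Psi>t x by simp
    have "Bs *\<^sub>v x = \<Psi> *\<^sub>v (\<Sigma> *\<^sub>v ?u)"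
      unfolding Bs_def assoc_mult_mat_vec[OF \<Psi>\<Sigma> \<Psi>t x] by (rule assoc_mult_mat_vec[OF \<Psi> \<Sigma>c u])
    moreover have "scalar_prod ?u (\<Sigma> *\<^sub>v ?u) = scalar_prod x (\<Psi> *\<^sub>v (\<Sigma> *\<^sub>v ?u))"
      by (rule transpose_vec_mult_scalar[OF \<Psi> _ x]) (use \<Sigma>c u in auto)
    moreover have "0 \<le> scalar_prod ?u (\<Sigma> *\<^sub>v ?u)" using \<Sigma>(1) u by (auto simp: sym_psd_def)
    ultimately show "0 \<le> scalar_prod x (Bs *\<^sub>v x)" by simp
  qed
  note Bs_psd = this
  obtain F G where FG: "\<And>a b. a < N \<Longrightarrow> b < N \<Longrightarrow> \<Sigma> $$ (a, b) = (\<Sum>k<R. F a k * G k b)"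
    using rank_factorization[OF \<Sigma>c \<Sigma>(2)] by blast
  have fac: "Bs $$ (a, b) = (\<Sum>k<R. ip N (rowf \<Psi> a) (\<lambda>c. F c k) * ip N (G k) (rowf \<Psi> b))"
    if ab: "a < M" "b < M" for a b
  proof -
    have inner: "colf (\<Sigma> * transpose_mat \<Psi>) b c = (\<Sum>k<R. ip N (G k) (rowf \<Psi> b) * F c k)" if c: "c < N" for c
    proof -
      have "(\<Sigma> * transpose_mat \<Psi>) $$ (c, b) = ip N (rowf \<Sigma> c) (colf (transpose_mat \<Psi>) b)"
        by (rule mult_entry[OF \<Sigma>c \<Psi>t c ab(2)])
      also have "\<dots> = ip N (\<lambda>d. \<Sum>k<R. F c k * G k d) (rowf \<Psi> b)"
        unfolding ip_def using FG c ab \<Psi> by (intro sum.cong refl) (simp add: rowf_def colf_def)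
      also have "\<dots> = (\<Sum>k<R. F c k * ip N (G k) (rowf \<Psi> b))" by (rule ip_sum_left)
      finally show ?thesis by (simp add: colf_def mult.commute)
    qed
    have "Bs $$ (a, b) = ip N (rowf \<Psi> a) (colf (\<Sigma> * transpose_mat \<Psi>) b)"
      unfolding Bs_alt by (rule mult_entry[OF \<Psi> \<Sigma>\<Psi>t ab])
    also have "\<dots> = ip N (rowf \<Psi> a) (\<lambda>c. \<Sum>k<R. ip N (G k) (rowf \<Psi> b) * F c k)"
      unfolding ip_def[of N "rowf \<Psi> a"] by (intro sum.cong refl) (simp add: inner)
    also have "\<dots> = (\<Sum>k<R. ip N (G k) (rowf \<Psi> b) * ip N (rowf \<Psi> a) (\<lambda>c. F c k))"
      by (rule ip_sum_right[of N _ _ "\<lambda>k c. F c k"])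
    finally show ?thesis by (simp add: mult.commute)
  qed
  note st1 = stage_1_error[where F = "\<lambda>a k. ip N (rowf \<Psi> a) (\<lambda>c. F c k)" and G = "\<lambda>k b. ip N (G k) (rowf \<Psi> b)",
      OF R(1) L sens Bs_psd fac z B U]
  have Bc: "B \<in> carrier_mat M M" by (rule st1(1))
  have Uiso: "isometry M R U" by (rule st1(2))
  have BBs_raw: "frobenius_norm (B - Bs) \<le> 300 * \<epsilon> / sqrt (real L)" by (rule st1(3))
  have B_tail: "frobenius_norm (B - B * U * transpose_mat U) \<le> frobenius_norm (B - Bs)" by (rule st1(4))
  note Uc = isometry_carrier[OF Uiso]
  have Ut: "transpose_mat U \<in> carrier_mat R M" using Uc by simp
  have BBs: "frobenius_norm (B - Bs) \<le> e" using BBs_raw by (simp add: e_def)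
  have e0: "0 \<le> e" using BBs frobenius_norm_nonneg[of "B - Bs"] by linarith

  define T where "T = {i. i < N \<and> row \<Sigma> i \<noteq> 0\<^sub>v N}"
  have T: "T \<subseteq> {..<N}" "card T \<le> K" using \<Sigma>(3) \<Sigma>c by (auto simp: T_def row_sparse_def)
  have \<Sigma>_supp: "(\<Sigma> * X) $$ (n, c) = 0" if "n < N" "n \<notin> T" "c < r" "X \<in> carrier_mat N r" for X n c r
  proof -
    have "row \<Sigma> n = 0\<^sub>v N" using that by (simp add: T_def)
    then show ?thesis using that \<Sigma>c by simp
  qed
  have K: "1 \<le> K" using R by simp
  note ripf = rip_imp_rip_fun[OF rip \<Psi>]

  \<comment> \<open>The ideal solution of the first program for the computed \<open>U\<close>: its
    image is \<open>Bs * U\<close>, and its rows vanish wherever those of \<Sigma> do.\<close>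
  define Qs where "Qs = \<Sigma> * transpose_mat \<Psi> * U"
  have Qs_alt: "Qs = \<Sigma> * (transpose_mat \<Psi> * U)" unfolding Qs_def by (rule assoc_mult_mat[OF \<Sigma>c \<Psi>t Uc])
  have Qsc: "Qs \<in> carrier_mat N R" unfolding Qs_def by (rule mult_carrier_mat[OF \<Sigma>\<Psi>t Uc])
  have \<Psi>Qs: "\<Psi> * Qs = Bs * U" unfolding Qs_def Bs_alt by (rule assoc_mult_mat[OF \<Psi> \<Sigma>\<Psi>t Uc, symmetric])
  have BU: "B * U \<in> carrier_mat M R" by (rule mult_carrier_mat[OF Bc Uc])
  have feas1: "frobenius_norm (\<Psi> * Qs - B * U) \<le> e"
  proof -
    have "\<Psi> * Qs - B * U = (Bs - B) * U" unfolding \<Psi>Qs by (rule minus_mult_distrib_mat[OF Bsc Bc Uc, symmetric])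
    then have "frobenius_norm (\<Psi> * Qs - B * U) \<le> frobenius_norm (Bs - B)"
      using frobenius_norm_mult_isometry_le[OF minus_carrier_mat[OF Bc] Uiso] by simp
    also have "\<dots> = frobenius_norm (B - Bs)" by (rule frobenius_norm_minus_commute[OF Bsc Bc])
    finally show ?thesis using BBs by simp
  qed
  have Qs_supp: "Qs $$ (n, c) = 0" if "n < N" "n \<notin> T" "c < R" for n c
    unfolding Qs_alt using \<Sigma>_supp[OF that, of "transpose_mat \<Psi> * U"] \<Psi>t Uc by simp
  note err1 = sparse_program_error[OF \<Psi> ripf \<delta> K BU Q1 Qsc feas1 T Qs_supp]
  note Q1c = err1(1)

  let ?X = "\<Sigma> * transpose_mat \<Psi>"
  let ?Gm = "?X - ?X * U * transpose_mat U"
  have XU: "?X * U \<in> carrier_mat N R" by (rule mult_carrier_mat[OF \<Sigma>\<Psi>t Uc])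
  have XUU: "?X * U * transpose_mat U \<in> carrier_mat N M" by (rule mult_carrier_mat[OF XU Ut])
  have Gc: "?Gm \<in> carrier_mat N M" by (rule minus_carrier_mat[OF XUU])
  have BsU: "Bs * U \<in> carrier_mat M R" by (rule mult_carrier_mat[OF Bsc Uc])
  have BsUU: "Bs * U * transpose_mat U \<in> carrier_mat M M" by (rule mult_carrier_mat[OF BsU Ut])
  have BUU: "B * U * transpose_mat U \<in> carrier_mat M M" by (rule mult_carrier_mat[OF BU Ut])
  \<comment> \<open>\<open>U\<close> is adapted to \<open>B\<close>; for \<open>Bs\<close> the
    residual is that of \<open>Bs - B\<close> plus that of \<open>B\<close>, each at most
    \<open>e\<close>.\<close>
  have proj_Bs: "frobenius_norm (Bs - Bs * U * transpose_mat U) \<le> 2 * e"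
  proof -
    let ?D = "Bs - B"
    have Dc: "?D \<in> carrier_mat M M" by (rule minus_carrier_mat[OF Bc])
    have "?D * U * transpose_mat U = Bs * U * transpose_mat U - B * U * transpose_mat U"
      unfolding minus_mult_distrib_mat[OF Bsc Bc Uc] by (rule minus_mult_distrib_mat[OF BsU BU Ut])
    then have "Bs - Bs * U * transpose_mat U = (?D - ?D * U * transpose_mat U) + (B - B * U * transpose_mat U)"
      using Bsc Bc BsUU BUU by (intro eq_matI) auto
    moreover have "?D - ?D * U * transpose_mat U \<in> carrier_mat M M"
      by (rule minus_carrier_mat[OF mult_carrier_mat[OF mult_carrier_mat[OF Dc Uc] Ut]])
    ultimately have "frobenius_norm (Bs - Bs * U * transpose_mat U) \<le>
        frobenius_norm (?D - ?D * U * transpose_mat U) + frobenius_norm (B - B * U * transpose_mat U)"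
      using frobenius_norm_triangle[OF _ minus_carrier_mat[OF BUU]] by simp
    also have "\<dots> \<le> frobenius_norm ?D + frobenius_norm (B - Bs)"
      by (intro add_mono frobenius_norm_residual_le[OF Dc Uiso] B_tail)
    also have "frobenius_norm ?D = frobenius_norm (B - Bs)" by (rule frobenius_norm_minus_commute[OF Bsc Bc])
    finally show ?thesis using BBs by simp
  qed
  \<comment> \<open>Multiplying \<Sigma> from the right keeps its zero rows, so \<open>?Gm\<close>
    is row-sparse and the isometry carries the preceding bound from \<open>\<Psi> * ?Gm\<close> to
    \<open>?Gm\<close>.\<close>
  have G: "frobenius_norm ?Gm \<le> 53 / 25 * e"
  proof -
    have "frobenius_norm ?Gm \<le> 53 / 50 * frobenius_norm (\<Psi> * ?Gm)"
    proof (rule row_sparse_frobenius_norm_le[OF ripf \<delta>(2) \<Psi> Gc T])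
      fix n c assume nc: "n < N" "n \<notin> T" "c < M"
      have "(\<Sigma> * (transpose_mat \<Psi> * U * transpose_mat U)) $$ (n, c) = 0"
        by (rule \<Sigma>_supp[OF nc]) (use \<Psi>t Uc in auto)
      moreover have "?X * U * transpose_mat U = \<Sigma> * (transpose_mat \<Psi> * U * transpose_mat U)"
        unfolding assoc_mult_mat[OF \<Sigma>c \<Psi>t Uc] by (rule assoc_mult_mat[OF \<Sigma>c mult_carrier_mat[OF \<Psi>t Uc] Ut])
      ultimately show "?Gm $$ (n, c) = 0"
        unfolding index_minus_carrier[OF \<Sigma>\<Psi>t XUU nc(1,3)] \<Sigma>_supp[OF nc \<Psi>t] by simp
    qed
    also have "\<Psi> * ?Gm = Bs - Bs * U * transpose_mat U"
      unfolding mult_minus_distrib_mat[OF \<Psi> \<Sigma>\<Psi>t XUU] assoc_mult_mat[OF \<Psi> XU Ut, symmetric]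
        assoc_mult_mat[OF \<Psi> \<Sigma>\<Psi>t Uc, symmetric] Bs_alt ..
    finally show ?thesis using proj_Bs by simp
  qed
  have Q1Ut: "Q1 * transpose_mat U \<in> carrier_mat N M" by (rule mult_carrier_mat[OF Q1c Ut])
  have UQ1t: "U * transpose_mat Q1 \<in> carrier_mat M N" using Uc Q1c by simp
  \<comment> \<open>The defect of \<open>U * transpose_mat Q1\<close> as a substitute for
    \<open>\<Psi> * \<Sigma>\<close>. It consists of the range missed by \<open>U\<close>, at most
    \<open>53 / 25 * e\<close>, and the error of the first program, at most
    \<open>6 * e\<close>.\<close>
  define Y where "Y = \<Psi> * \<Sigma> - U * transpose_mat Q1"
  have Yc: "Y \<in> carrier_mat M N" unfolding Y_def by (rule minus_carrier_mat[OF UQ1t])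
  have Y: "frobenius_norm Y \<le> 203 / 25 * e"
  proof -
    have "transpose_mat (U * transpose_mat Q1) = Q1 * transpose_mat U"
      using transpose_mult[OF Uc, of "transpose_mat Q1" N] Q1c by simp
    then have "transpose_mat Y = ?X - Q1 * transpose_mat U"
      unfolding Y_def transpose_minus[OF \<Psi>\<Sigma> UQ1t] tr\<Psi>\<Sigma> by simp
    then have "frobenius_norm Y = frobenius_norm (?X - Q1 * transpose_mat U)"
      by (metis frobenius_norm_transpose)
    also have "\<dots> \<le> frobenius_norm ?Gm + frobenius_norm (?X * U * transpose_mat U - Q1 * transpose_mat U)"
      by (rule frobenius_norm_triangle_diff[OF \<Sigma>\<Psi>t XUU Q1Ut])
    also have "?X * U * transpose_mat U - Q1 * transpose_mat U = (Qs - Q1) * transpose_mat U"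
      unfolding Qs_def by (rule minus_mult_distrib_mat[OF XU Q1c Ut, symmetric])
    also have "frobenius_norm \<dots> \<le> frobenius_norm (Qs - Q1)"
      by (rule frobenius_norm_mult_isometry_transpose_le[OF minus_carrier_mat[OF Q1c] Uiso])
    also have "\<dots> = frobenius_norm (Q1 - Qs)" by (rule frobenius_norm_minus_commute[OF Qsc Q1c])
    finally show ?thesis using G err1(2) by simp
  qed

  have RN: "R \<le> N" using R by simp
  note Viso = left_singular_vectors_project(1)[OF V RN] and Vproj = left_singular_vectors_project(2)[OF V RN]
  note Vc = isometry_carrier[OF Viso]
  have Vt: "transpose_mat V \<in> carrier_mat R N" using Vc by simp
  have \<Sigma>V: "\<Sigma> * V \<in> carrier_mat N R" by (rule mult_carrier_mat[OF \<Sigma>c Vc])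
  have UQV: "U * transpose_mat Q1 * V \<in> carrier_mat M R" by (rule mult_carrier_mat[OF UQ1t Vc])
  have feas2: "frobenius_norm (\<Psi> * (\<Sigma> * V) - U * transpose_mat Q1 * V) \<le> 9 * e"
  proof -
    have "\<Psi> * (\<Sigma> * V) - U * transpose_mat Q1 * V = Y * V"
      unfolding Y_def minus_mult_distrib_mat[OF \<Psi>\<Sigma> UQ1t Vc] assoc_mult_mat[OF \<Psi> \<Sigma>c Vc] ..
    then have "frobenius_norm (\<Psi> * (\<Sigma> * V) - U * transpose_mat Q1 * V) \<le> frobenius_norm Y"
      using frobenius_norm_mult_isometry_le[OF Yc Viso] by simp
    then show ?thesis using Y e0 by linarith
  qed
  have \<Sigma>V_supp: "(\<Sigma> * V) $$ (n, c) = 0" if "n < N" "n \<notin> T" "c < R" for n c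
    by (rule \<Sigma>_supp[OF that Vc])
  note err2 = sparse_program_error[OF \<Psi> ripf \<delta> K UQV Q2 \<Sigma>V feas2 T \<Sigma>V_supp]
  note Q2c = err2(1)
  have \<Sigma>VV: "\<Sigma> * V * transpose_mat V \<in> carrier_mat N N" by (rule mult_carrier_mat[OF \<Sigma>V Vt])
  have final: "frobenius_norm (\<Sigma> - \<Sigma> * V * transpose_mat V) \<le> 9 * e"
  proof -
    let ?Z = "\<Sigma> - \<Sigma> * V * transpose_mat V"
    have "frobenius_norm ?Z \<le> 53 / 50 * frobenius_norm (\<Psi> * ?Z)"
    proof (rule row_sparse_frobenius_norm_le[OF ripf \<delta>(2) \<Psi> minus_carrier_mat[OF \<Sigma>VV] T])
      fix n c assume nc: "n < N" "n \<notin> T" "c < N"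
      have "(\<Sigma> * (V * transpose_mat V)) $$ (n, c) = 0" "(\<Sigma> * 1\<^sub>m N) $$ (n, c) = 0"
        by (rule \<Sigma>_supp[OF nc], use Vc in auto)+
      then show "?Z $$ (n, c) = 0"
        unfolding index_minus_carrier[OF \<Sigma>c \<Sigma>VV nc(1,3)] using assoc_mult_mat[OF \<Sigma>c Vc Vt] \<Sigma>c by simp
    qed
    \<comment> \<open>The projection by \<open>V\<close> fixes \<open>U * transpose_mat Q1\<close>,
      so that this term cancels: what \<open>V\<close> misses of \<open>\<Psi> * \<Sigma>\<close> is
      what it misses of \<open>Y\<close>.\<close>
    also have "\<Psi> * ?Z = Y - Y * V * transpose_mat V"
    proof -
      have \<Psi>\<Sigma>V: "\<Psi> * \<Sigma> * V \<in> carrier_mat M R" by (rule mult_carrier_mat[OF \<Psi>\<Sigma> Vc])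
      have "U * transpose_mat Q1 * V * transpose_mat V = U * (transpose_mat Q1 * V * transpose_mat V)"
        using Uc Q1c Vc Vt by (simp add: assoc_mult_mat[of _ M R _ N] assoc_mult_mat[of _ R N _ R] assoc_mult_mat[of _ M R _ R])
      then have id: "U * transpose_mat Q1 * V * transpose_mat V = U * transpose_mat Q1" by (simp only: Vproj)
      have e1: "Y * V * transpose_mat V = \<Psi> * \<Sigma> * V * transpose_mat V - U * transpose_mat Q1"
        unfolding Y_def minus_mult_distrib_mat[OF \<Psi>\<Sigma> UQ1t Vc] minus_mult_distrib_mat[OF \<Psi>\<Sigma>V UQV Vt] id ..
      have e2: "\<Psi> * ?Z = \<Psi> * \<Sigma> - \<Psi> * \<Sigma> * V * transpose_mat V"
        unfolding mult_minus_distrib_mat[OF \<Psi> \<Sigma>c \<Sigma>VV] assoc_mult_mat[OF \<Psi> \<Sigma>V Vt, symmetric] assoc_mult_mat[OF \<Psi> \<Sigma>c Vc, symmetric] ..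
      show ?thesis
        unfolding e1 e2 unfolding Y_def
        by (rule minus_minus_cancel_mat[OF \<Psi>\<Sigma> UQ1t mult_carrier_mat[OF \<Psi>\<Sigma>V Vt]])
    qed
    also have "frobenius_norm \<dots> \<le> frobenius_norm Y" by (rule frobenius_norm_residual_le[OF Yc Viso])
    finally show ?thesis using Y e0 by simp
  qed
  have "frobenius_norm (S - \<Sigma>) \<le> frobenius_norm (S - \<Sigma> * V * transpose_mat V) + frobenius_norm (\<Sigma> * V * transpose_mat V - \<Sigma>)"
    by (rule frobenius_norm_triangle_diff[OF _ \<Sigma>VV \<Sigma>c]) (use Q2c Vt S in auto)
  also have "S - \<Sigma> * V * transpose_mat V = (Q2 - \<Sigma> * V) * transpose_mat V"
    unfolding S by (rule minus_mult_distrib_mat[OF Q2c \<Sigma>V Vt, symmetric])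
  also have "frobenius_norm \<dots> \<le> frobenius_norm (Q2 - \<Sigma> * V)"
    by (rule frobenius_norm_mult_isometry_transpose_le[OF minus_carrier_mat[OF \<Sigma>V] Viso])
  also have "frobenius_norm (\<Sigma> * V * transpose_mat V - \<Sigma>) = frobenius_norm (\<Sigma> - \<Sigma> * V * transpose_mat V)"
    by (rule frobenius_norm_minus_commute[OF \<Sigma>VV \<Sigma>c])
  finally have "frobenius_norm (S - \<Sigma>) \<le> 64 * e" using err2(2) final e0 by simp
  then show ?thesis by (simp add: e_def)
qed

theorem theorem1:
  shows "\<exists>\<delta>\<^sub>0 C\<^sub>1 \<gamma> :: real. 0 < \<delta>\<^sub>0 \<and> \<delta>\<^sub>0 < 1 \<and> 0 < C\<^sub>1 \<and> 0 < \<gamma> \<and>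
    (\<forall>\<delta>::real. 0 < \<delta> \<and> \<delta> \<le> \<delta>\<^sub>0 \<longrightarrow>
      (\<exists>c\<^sub>1 c\<^sub>2 :: real. 0 < c\<^sub>1 \<and> 0 < c\<^sub>2 \<and> (\<exists>C\<^sub>2::real. 0 < C\<^sub>2 \<and>
        (\<forall>(R::nat) (K::nat) (N::nat) (M::nat) (L::nat) (\<Psi> :: real Matrix.mat).
           1 \<le> R \<and> R \<le> K \<and> K \<le> N \<and> 1 \<le> M \<and> 1 \<le> L \<and>
           \<Psi> \<in> carrier_mat M N \<and> rip K N \<Psi> \<delta> \<and>
           C\<^sub>1 * real R * real M \<le> real L \<longrightarrow>
           (\<exists>E \<in> sets (gaussian_vectors L M).
              measure (gaussian_vectors L M) E > 1 - exp (- \<gamma> * real M) \<and>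
              (\<forall>\<omega> \<in> E. \<forall>(\<Sigma> :: real Matrix.mat) (\<epsilon>::real) (z :: real Matrix.vec) (S :: real Matrix.mat).
                 let w = (\<lambda>l. Matrix.vec M (\<omega> l));
                     y = quad_meas L w (\<Psi> * \<Sigma> * transpose_mat \<Psi>) + z
                 in sym_psd N \<Sigma> \<and> vec_space.rank N \<Sigma> = R \<and> row_sparse K \<Sigma> \<and>
                    0 \<le> \<epsilon> \<and> z \<in> carrier_vec L \<and> l2_norm z \<le> \<epsilon> \<and>
                    two_stage_output M N L R \<Psi> w y \<epsilon> c\<^sub>1 c\<^sub>2 S \<longrightarrow>
                    frobenius_norm (S - \<Sigma>) \<le> C\<^sub>2 * \<epsilon> / sqrt (real L)))))))"
proof -
  \<comment> \<open>The multiple 589826 of \<open>R\<close> is the rank of the leading part of the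
    error in the trace minimisation.\<close>
  obtain C :: real where C: "0 < C"
    and event: "\<And>R M L. 1 \<le> R \<Longrightarrow> 1 \<le> M \<Longrightarrow> C * real R * real M \<le> real L \<Longrightarrow>
      2 \<le> L \<and> (\<exists>E\<in>sets (gaussian_vectors L M). measure (gaussian_vectors L M) E > 1 - exp (- real M) \<and>
        (\<forall>w\<in>E. \<forall>X c. low_rank M (589826 * R) c X \<longrightarrow>
          sens (L div 2) M X w \<le> 8 * real (L div 2) * sqrt (frob2 M X) \<and>
          real (L div 2) * sqrt (frob2 M X) / 24 \<le> sens (L div 2) M X w))"
    by (rule sens_event[of 589826]) (simp, rule that)
  have key: "\<exists>E \<in> sets (gaussian_vectors L M).
      measure (gaussian_vectors L M) E > 1 - exp (- 1 * real M) \<and>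
      (\<forall>\<omega> \<in> E. \<forall>(\<Sigma> :: real Matrix.mat) (\<epsilon>::real) (z :: real Matrix.vec) (S :: real Matrix.mat).
         let w = (\<lambda>l. Matrix.vec M (\<omega> l));
             y = quad_meas L w (\<Psi> * \<Sigma> * transpose_mat \<Psi>) + z
         in sym_psd N \<Sigma> \<and> vec_space.rank N \<Sigma> = R \<and> row_sparse K \<Sigma> \<and>
            0 \<le> \<epsilon> \<and> z \<in> carrier_vec L \<and> l2_norm z \<le> \<epsilon> \<and>
            two_stage_output M N L R \<Psi> w y \<epsilon> 300 2700 S \<longrightarrow>
            frobenius_norm (S - \<Sigma>) \<le> 19200 * \<epsilon> / sqrt (real L))"
    if \<delta>: "0 < \<delta> \<and> \<delta> \<le> 1 / 10"
      and asm: "1 \<le> R \<and> R \<le> K \<and> K \<le> N \<and> 1 \<le> M \<and> 1 \<le> L \<and>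
        \<Psi> \<in> carrier_mat M N \<and> rip K N \<Psi> \<delta> \<and> C * real R * real M \<le> real L"
    for \<delta> :: real and R K N M L :: nat and \<Psi> :: "real Matrix.mat"
  proof -
    have L: "2 \<le> L" and "\<exists>E\<in>sets (gaussian_vectors L M). measure (gaussian_vectors L M) E > 1 - exp (- real M) \<and>
        (\<forall>w\<in>E. \<forall>X c. low_rank M (589826 * R) c X \<longrightarrow>
          sens (L div 2) M X w \<le> 8 * real (L div 2) * sqrt (frob2 M X) \<and>
          real (L div 2) * sqrt (frob2 M X) / 24 \<le> sens (L div 2) M X w)"
      using event[of R M L] asm by auto
    then obtain E where E: "E \<in> sets (gaussian_vectors L M)" "measure (gaussian_vectors L M) E > 1 - exp (- real M)"
      and sens: "\<And>w X c. w \<in> E \<Longrightarrow> low_rank M (589826 * R) c X \<Longrightarrow>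
        sens (L div 2) M X w \<le> 8 * real (L div 2) * sqrt (frob2 M X) \<and>
        real (L div 2) * sqrt (frob2 M X) / 24 \<le> sens (L div 2) M X w"
      by (elim bexE conjE) (rule that, auto)
    show ?thesis
      unfolding Let_def
    proof (intro bexI[OF _ E(1)] conjI ballI allI impI)
      show "measure (gaussian_vectors L M) E > 1 - exp (- 1 * real M)" using E(2) by simp
    next
      fix \<omega> \<Sigma> \<epsilon> z S
      assume \<omega>: "\<omega> \<in> E"
        and s: "sym_psd N \<Sigma> \<and> vec_space.rank N \<Sigma> = R \<and> row_sparse K \<Sigma> \<and>
          0 \<le> \<epsilon> \<and> z \<in> carrier_vec L \<and> l2_norm z \<le> \<epsilon> \<and>
          two_stage_output M N L R \<Psi> (\<lambda>l. Matrix.vec M (\<omega> l))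
            (quad_meas L (\<lambda>l. Matrix.vec M (\<omega> l)) (\<Psi> * \<Sigma> * transpose_mat \<Psi>) + z) \<epsilon> 300 2700 S"
      show "frobenius_norm (S - \<Sigma>) \<le> 19200 * \<epsilon> / sqrt (real L)"
        by (rule two_stage_error[where K = K and \<Psi> = \<Psi> and \<delta> = \<delta>, OF _ _ _ _ _ _ _ L sens[OF \<omega>]])
          (use asm \<delta> s in auto)
    qed
  qed
  show ?thesis
  \<comment> \<open>The bound 1 / 10 is the one required by the recovery argument, and \<gamma> = 1
    since the event fails with probability below \<open>exp (- real M)\<close>.\<close>
  proof (rule exI[of _ "1 / 10"], rule exI[of _ C], rule exI[of _ 1], intro conjI allI impI, goal_cases)
    case (5 \<delta>)
    show ?case
      by (rule exI[of _ 300], rule exI[of _ 2700], intro conjI, simp, simp, rule exI[of _ 19200],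
          intro conjI allI impI, simp, rule key[OF 5])
  qed (use C in auto)
qed

end
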